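(* Let $g, r, d$ be non-negative integers. The function $M_g^{\mathrm{tr}} \to \mathbb{Z}$ sending (the isomorphism class of) a tropical curve $\Gamma$ of genus $g$ to its Brill-Noether rank $w_d^r(\Gamma)$ is upper semicontinuous on $M_g^{\mathrm{tr}}$, the moduli space of tropical curves of genus $g$.
   Context: Tropical curves. A tropical curve is a triple $\Gamma=(G,w,\ell)$ where $G$ is a finite connected graph (loops and multiple edges allowed), $\ell:E(G)\to\mathbb{R}_{>0}$ is a length function and $w:V(G)\to\mathbb{Z}_{\ge 0}$ is a weight function. It is identified with the compact metric space of the metric graph $(G,\ell)$. Its genus is $g(\Gamma)=|E(G)|-|V(G)|+1+\sum_{v}w(v)$. It is pure if $w=0$; the underlying pure tropical curve of $\Gamma$ is $\Gamma^0=(G,0,\ell)$. The combinatorial type of $\Gamma$ is $(G,w)$. Divisors. A divisor on $\Gamma$ is a finite integer combination of points of $\Gamma^0$; it is effective if all coefficients are non-negative, and its degree is the sum of the coefficients. An effective divisor $E$ is contained in $D$ if $D-E$ is effective. A rational function is a continuous piecewise linear function with integer slopes on the metric graph, and $\mathrm{div}(f)(p)$ is the sum of the incoming slopes of $f$ at $p$. Two divisors are linearly equivalent if they differ by some $\mathrm{div}(f)$. On a pure tropical curve, the rank of $D$ is $-1$ if $D$ is not linearly equivalent to an effective divisor, and otherwise is the largest $r$ such that for every effective $E$ of degree $r$, $D$ is linearly equivalent to an effective divisor containing $E$. For a general $\Gamma$, the rank of $D$ on $\Gamma$ is its rank as a divisor on the pure tropical curve $\Gamma^w_\epsilon$ obtained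 from $\Gamma^0$ by attaching $w(v)$ loops of length $\epsilon>0$ at each vertex $v$ (this is independent of $\epsilon$). Brill-Noether rank. $w_d^r(\Gamma)$ is the largest integer $\rho$ such that every effective divisor $E$ of degree $r+\rho$ on $\Gamma$ is contained in an effective divisor $D$ on $\Gamma$ of degree $d$ and rank at least $r$. By convention it is $-1$ if there is no divisor of degree $d$ and rank at least $r$. Moduli space. Fix a combinatorial type $(G,w)$. Points of $\mathbb{R}_{>0}^{E(G)}$ are identified with tropical curves of type $(G,w)$, the coordinates being edge lengths. A point $s\in\mathbb{R}_{\ge0}^{E(G)}$ corresponds to the curve $\Gamma_s$ obtained by contracting the edges $e$ with $s_e=0$, giving each other edge $e$ length $s_e$, and giving each vertex $v$ of the contracted graph weight equal to the genus (first Betti number plus sum of weights) of the connected subgraph of $(G,w)$ collapsed to $v$. Let $\mathrm{Aut}(G,w)$ be the group of weight-preserving automorphisms of $G$, acting on $\mathbb{R}_{\ge0}^{E(G)}$ by permuting coordinates, and put $\overline{C(G,w)}=\mathbb{R}_{\ge0}^{E(G)}/\mathrm{Aut}(G,w)$. Then $M_g^{\mathrm{tr}}=\coprod\overline{C(G,w)}/\sim$ with the quotient topology, the disjoint union being over all combinatorial types $(G,w)$ of genus $g$, and $\sim$ identifying two points when they correspond to isomorphic tropical curves. A function $\phi$ with integer values on a topological space is upper semicontinuous if $\{\phi\ge\rho\}$ is closed for every $\rho$. *)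

theory Defs
  imports
    "Graph_Theory.Digraph_Component"
    "HOL-Library.Poly_Mapping"
    "HOL-Analysis.Analysis"
begin

section \<open>Weighted graphs and tropical curves\<close>

text \<open>
  A graph (loops and multiple edges allowed) is represented by a digraph of the library: every
  edge carries an auxiliary orientation from its tail to its head. The orientation only serves to
  coordinatise edges; isomorphisms and automorphisms ignore it. The library's
  notion of connectedness is that of the underlying undirected graph and includes
  that there is at least one vertex.
\<close>

type_synonym ('v, 'e) wgraph = "('v, 'e) pre_digraph \<times> ('v \<Rightarrow> nat)"

type_synonym ('v, 'e) trop_curve = "('v, 'e) pre_digraph \<times> ('v \<Rightarrow> nat) \<times> ('e \<Rightarrow> real)"

definition genus :: "('v, 'e) pre_digraph \<Rightarrow> ('v \<Rightarrow> nat) \<Rightarrow> int" where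
  "genus G w = int (card (arcs G)) - int (card (verts G)) + 1 + (\<Sum>v\<in>verts G. int (w v))"

text \<open>The sets of end points are compared, so that an isomorphism may reverse orientations.\<close>

definition wgraph_iso ::
    "('v, 'e) pre_digraph \<Rightarrow> ('v \<Rightarrow> nat) \<Rightarrow> ('u, 'f) pre_digraph \<Rightarrow> ('u \<Rightarrow> nat) \<Rightarrow>
      ('v \<Rightarrow> 'u) \<Rightarrow> ('e \<Rightarrow> 'f) \<Rightarrow> bool" where
  "wgraph_iso G w H u \<phi> \<psi> \<longleftrightarrow>
     bij_betw \<phi> (verts G) (verts H) \<and> bij_betw \<psi> (arcs G) (arcs H) \<and>
     (\<forall>e\<in>arcs G. {tail H (\<psi> e), head H (\<psi> e)} = {\<phi> (tail G e), \<phi> (head G e)}) \<and>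
     (\<forall>v\<in>verts G. u (\<phi> v) = w v)"

fun trop_isomorphic :: "('v, 'e) trop_curve \<Rightarrow> ('u, 'f) trop_curve \<Rightarrow> bool" where
  "trop_isomorphic (G, w, l) (H, u, m) \<longleftrightarrow>
     (\<exists>\<phi> \<psi>. wgraph_iso G w H u \<phi> \<psi> \<and> (\<forall>e\<in>arcs G. m (\<psi> e) = l e))"


section \<open>Divisors and rational functions on metric graphs\<close>

text \<open>
  \<open>Inner e t\<close> is the point of the open edge \<open>e\<close> at distance \<open>t\<close> from the tail of \<open>e\<close>, measured
  along \<open>e\<close>.
\<close>

datatype ('v, 'e) point = Vert 'v | Inner 'e real

definition points :: "('v, 'e) pre_digraph \<Rightarrow> ('e \<Rightarrow> real) \<Rightarrow> ('v, 'e) point set" where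
  "points G l = Vert ` verts G \<union> {Inner e t |e t. e \<in> arcs G \<and> 0 < t \<and> t < l e}"

type_synonym 'p divisor = "'p \<Rightarrow>\<^sub>0 int"

definition divisor_on :: "'p set \<Rightarrow> 'p divisor \<Rightarrow> bool" where
  "divisor_on P D \<longleftrightarrow> Poly_Mapping.keys D \<subseteq> P"

definition effective :: "'p divisor \<Rightarrow> bool" where
  "effective D \<longleftrightarrow> (\<forall>p. 0 \<le> Poly_Mapping.lookup D p)"

definition deg :: "'p divisor \<Rightarrow> int" where
  "deg D = (\<Sum>p\<in>Poly_Mapping.keys D. Poly_Mapping.lookup D p)"

definition contained_in :: "'p divisor \<Rightarrow> 'p divisor \<Rightarrow> bool" where
  "contained_in E D \<longleftrightarrow> effective (D - E)"

text \<open>The restriction of a function to the closed edge \<open>e\<close>, as a function on \<open>[0, l e]\<close>.\<close>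

definition on_edge ::
    "('v, 'e) pre_digraph \<Rightarrow> ('e \<Rightarrow> real) \<Rightarrow> (('v, 'e) point \<Rightarrow> real) \<Rightarrow> 'e \<Rightarrow> real \<Rightarrow> real" where
  "on_edge G l f e t =
     (if t \<le> 0 then f (Vert (tail G e))
      else if t \<ge> l e then f (Vert (head G e))
      else f (Inner e t))"

definition pl_integer_slopes :: "real \<Rightarrow> (real \<Rightarrow> real) \<Rightarrow> bool" where
  "pl_integer_slopes L h \<longleftrightarrow>
     continuous_on {0..L} h \<and>
     (\<exists>S. finite S \<and>
        (\<forall>a b. 0 \<le> a \<and> a < b \<and> b \<le> L \<and> {a<..<b} \<inter> S = {} \<longrightarrow>
           (\<exists>k::int. \<forall>t\<in>{a..b}. h t = h a + of_int k * (t - a))))"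

definition rational_function ::
    "('v, 'e) pre_digraph \<Rightarrow> ('e \<Rightarrow> real) \<Rightarrow> (('v, 'e) point \<Rightarrow> real) \<Rightarrow> bool" where
  "rational_function G l f \<longleftrightarrow> (\<forall>e\<in>arcs G. pl_integer_slopes (l e) (on_edge G l f e))"

definition right_slope :: "(real \<Rightarrow> real) \<Rightarrow> real \<Rightarrow> int" where
  "right_slope h t = (THE k. \<forall>\<^sub>F u in at_right t. h u = h t + of_int k * (u - t))"

definition left_slope :: "(real \<Rightarrow> real) \<Rightarrow> real \<Rightarrow> int" where
  "left_slope h t = (THE k. \<forall>\<^sub>F u in at_left t. h u = h t + of_int k * (u - t))"

text \<open>
  The coefficient of \<open>p\<close> in \<open>div f\<close>: the sum of the slopes of \<open>f\<close> in the directions pointing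
  towards \<open>p\<close>. A loop at a vertex contributes through both of its ends.
\<close>

fun div_at ::
    "('v, 'e) pre_digraph \<Rightarrow> ('e \<Rightarrow> real) \<Rightarrow> (('v, 'e) point \<Rightarrow> real) \<Rightarrow> ('v, 'e) point \<Rightarrow> int" where
  "div_at G l f (Vert v) =
     (\<Sum>e\<in>in_arcs G v. left_slope (on_edge G l f e) (l e)) +
     (\<Sum>e\<in>out_arcs G v. - right_slope (on_edge G l f e) 0)"
| "div_at G l f (Inner e t) =
     left_slope (on_edge G l f e) t - right_slope (on_edge G l f e) t"

definition lin_equiv ::
    "('v, 'e) pre_digraph \<Rightarrow> ('e \<Rightarrow> real) \<Rightarrow>
      ('v, 'e) point divisor \<Rightarrow> ('v, 'e) point divisor \<Rightarrow> bool" where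
  "lin_equiv G l D D' \<longleftrightarrow>
     (\<exists>f. rational_function G l f \<and>
        (\<forall>p\<in>points G l. Poly_Mapping.lookup (D - D') p = div_at G l f p))"


section \<open>Rank and Brill-Noether rank\<close>

definition equiv_to_effective_containing ::
    "('v, 'e) pre_digraph \<Rightarrow> ('e \<Rightarrow> real) \<Rightarrow>
      ('v, 'e) point divisor \<Rightarrow> ('v, 'e) point divisor \<Rightarrow> bool" where
  "equiv_to_effective_containing G l D E \<longleftrightarrow>
     (\<exists>D'. divisor_on (points G l) D' \<and> effective D' \<and> lin_equiv G l D D' \<and> contained_in E D')"

definition pure_rank ::
    "('v, 'e) pre_digraph \<Rightarrow> ('e \<Rightarrow> real) \<Rightarrow> ('v, 'e) point divisor \<Rightarrow> int" where
  "pure_rank G l D =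
     (if \<not> (\<exists>D'. divisor_on (points G l) D' \<and> effective D' \<and> lin_equiv G l D D') then -1
      else int (GREATEST r::nat.
        \<forall>E. divisor_on (points G l) E \<and> effective E \<and> deg E = int r \<longrightarrow>
            equiv_to_effective_containing G l D E))"

definition attach_loops :: "('v, 'e) pre_digraph \<Rightarrow> ('v \<Rightarrow> nat) \<Rightarrow> ('v, 'e + 'v \<times> nat) pre_digraph" where
  "attach_loops G w =
     \<lparr> verts = verts G,
       arcs = Inl ` arcs G \<union> Inr ` (SIGMA v:verts G. {..<w v}),
       tail = case_sum (tail G) fst,
       head = case_sum (head G) fst \<rparr>"

definition attach_loops_length :: "real \<Rightarrow> ('e \<Rightarrow> real) \<Rightarrow> 'e + 'v \<times> nat \<Rightarrow> real" where
  "attach_loops_length \<epsilon> l = case_sum l (\<lambda>_. \<epsilon>)"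

primrec include_point :: "('v, 'e) point \<Rightarrow> ('v, 'e + 'v \<times> nat) point" where
  "include_point (Vert v) = Vert v"
| "include_point (Inner e t) = Inner (Inl e) t"

text \<open>
  The rank does not depend on the length \<open>\<epsilon> > 0\<close> of the attached loops. The choice of \<open>\<epsilon>\<close>
  is kept as a parameter, over which the final theorem quantifies universally.
\<close>

fun rank :: "real \<Rightarrow> ('v, 'e) trop_curve \<Rightarrow> ('v, 'e) point divisor \<Rightarrow> int" where
  "rank \<epsilon> (G, w, l) D =
     pure_rank (attach_loops G w) (attach_loops_length \<epsilon> l)
       (frag_extend (\<lambda>p. frag_of (include_point p)) D)"

text \<open>
  In the second case below the integer \<open>\<rho> = 0\<close> always qualifies, and no \<open>\<rho> > d - r\<close> does.
\<close>

fun bn_rank :: "real \<Rightarrow> nat \<Rightarrow> nat \<Rightarrow> ('v, 'e) trop_curve \<Rightarrow> int" where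
  "bn_rank \<epsilon> r d (G, w, l) =
     (if \<not> (\<exists>D. divisor_on (points G l) D \<and> deg D = int d \<and> int r \<le> rank \<epsilon> (G, w, l) D) then -1
      else (GREATEST \<rho>::int.
        \<forall>E. divisor_on (points G l) E \<and> effective E \<and> deg E = int r + \<rho> \<longrightarrow>
          (\<exists>D. divisor_on (points G l) D \<and> effective D \<and> deg D = int d \<and>
               int r \<le> rank \<epsilon> (G, w, l) D \<and> contained_in E D)))"


section \<open>The moduli space of tropical curves\<close>

text \<open>
  For \<open>s\<close> in the closed orthant, the vertices of the contracted graph are the connected
  components of the subgraph consisting of all vertices and of the edges of length \<open>0\<close>. If \<open>s\<close> is
  strictly positive then these are the singletons, and \<open>contract G w s\<close> is
  \<open>(G, w, s)\<close> up to renaming \<open>v\<close> to \<open>{v}\<close>.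
\<close>

definition zero_subgraph :: "('v, 'e) pre_digraph \<Rightarrow> ('e \<Rightarrow> real) \<Rightarrow> ('v, 'e) pre_digraph" where
  "zero_subgraph G s = G\<lparr>arcs := {e \<in> arcs G. s e = 0}\<rparr>"

definition zero_component :: "('v, 'e) pre_digraph \<Rightarrow> ('e \<Rightarrow> real) \<Rightarrow> 'v \<Rightarrow> 'v set" where
  "zero_component G s v = {u. reachable (with_proj (mk_symmetric (zero_subgraph G s))) v u}"

definition contract ::
    "('v, 'e) pre_digraph \<Rightarrow> ('v \<Rightarrow> nat) \<Rightarrow> ('e \<Rightarrow> real) \<Rightarrow> ('v set, 'e) trop_curve" where
  "contract G w s =
     (\<lparr> verts = zero_component G s ` verts G,
        arcs = {e \<in> arcs G. s e \<noteq> 0},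
        tail = (\<lambda>e. zero_component G s (tail G e)),
        head = (\<lambda>e. zero_component G s (head G e)) \<rparr>,
      (\<lambda>C. nat (genus (zero_subgraph G s \<restriction> C) w)),
      s)"

definition quotient_topology :: "'a topology \<Rightarrow> ('a \<Rightarrow> 'b) \<Rightarrow> 'b topology" where
  "quotient_topology X f =
     topology (\<lambda>U. U \<subseteq> f ` topspace X \<and> openin X {x \<in> topspace X. f x \<in> U})"

lemma openin_quotient_topology:
  "openin (quotient_topology X f) U \<longleftrightarrow>
     U \<subseteq> f ` topspace X \<and> openin X {x \<in> topspace X. f x \<in> U}"
proof -
  have "istopology (\<lambda>U. U \<subseteq> f ` topspace X \<and> openin X {x \<in> topspace X. f x \<in> U})"
    unfolding istopology_def
  proof (intro conjI allI impI; (elim conjE)?)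
    fix S T
    assume "openin X {x \<in> topspace X. f x \<in> S}" "openin X {x \<in> topspace X. f x \<in> T}"
    then have "openin X ({x \<in> topspace X. f x \<in> S} \<inter> {x \<in> topspace X. f x \<in> T})"
      by (rule openin_Int)
    moreover have "{x \<in> topspace X. f x \<in> S} \<inter> {x \<in> topspace X. f x \<in> T} =
        {x \<in> topspace X. f x \<in> S \<inter> T}"
      by blast
    ultimately show "openin X {x \<in> topspace X. f x \<in> S \<inter> T}" by simp
  next
    fix \<K>
    assume "\<forall>K\<in>\<K>. K \<subseteq> f ` topspace X \<and> openin X {x \<in> topspace X. f x \<in> K}"
    then have "openin X (\<Union>K\<in>\<K>. {x \<in> topspace X. f x \<in> K})"
      by (intro openin_Union) auto
    moreover have "(\<Union>K\<in>\<K>. {x \<in> topspace X. f x \<in> K}) = {x \<in> topspace X. f x \<in> \<Union>\<K>}"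
      by blast
    ultimately show "openin X {x \<in> topspace X. f x \<in> \<Union>\<K>}" by simp
  next
    fix S T
    assume "S \<subseteq> f ` topspace X"
    then show "S \<inter> T \<subseteq> f ` topspace X" by (rule le_infI1)
  next
    fix \<K>
    assume "\<forall>K\<in>\<K>. K \<subseteq> f ` topspace X \<and> openin X {x \<in> topspace X. f x \<in> K}"
    then show "\<Union>\<K> \<subseteq> f ` topspace X" by (intro Union_least) simp
  qed
  then show ?thesis by (simp add: quotient_topology_def)
qed

lemma topspace_quotient_topology [simp]:
  "topspace (quotient_topology X f) = f ` topspace X"
proof
  show "topspace (quotient_topology X f) \<subseteq> f ` topspace X"
    using openin_topspace[of "quotient_topology X f"] unfolding openin_quotient_topology
    by (rule conjunct1)
  have "{x \<in> topspace X. f x \<in> f ` topspace X} = topspace X" by blast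
  then have "openin (quotient_topology X f) (f ` topspace X)"
    by (simp add: openin_quotient_topology)
  then show "f ` topspace X \<subseteq> topspace (quotient_topology X f)"
    by (rule openin_subset)
qed

lemma quotient_map_quotient_topology: "quotient_map X (quotient_topology X f) f"
  by (simp add: quotient_map_def openin_quotient_topology)

definition orthant :: "('v, 'e) pre_digraph \<Rightarrow> ('e \<Rightarrow> real) topology" where
  "orthant G = product_topology (\<lambda>_. top_of_set {0..}) (arcs G)"

definition aut_orbit ::
    "('v, 'e) pre_digraph \<Rightarrow> ('v \<Rightarrow> nat) \<Rightarrow> ('e \<Rightarrow> real) \<Rightarrow> ('e \<Rightarrow> real) set" where
  "aut_orbit G w s = {restrict (s \<circ> \<psi>) (arcs G) |\<phi> \<psi>. wgraph_iso G w G w \<phi> \<psi>}"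

definition closed_cell :: "('v, 'e) wgraph \<Rightarrow> ('e \<Rightarrow> real) set topology" where
  "closed_cell = (\<lambda>(G, w). quotient_topology (orthant G) (aut_orbit G w))"

text \<open>
  Every finite graph is isomorphic to one whose vertices and edges are natural numbers. Isomorphic
  copies among these index different summands of the disjoint union below, which are then
  identified by the equivalence relation.
\<close>

definition comb_types :: "nat \<Rightarrow> (nat, nat) wgraph set" where
  "comb_types g =
     {(G, w). fin_digraph G \<and> Digraph_Component.connected G \<and> genus G w = int g}"

type_synonym cell_point = "(nat, nat) wgraph \<times> (nat \<Rightarrow> real) set"

definition cells :: "nat \<Rightarrow> cell_point topology" where
  "cells g = sum_topology closed_cell (comb_types g)"

text \<open>
  A point of a cell is an orbit; the curves corresponding to its members are isomorphic.
\<close>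

fun curves_at :: "cell_point \<Rightarrow> (nat set, nat) trop_curve set" where
  "curves_at ((G, w), S) = contract G w ` S"

definition cell_equiv :: "cell_point \<Rightarrow> cell_point \<Rightarrow> bool" where
  "cell_equiv x y \<longleftrightarrow> (\<exists>\<Gamma>\<in>curves_at x. \<exists>\<Delta>\<in>curves_at y. trop_isomorphic \<Gamma> \<Delta>)"

definition cell_class :: "nat \<Rightarrow> cell_point \<Rightarrow> cell_point set" where
  "cell_class g x = {y \<in> topspace (cells g). cell_equiv x y}"

definition M_tr :: "nat \<Rightarrow> cell_point set topology" where
  "M_tr g = quotient_topology (cells g) (cell_class g)"

text \<open>
  The common value of the Brill-Noether rank on all curves representing the point \<open>X\<close>;
  \<open>the_elem\<close> is only meaningful because there is exactly one such value.
\<close>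

definition bn_rank_M_tr :: "real \<Rightarrow> nat \<Rightarrow> nat \<Rightarrow> cell_point set \<Rightarrow> int" where
  "bn_rank_M_tr \<epsilon> r d X = the_elem (bn_rank \<epsilon> r d ` (\<Union>x\<in>X. curves_at x))"

definition upper_semicontinuous_map :: "'a topology \<Rightarrow> ('a \<Rightarrow> int) \<Rightarrow> bool" where
  "upper_semicontinuous_map X \<phi> \<longleftrightarrow> (\<forall>\<rho>. closedin X {x \<in> topspace X. \<rho> \<le> \<phi> x})"

end

theory Submission
  imports Defs
begin

text \<open>
  Represent a rational function by its slopes at the tails of the edges and its values at the
  vertices. In this form linear equivalence between divisors of bounded degree is a closed
  condition: slopes are bounded by the degrees, and the equations survive when edge lengths tend to
  \<open>0\<close>. So effective divisors \<open>D\<^sub>n\<close> of rank at least \<open>r\<close> on curves \<open>\<Gamma>\<^sub>n\<close> tending to \<open>\<Gamma>\<close> subconverge to an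
  effective divisor \<open>D\<close> on \<open>\<Gamma>\<close>, and only its rank has to be controlled.

  A vertex of \<open>\<Gamma>\<close> may have more weight than the vertices contracted to it. To meet a demand on \<open>n\<close> of
  its loops, two chips per loop at the vertex are enough. They are obtained from a demand of one chip
  at a generic position on each of \<open>n\<close> removable edges of the contracted subgraph: comparing
  potentials modulo the rational span of all other data shows that, besides the \<open>n\<close> demanded
  chips, at least \<open>n\<close> further ones lie on that subgraph. Invariance under isomorphism is the special
  case of constant sequences.
\<close>

section \<open>Divisors as linear functionals\<close>

text \<open>Attaching the loops of \<open>rank\<close> to the nearby curves before degenerating puts
  weights and shrinking edges on the same footing: edges whose length tends to 0 and attached loops
  of fixed length \<epsilon> are collapsed by one map onto the limit graph, and the genus of a fibre
  becomes the first Betti number of a graph. Hence as many edges as the weight of the limit vertex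
  can be removed without disconnecting the fibre. Two chips per loop are natural: on a circle one
  chip alone cannot move, whereas two chips at the base point are equivalent to any prescribed chip
  plus another one. Generic positions are chosen anew on every curve, as genericity is relative to
  its lengths and divisor; only the number of chips on collapsed edges survives the limit. Limits
  can push chips to the ends of edges, so divisors are allowed there until the limit has been taken.
  A sequence may itself run in the boundary of a cell, so a stratum with constant zero set is
  selected, and the limit is a further contraction of the curves on it.\<close>

abbreviation "lookup \<equiv> Poly_Mapping.lookup"
abbreviation "keys \<equiv> Poly_Mapping.keys"

text \<open>The pairing of a divisor with a function on points. Degree, coefficients, chip counts on
  an edge and moments are all of this form, so linearity and positivity are proved once; the ring is
  arbitrary because integer counts and real moments both occur.\<close>

definition ev :: "('p \<Rightarrow> 'a::comm_ring_1) \<Rightarrow> 'p divisor \<Rightarrow> 'a" where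
  "ev g A = (\<Sum>p\<in>keys A. of_int (lookup A p) * g p)"

abbreviation push :: "('p \<Rightarrow> 'q) \<Rightarrow> 'p divisor \<Rightarrow> 'q divisor" where
  "push \<theta> \<equiv> frag_extend (\<lambda>p. frag_of (\<theta> p))"

lemma ev_superset:
  assumes "finite S" "keys A \<subseteq> S"
  shows "ev g A = (\<Sum>p\<in>S. of_int (lookup A p) * g p)"
  unfolding ev_def
  by (rule sum.mono_neutral_left) (use assms in \<open>auto simp: in_keys_iff\<close>)

lemma ev_0 [simp]: "ev g 0 = 0"
  by (simp add: ev_def)

lemma ev_frag_of [simp]: "ev g (frag_of p) = g p"
  by (simp add: ev_def)

lemma ev_add: "ev g (A + B) = ev g A + ev g B"
proof -
  let ?S = "keys A \<union> keys B"
  have "keys (A + B) \<subseteq> ?S"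
    by (rule keys_add)
  then show ?thesis
    by (simp add: ev_superset[of ?S] lookup_add distrib_right sum.distrib)
qed

lemma ev_uminus: "ev g (- A) = - ev g A"
  by (simp add: ev_def sum_negf)

lemma ev_diff: "ev g (A - B) = ev g A - ev g B"
  using ev_add[of g A "- B"] by (simp add: ev_uminus)

lemma ev_sum: "ev g (\<Sum>i\<in>I. A i) = (\<Sum>i\<in>I. ev g (A i))"
  by (induction I rule: infinite_finite_induct) (auto simp: ev_add)

lemma ev_cong: "(\<And>p. p \<in> keys A \<Longrightarrow> g p = h p) \<Longrightarrow> ev g A = ev h A"
  by (simp add: ev_def)

lemma ev_eq_0: "(\<And>p. p \<in> keys A \<Longrightarrow> g p = 0) \<Longrightarrow> ev g A = 0"
  by (simp add: ev_def)

lemma ev_zero_fun [simp]: "ev (\<lambda>p. 0) A = 0"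
  by (rule ev_eq_0) simp

lemma ev_add_fun: "ev (\<lambda>p. g p + h p) A = ev g A + ev h A"
  by (simp add: ev_def distrib_left sum.distrib)

lemma ev_diff_fun: "ev (\<lambda>p. g p - h p) A = ev g A - ev h A"
  by (simp add: ev_def right_diff_distrib sum_subtractf)

lemma ev_cmult_fun: "ev (\<lambda>p. c * g p) A = c * ev g A"
  by (simp add: ev_def sum_distrib_left algebra_simps)

lemma ev_sum_fun: "ev (\<lambda>p. \<Sum>i\<in>I. g i p) A = (\<Sum>i\<in>I. ev (g i) A)"
  by (induction I rule: infinite_finite_induct) (auto simp: ev_add_fun)

lemma of_int_ev: "of_int (ev g A) = ev (\<lambda>p. of_int (g p)) A"
  by (simp add: ev_def)

lemma lookup_eq_ev: "lookup A p = ev (\<lambda>q. if q = p then 1 else 0) A"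
  by (auto simp: ev_def if_distrib in_keys_iff cong: if_cong)

lemma deg_eq_ev: "deg A = ev (\<lambda>_. 1) A"
  by (simp add: deg_def ev_def)

text \<open>Push-forward is adjoint to composition, so that questions about a pushed divisor become
  pointwise identities between functions on points.\<close>

lemma ev_push: "ev g (push \<theta> A) = ev (\<lambda>p. g (\<theta> p)) A"
  by (rule frag_induction[where S = UNIV and c = A]) (auto simp: ev_diff frag_extend_diff)

lemma push_push: "push \<theta> (push \<tau> A) = push (\<lambda>p. \<theta> (\<tau> p)) A"
  using frag_extend_compose[of "\<lambda>p. frag_of (\<theta> p)" \<tau> A] by (simp add: o_def)

lemma push_id: "(\<And>p. p \<in> keys A \<Longrightarrow> \<theta> p = p) \<Longrightarrow> push \<theta> A = A"
  using frag_extend_eq[of A "\<lambda>p. frag_of (\<theta> p)" frag_of] frag_expansion[of A] by simp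

lemma push_sum: "push \<theta> (\<Sum>i\<in>I. A i) = (\<Sum>i\<in>I. push \<theta> (A i))"
  by (induction I rule: infinite_finite_induct) (auto simp: frag_extend_add)

lemma lookup_push: "lookup (push \<theta> A) q = ev (\<lambda>p. if \<theta> p = q then 1 else 0) A"
  by (simp add: lookup_eq_ev ev_push)

lemma keys_push: "keys (push \<theta> A) \<subseteq> \<theta> ` keys A"
  using keys_frag_extend[of "\<lambda>p. frag_of (\<theta> p)" A] by auto

lemma deg_push: "deg (push \<theta> A) = deg A"
  by (simp add: deg_eq_ev ev_push)

lemma deg_add: "deg (A + B) = deg A + deg B"
  by (simp add: deg_eq_ev ev_add)

lemma deg_diff: "deg (A - B) = deg A - deg B"
  by (simp add: deg_eq_ev ev_diff)

lemma deg_sum: "deg (\<Sum>i\<in>I. A i) = (\<Sum>i\<in>I. deg (A i))"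
  by (simp add: deg_eq_ev ev_sum)

lemma deg_0 [simp]: "deg 0 = 0"
  by (simp add: deg_eq_ev)

lemma deg_frag_of [simp]: "deg (frag_of p) = 1"
  by (simp add: deg_eq_ev)

section \<open>Positivity and effective divisors\<close>

lemma ev_nonneg:
  fixes g :: "'p \<Rightarrow> 'a::linordered_idom"
  assumes "effective A" "\<And>p. p \<in> keys A \<Longrightarrow> 0 \<le> g p"
  shows "0 \<le> ev g A"
  using assms unfolding ev_def effective_def by (intro sum_nonneg mult_nonneg_nonneg) auto

lemma ev_mono:
  fixes g :: "'p \<Rightarrow> 'a::linordered_idom"
  assumes "effective A" "\<And>p. p \<in> keys A \<Longrightarrow> g p \<le> h p"
  shows "ev g A \<le> ev h A"
  using ev_nonneg[OF assms(1), of "\<lambda>p. h p - g p"] assms(2) by (simp add: ev_diff_fun)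

lemma effective_0 [simp]: "effective 0"
  by (simp add: effective_def)

lemma effective_frag_of [simp]: "effective (frag_of p)"
  by (simp add: effective_def)

lemma effective_add: "effective A \<Longrightarrow> effective B \<Longrightarrow> effective (A + B)"
  by (simp add: effective_def lookup_add)

lemma effective_sum: "(\<And>i. i \<in> I \<Longrightarrow> effective (A i)) \<Longrightarrow> effective (\<Sum>i\<in>I. A i)"
  by (induction I rule: infinite_finite_induct) (auto simp: effective_add)

lemma effective_push: "effective A \<Longrightarrow> effective (push \<theta> A)"
  by (auto simp: effective_def[of "push _ _"] lookup_push intro: ev_nonneg)

lemma effective_deg_nonneg: "effective A \<Longrightarrow> 0 \<le> deg A"
  by (auto simp: deg_eq_ev intro: ev_nonneg)

lemma effective_keys_add:
  "effective A \<Longrightarrow> effective B \<Longrightarrow>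
    keys (A + B) = keys A \<union> keys B"
  by (force simp: effective_def in_keys_iff lookup_add add_nonneg_eq_0_iff set_eq_iff)

lemma effective_deg_0:
  assumes "effective A" "deg A = 0"
  shows "A = 0"
proof -
  have "\<forall>p\<in>keys A. lookup A p = 0"
    using assms sum_nonneg_eq_0_iff[of "keys A" "lookup A"]
    by (auto simp: deg_def effective_def)
  then show ?thesis by (metis keys_eq_empty in_keys_iff ex_in_conv)
qed

text \<open>Labelling the chips, with repetitions for multiplicity, is what allows limits to be
  taken chip by chip. The induction removes one chip of the support at a time.\<close>

lemma effective_indexed:
  assumes "effective A" "deg A = int d"
  obtains x where "A = (\<Sum>i<d. frag_of (x i))" "\<And>i. i < d \<Longrightarrow> x i \<in> keys A"
proof -
  have "\<exists>x. A = (\<Sum>i<d. frag_of (x i)) \<and> (\<forall>i<d. x i \<in> keys A)"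
    using assms
  proof (induction d arbitrary: A)
    case 0
    then show ?case using effective_deg_0 by simp
  next
    case (Suc d)
    obtain p where p: "p \<in> keys A"
      using Suc.prems(2) by (metis deg_0 ex_in_conv keys_eq_empty nat.distinct(1) of_nat_eq_0_iff)
    let ?B = "A - frag_of p"
    have eff: "effective ?B"
      using Suc.prems(1) p unfolding effective_def
      by (auto simp: lookup_minus in_keys_iff) (metis linorder_not_le order_le_less zero_less_iff_neq_zero
          antisym_conv3 int_one_le_iff_zero_less)
    have "deg ?B = int d" using Suc.prems(2) by (simp add: deg_diff)
    from Suc.IH[OF eff this] obtain x where
      x: "?B = (\<Sum>i<d. frag_of (x i))" "\<forall>i<d. x i \<in> keys ?B" by auto
    have k: "keys A = keys ?B \<union> {p}"
      using effective_keys_add[OF eff effective_frag_of, of p] by simp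
    let ?x = "x(d := p)"
    have "A = (\<Sum>i<Suc d. frag_of (?x i))" 
      using x(1) by (simp add: algebra_simps)
    moreover have "\<forall>i<Suc d. ?x i \<in> keys A"
      using x(2) k by (auto simp: less_Suc_eq)
    ultimately show ?case by blast
  qed
  then show ?thesis using that by blast
qed

lemma keys_indexed:
  "keys (\<Sum>i<d::nat. frag_of (x i)) = x ` {..<d}"
proof (induction d)
  case (Suc d)
  have "effective (\<Sum>i<d. frag_of (x i))" by (rule effective_sum) simp
  with Suc show ?case by (simp add: effective_keys_add lessThan_Suc)
qed simp

section \<open>Piecewise linear functions on an interval\<close>

lemma right_slope_eqI:
  assumes "\<forall>\<^sub>F u in at_right t. h u = h t + of_int k * (u - t)"
  shows "right_slope h t = k"
  unfolding right_slope_def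
proof (rule the_equality)
  show "\<forall>\<^sub>F u in at_right t. h u = h t + of_int k * (u - t)" by fact
next
  fix k' :: int
  assume "\<forall>\<^sub>F u in at_right t. h u = h t + of_int k' * (u - t)"
  with assms eventually_at_right_less[of t]
  have "\<forall>\<^sub>F u in at_right t. k' = k"
    by eventually_elim simp
  then show "k' = k" by simp
qed

lemma left_slope_eqI:
  assumes "\<forall>\<^sub>F u in at_left t. h u = h t + of_int k * (u - t)"
  shows "left_slope h t = k"
  unfolding left_slope_def
proof (rule the_equality)
  show "\<forall>\<^sub>F u in at_left t. h u = h t + of_int k * (u - t)" by fact
next
  fix k' :: int
  assume *: "\<forall>\<^sub>F u in at_left t. h u = h t + of_int k' * (u - t)"
  have "\<forall>\<^sub>F u in at_left t. u < t"
    by (simp add: eventually_at_filter)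
  with assms * have "\<forall>\<^sub>F u in at_left t. k' = k"
    by eventually_elim simp
  then show "k' = k" by simp
qed

lemma sum_hinge_right:
  fixes c :: "real \<Rightarrow> real"
  assumes "finite S"
  shows "\<forall>\<^sub>F u in at_right t.
    (\<Sum>s\<in>S. c s * max 0 (u - s)) = (\<Sum>s\<in>S. c s * max 0 (t - s)) + (\<Sum>s\<in>S. if s \<le> t then c s else 0) * (u - t)"
  using assms
proof (induction S)
  case (insert s S)
  have *: "\<forall>\<^sub>F u in at_right t. s > t \<longrightarrow> u < s"
  proof (cases "s > t")
    case True
    then show ?thesis by (simp add: eventually_at_right[OF True]) (use True in auto)
  qed simp
  from insert.IH * eventually_at_right_less[of t] show ?case
    by eventually_elim (use insert.hyps in \<open>auto simp: algebra_simps max_def\<close>)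
qed simp

lemma sum_hinge_left:
  fixes c :: "real \<Rightarrow> real"
  assumes "finite S"
  shows "\<forall>\<^sub>F u in at_left t.
    (\<Sum>s\<in>S. c s * max 0 (u - s)) = (\<Sum>s\<in>S. c s * max 0 (t - s)) + (\<Sum>s\<in>S. if s < t then c s else 0) * (u - t)"
  using assms
proof (induction S)
  case (insert s S)
  have *: "\<forall>\<^sub>F u in at_left t. s < t \<longrightarrow> s < u"
  proof (cases "s < t")
    case True
    then show ?thesis by (simp add: eventually_at_left[OF True]) (use True in auto)
  qed simp
  have **: "\<forall>\<^sub>F u in at_left t. u < t"
    by (simp add: eventually_at_filter)
  from insert.IH * ** show ?case
    by eventually_elim (use insert.hyps in \<open>auto simp: algebra_simps max_def\<close>)
qed simp

text \<open>For positive breaks this is the function with value \<open>a\<close> and slope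
  \<open>k\<close> at 0 whose slope drops by \<open>c s\<close> on passing \<open>s\<close>; the
  drop, left slope minus right slope, is the coefficient of its divisor at \<open>s\<close>.\<close>

definition hinge :: "real \<Rightarrow> int \<Rightarrow> (real \<Rightarrow> int) \<Rightarrow> real set \<Rightarrow> real \<Rightarrow> real" where
  "hinge a k c S t = a + of_int k * t - (\<Sum>s\<in>S. of_int (c s) * max 0 (t - s))"

lemma right_slope_hinge:
  assumes h: "\<And>u. 0 \<le> u \<Longrightarrow> u \<le> L \<Longrightarrow> h u = hinge a k c S u" and S: "finite S" and t: "0 \<le> t" "t < L"
  shows "right_slope h t = k - (\<Sum>s\<in>S. if s \<le> t then c s else 0)"
proof (rule right_slope_eqI)
  have "\<forall>\<^sub>F u in at_right t. u < L"
    by (simp add: eventually_at_right[OF t(2)]) (use t in auto)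
  with sum_hinge_right[OF S, where c = "\<lambda>s. of_int (c s)" and t = t] eventually_at_right_less[of t]
  show "\<forall>\<^sub>F u in at_right t. h u = h t + of_int (k - (\<Sum>s\<in>S. if s \<le> t then c s else 0)) * (u - t)"
  proof eventually_elim
    case (elim u)
    then show ?case using t by (simp add: h hinge_def algebra_simps if_distrib cong: if_cong)
  qed
qed

lemma left_slope_hinge:
  assumes h: "\<And>u. 0 \<le> u \<Longrightarrow> u \<le> L \<Longrightarrow> h u = hinge a k c S u" and S: "finite S" and t: "0 < t" "t \<le> L"
  shows "left_slope h t = k - (\<Sum>s\<in>S. if s < t then c s else 0)"
proof (rule left_slope_eqI)
  have "\<forall>\<^sub>F u in at_left t. 0 < u"
    by (simp add: eventually_at_left[OF t(1)]) (use t in auto)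
  moreover have "\<forall>\<^sub>F u in at_left t. u < t"
    by (simp add: eventually_at_filter)
  ultimately 
  show "\<forall>\<^sub>F u in at_left t. h u = h t + of_int (k - (\<Sum>s\<in>S. if s < t then c s else 0)) * (u - t)"
    using sum_hinge_left[OF S, where c = "\<lambda>s. of_int (c s)" and t = t]
  proof eventually_elim
    case (elim u)
    then show ?case using t by (simp add: h hinge_def algebra_simps if_distrib cong: if_cong)
  qed
qed

lemma pl_integer_slopes_hinge:
  assumes h: "\<And>u. 0 \<le> u \<Longrightarrow> u \<le> L \<Longrightarrow> h u = hinge a k c S u" and S: "finite S"
  shows "pl_integer_slopes L h"
  unfolding pl_integer_slopes_def
proof (intro conjI exI allI impI)
  have "continuous_on {0..L} (hinge a k c S)"
    unfolding hinge_def by (intro continuous_intros)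
  then show "continuous_on {0..L} h"
    by (rule continuous_on_eq) (simp add: h)
next
  show "finite S" by fact
next
  fix x y :: real
  assume xy: "0 \<le> x \<and> x < y \<and> y \<le> L \<and> {x<..<y} \<inter> S = {}"
  \<comment> \<open>With no break inside the interval, the right slope at \<open>x\<close> is the
    slope throughout.\<close>
  let ?k = "k - (\<Sum>s\<in>S. if s \<le> x then c s else 0)"
  show "\<forall>t\<in>{x..y}. h t = h x + of_int ?k * (t - x)"
  proof
    fix t assume t: "t \<in> {x..y}"
    have *: "of_int (c s) * max 0 (t - s) =
        of_int (c s) * max 0 (x - s) + of_int (if s \<le> x then c s else 0) * (t - x)" if "s \<in> S" for s
    proof -
      have "s \<le> x \<or> y \<le> s" using xy that by force
      then show ?thesis using t xy by (auto simp: algebra_simps max_def)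
    qed
    have "(\<Sum>s\<in>S. of_int (c s) * max 0 (t - s)) = (\<Sum>s\<in>S. of_int (c s) * max 0 (x - s)) +
        of_int (\<Sum>s\<in>S. if s \<le> x then c s else 0) * (t - x)"
      by (simp only: sum.cong[OF refl *] sum.distrib of_int_sum sum_distrib_right)
    then show "h t = h x + of_int ?k * (t - x)"
      using t xy h[of t] h[of x] by (simp add: hinge_def left_diff_distrib right_diff_distrib)
  qed
qed

lemma pl_one_sided_slopes:
  assumes pl: "pl_integer_slopes L h"
  shows "0 \<le> t \<Longrightarrow> t < L \<Longrightarrow> \<forall>\<^sub>F u in at_right t. h u = h t + of_int (right_slope h t) * (u - t)"
    and "0 < t \<Longrightarrow> t \<le> L \<Longrightarrow> \<forall>\<^sub>F u in at_left t. h u = h t + of_int (left_slope h t) * (u - t)"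
proof -
  obtain S where S: "finite S" and lin: "\<And>a b. 0 \<le> a \<Longrightarrow> a < b \<Longrightarrow> b \<le> L \<Longrightarrow> {a<..<b} \<inter> S = {} \<Longrightarrow>
      \<exists>k::int. \<forall>t\<in>{a..b}. h t = h a + of_int k * (t - a)"
    using pl unfolding pl_integer_slopes_def by metis
  \<comment> \<open>No break other than \<open>t\<close> itself lies closer than \<delta> to
    \<open>t\<close>, which gives linearity on one interval to each side.\<close>
  obtain \<delta> where \<delta>: "\<delta> > 0" "\<And>s. s \<in> S \<Longrightarrow> s \<noteq> t \<Longrightarrow> \<delta> \<le> dist t s"
    using finite_set_avoid[OF S] by metis
  {
    assume t: "0 \<le> t" "t < L"
    define b where "b = min L (t + \<delta>)"
    have b: "t < b" "b \<le> L" using t \<delta> by (auto simp: b_def)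
    have "{t<..<b} \<inter> S = {}" using \<delta>(2) by (fastforce simp: b_def dist_real_def)
    with lin[OF t(1) b] obtain k :: int where k: "\<forall>u\<in>{t..b}. h u = h t + of_int k * (u - t)" by auto
    have "\<forall>\<^sub>F u in at_right t. u < b"
      by (simp add: eventually_at_right[OF b(1)]) (use b in auto)
    with eventually_at_right_less[of t] have "\<forall>\<^sub>F u in at_right t. h u = h t + of_int k * (u - t)"
      by eventually_elim (rule k[rule_format], simp)
    with right_slope_eqI[OF this]
    show "\<forall>\<^sub>F u in at_right t. h u = h t + of_int (right_slope h t) * (u - t)" by simp
  next
    assume t: "0 < t" "t \<le> L"
    define a where "a = max 0 (t - \<delta>)"
    have a: "0 \<le> a" "a < t" using t \<delta> by (auto simp: a_def)
    have "{a<..<t} \<inter> S = {}" using \<delta>(2) by (fastforce simp: a_def dist_real_def)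
    with lin[OF a t(2)] obtain k :: int where k: "\<forall>u\<in>{a..t}. h u = h a + of_int k * (u - a)" by auto
    have k': "h u = h t + of_int k * (u - t)" if u: "u \<in> {a..t}" for u
    proof -
      have "t \<in> {a..t}" using a by simp
      then have "h t = h a + of_int k * (t - a)" by (rule k[THEN bspec])
      moreover have "h u = h a + of_int k * (u - a)" using u by (rule k[THEN bspec])
      ultimately show ?thesis by (simp only:) (simp add: algebra_simps)
    qed
    have "\<forall>\<^sub>F u in at_left t. a < u"
      by (simp add: eventually_at_left[OF a(2)]) (use a in auto)
    moreover have "\<forall>\<^sub>F u in at_left t. u < t"
      by (simp add: eventually_at_filter)
    ultimately have "\<forall>\<^sub>F u in at_left t. h u = h t + of_int k * (u - t)"
      by eventually_elim (rule k', simp)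
    with left_slope_eqI[OF this]
    show "\<forall>\<^sub>F u in at_left t. h u = h t + of_int (left_slope h t) * (u - t)" by simp
  }
qed

text \<open>
  Adding the hinges back removes all breaks, and the derivative of the result is locally constant.
\<close>

lemma pl_eq_hinge:
  assumes pl: "pl_integer_slopes L h" and L: "0 < L" and S: "finite S"
    and c: "\<And>t. 0 < t \<Longrightarrow> t < L \<Longrightarrow> left_slope h t - right_slope h t = (if t \<in> S then c t else 0)"
  obtains k where "\<And>t. 0 \<le> t \<Longrightarrow> t \<le> L \<Longrightarrow> h t = hinge (h 0) k c (S \<inter> {0<..<L}) t"
proof -
  let ?S = "(S \<inter> {0<..<L})"
  have fS: "finite ?S" using S by simp
  define g where "g t = h t + (\<Sum>s\<in>?S. of_int (c s) * max 0 (t - s))" for t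
  have loc: "\<exists>m::int. \<forall>\<^sub>F u in nhds t. g u = g t + of_int m * (u - t)" if t: "0 < t" "t < L" for t
  proof -
    let ?a = "left_slope h t + (\<Sum>s\<in>?S. if s < t then c s else 0)"
    let ?b = "right_slope h t + (\<Sum>s\<in>?S. if s \<le> t then c s else 0)"
    have *: "(if s \<le> t then c s else 0) = (if s < t then c s else 0) + (if s = t then c s else 0)" for s
      by auto
    have "(\<Sum>s\<in>?S. if s \<le> t then c s else 0) = (\<Sum>s\<in>?S. if s < t then c s else 0) + (if t \<in> S then c t else 0)"
      unfolding * sum.distrib using fS t by simp
    then have ab: "?a = ?b" using c[OF t] by simp
    have "\<forall>\<^sub>F u in at_left t. g u = g t + of_int ?a * (u - t)"
      using pl_one_sided_slopes(2)[OF pl t(1) less_imp_le[OF t(2)]]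
        sum_hinge_left[OF fS, of "\<lambda>s. of_int (c s)" t]
      by eventually_elim (simp add: g_def algebra_simps if_distrib cong: if_cong)
    moreover have "\<forall>\<^sub>F u in at_right t. g u = g t + of_int ?b * (u - t)"
      using pl_one_sided_slopes(1)[OF pl less_imp_le[OF t(1)] t(2)]
        sum_hinge_right[OF fS, of "\<lambda>s. of_int (c s)" t]
      by eventually_elim (simp add: g_def algebra_simps if_distrib cong: if_cong)
    ultimately have "\<forall>\<^sub>F u in at t. g u = g t + of_int ?a * (u - t)"
      unfolding eventually_at_split ab by simp
    then have "\<forall>\<^sub>F u in nhds t. g u = g t + of_int ?a * (u - t)"
      by (simp add: eventually_at_filter) (erule eventually_mono, auto)
    then show ?thesis by blast
  qed
  \<comment> \<open>Base point \<open>x\<close> and point of differentiation \<open>t\<close> are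
    kept apart, because the affine formula found at one point is reused at all nearby
    points.\<close>
  have der: "(g has_real_derivative of_int m) (at t)"
    if "\<forall>\<^sub>F u in nhds t. g u = g x + of_int m * (u - x)" for t x and m :: int
  proof -
    have "((\<lambda>u. g x + of_int m * (u - x)) has_real_derivative of_int m) (at t)"
      by (auto intro!: derivative_eq_intros)
    moreover have "\<forall>\<^sub>F u in nhds t. (g x + of_int m * (u - x)) = g u"
      using that by eventually_elim simp
    ultimately show ?thesis
      using DERIV_cong_ev[of t t "\<lambda>u. g x + of_int m * (u - x)" g "of_int m" "of_int m"] by simp
  qed
  have const: "deriv g a = deriv g b" if "a \<in> {0<..<L}" "b \<in> {0<..<L}" for a b
  proof (rule connected_local_const[where A = "{0<..<L}" and f = "deriv g"])
    show "\<forall>a\<in>{0<..<L}. \<forall>\<^sub>F b in at a within {0<..<L}. deriv g a = deriv g b"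
    proof
      fix t assume "t \<in> {0<..<L}"
      then obtain m :: int where m: "\<forall>\<^sub>F u in nhds t. g u = g t + of_int m * (u - t)"
        using loc by auto
      have "deriv g t = of_int m" using der[OF m] by (rule DERIV_imp_deriv)
      moreover have "\<forall>\<^sub>F b in nhds t. deriv g b = of_int m"
        using eventually_eventually[THEN iffD2, OF m]
        by (rule eventually_mono) (rule DERIV_imp_deriv[OF der])
      ultimately show "\<forall>\<^sub>F b in at t within {0<..<L}. deriv g t = deriv g b"
        by (auto simp: eventually_at_filter elim: eventually_mono)
    qed
  qed (use that in auto)
  have "L / 2 \<in> {0<..<L}" using L by auto
  then obtain k :: int where k: "deriv g (L/2) = of_int k"
    using loc[of "L/2"] DERIV_imp_deriv[OF der] by auto
  have derk: "((\<lambda>t. g t - of_int k * t) has_real_derivative 0) (at t)" if t: "0 < t" "t < L" for t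
  proof -
    obtain m :: int where m: "(g has_real_derivative of_int m) (at t)"
      using loc[OF t] der[of t] by auto
    have "of_int m = (of_int k :: real)"
      using const[of t "L/2"] t L k DERIV_imp_deriv[OF m] by simp
    with m show ?thesis by (auto intro!: derivative_eq_intros)
  qed
  have "continuous_on {0..L} h" using pl by (simp add: pl_integer_slopes_def)
  then have cont: "continuous_on {0..L} (\<lambda>t. g t - of_int k * t)"
    unfolding g_def by (intro continuous_intros)
  have g: "g t - of_int k * t = g 0" if t: "0 \<le> t" "t \<le> L" for t
  proof (cases "t = 0")
    case False
    have "continuous_on {0..t} (\<lambda>t. g t - of_int k * t)"
      using continuous_on_subset[OF cont] t by auto
    then have "g 0 - of_int k * 0 = g t - of_int k * t"
      by (intro DERIV_isconst_end[symmetric]) (use False t derk in auto)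
    then show ?thesis by simp
  qed simp
  have "g 0 = h 0" by (simp add: g_def)
  then have "h t = hinge (h 0) k c ?S t" if "0 \<le> t" "t \<le> L" for t
    using g[OF that] by (simp add: hinge_def g_def)
  then show ?thesis using that by blast
qed

section \<open>Principal divisors in terms of slopes and potentials\<close>

definition edge_fun :: "'e \<Rightarrow> (real \<Rightarrow> 'a::zero) \<Rightarrow> ('v, 'e) point \<Rightarrow> 'a" where
  "edge_fun e F p = (case p of Vert v \<Rightarrow> 0 | Inner e' t \<Rightarrow> if e' = e then F t else 0)"

lemma edge_fun_simps [simp]:
  "edge_fun e F (Vert v) = 0" "edge_fun e F (Inner e' t) = (if e' = e then F t else 0)"
  by (simp_all add: edge_fun_def)

abbreviation on_edge_count :: "'e \<Rightarrow> ('v, 'e) point divisor \<Rightarrow> int" where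
  "on_edge_count e A \<equiv> ev (edge_fun e (\<lambda>_. 1)) A"

text \<open>A chip at \<open>t\<close> lowers the slope by one on the remaining length
  \<open>l e - t\<close>; the moment is therefore the total amount by which the chips on
  \<open>e\<close> lower the value at its head.\<close>

abbreviation moment :: "('e \<Rightarrow> real) \<Rightarrow> 'e \<Rightarrow> ('v, 'e) point divisor \<Rightarrow> real" where
  "moment l e A \<equiv> ev (edge_fun e (\<lambda>t. l e - t)) A"

text \<open>
  \<open>k e\<close> is the slope at the tail of \<open>e\<close> and \<open>\<phi>\<close> the values at the vertices of a function with
  divisor \<open>A\<close>. The definition still makes sense for edges of length \<open>0\<close> and for chips at the ends
  of an edge, which occur in limits.
\<close>

definition potential ::
    "('v, 'e) pre_digraph \<Rightarrow> ('e \<Rightarrow> real) \<Rightarrow> ('e \<Rightarrow> int) \<Rightarrow> ('v \<Rightarrow> real) \<Rightarrow>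
      ('v, 'e) point divisor \<Rightarrow> bool" where
  "potential G l k \<phi> A \<longleftrightarrow>
     (\<forall>e\<in>arcs G. \<phi> (head G e) - \<phi> (tail G e) = of_int (k e) * l e - moment l e A) \<and>
     (\<forall>v\<in>verts G. lookup A (Vert v) =
        (\<Sum>e\<in>arcs G. (if head G e = v then k e - on_edge_count e A else 0) -
          (if tail G e = v then k e else 0)))"

definition principal ::
    "('v, 'e) pre_digraph \<Rightarrow> ('e \<Rightarrow> real) \<Rightarrow> ('v, 'e) point divisor \<Rightarrow> bool" where
  "principal G l A \<longleftrightarrow> (\<exists>k \<phi>. potential G l k \<phi> A)"

definition edge_support :: "'e \<Rightarrow> ('v, 'e) point divisor \<Rightarrow> real set" where
  "edge_support e A = {t. Inner e t \<in> keys A}"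

lemma finite_edge_support [simp]: "finite (edge_support e A)"
proof -
  have "finite (Inner e -` keys A)"
    by (rule finite_vimageI) (auto intro: injI)
  then show ?thesis by (simp add: edge_support_def vimage_def)
qed

lemma ev_edge_fun:
  "ev (edge_fun e F) A = (\<Sum>t\<in>edge_support e A. of_int (lookup A (Inner e t)) * F t)"
proof -
  have "(\<Sum>t\<in>edge_support e A. of_int (lookup A (Inner e t)) * F t) =
      (\<Sum>p\<in>Inner e ` edge_support e A. of_int (lookup A p) * edge_fun e F p)"
    by (subst sum.reindex) (auto intro: inj_onI)
  also have "\<dots> = (\<Sum>p\<in>keys A. of_int (lookup A p) * edge_fun e F p)"
    by (rule sum.mono_neutral_left) (auto simp: edge_support_def edge_fun_def split: point.split)
  finally show ?thesis by (simp add: ev_def)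
qed

lemma hinge_0: "(\<And>s. s \<in> S \<Longrightarrow> 0 \<le> s) \<Longrightarrow> hinge a k c S 0 = a"
  by (simp add: hinge_def)

lemma hinge_end:
  assumes "\<And>s. s \<in> edge_support e A \<Longrightarrow> s \<le> l e"
  shows "hinge a k (\<lambda>t. lookup A (Inner e t)) (edge_support e A) (l e) =
    a + of_int k * l e - moment l e A"
  unfolding hinge_def ev_edge_fun
  by (intro arg_cong2[where f = "(-)"] sum.cong) (auto simp: assms)

lemma sum_in_out_arcs:
  fixes a b :: "'e \<Rightarrow> int"
  assumes "fin_digraph G"
  shows "(\<Sum>e\<in>in_arcs G v. a e) + (\<Sum>e\<in>out_arcs G v. - b e) =
    (\<Sum>e\<in>arcs G. (if head G e = v then a e else 0) - (if tail G e = v then b e else 0))"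
proof -
  interpret fin_digraph G by fact
  show ?thesis
    by (simp add: sum_subtractf sum_negf sum.inter_filter[symmetric] in_arcs_def out_arcs_def)
qed

text \<open>On each edge the divisor fixes \<open>f\<close> up to its value and slope at the tail,
  so \<open>f\<close> is a hinge function there; its value and slope at the head give the edge and
  vertex equations of \<open>potential\<close>.\<close>

lemma lin_equiv_imp_principal:
  assumes G: "fin_digraph G" and l: "\<And>e. e \<in> arcs G \<Longrightarrow> 0 < l e"
    and keys: "keys (D - D') \<subseteq> points G l"
    and lin: "lin_equiv G l D D'"
  shows "principal G l (D - D')"
proof -
  let ?A = "D - D'"
  let ?c = "\<lambda>e t. lookup ?A (Inner e t)"
  let ?S = "\<lambda>e. edge_support e ?A"
  obtain f where f: "rational_function G l f"
    and div: "\<And>p. p \<in> points G l \<Longrightarrow> lookup ?A p = div_at G l f p"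
    using lin unfolding lin_equiv_def by auto
  have "\<exists>k. \<forall>t. 0 \<le> t \<longrightarrow> t \<le> l e \<longrightarrow>
      on_edge G l f e t = hinge (on_edge G l f e 0) k (?c e) (?S e) t" if e: "e \<in> arcs G" for e
  proof -
    have pl: "pl_integer_slopes (l e) (on_edge G l f e)"
      using f e by (simp add: rational_function_def)
    have "left_slope (on_edge G l f e) t - right_slope (on_edge G l f e) t =
        (if t \<in> ?S e then ?c e t else 0)" if "0 < t" "t < l e" for t
      using div[of "Inner e t"] that e by (auto simp: points_def edge_support_def in_keys_iff)
    from pl_eq_hinge[OF pl l[OF e] finite_edge_support this] obtain k where
      "\<And>t. 0 \<le> t \<Longrightarrow> t \<le> l e \<Longrightarrow>
        on_edge G l f e t = hinge (on_edge G l f e 0) k (?c e) (?S e \<inter> {0<..<l e}) t"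
      by blast
    moreover have "?S e \<inter> {0<..<l e} = ?S e"
      using keys by (auto simp: edge_support_def points_def)
    ultimately show ?thesis by (metis (no_types, lifting))
  qed
  then obtain k where k: "\<And>e t. e \<in> arcs G \<Longrightarrow> 0 \<le> t \<Longrightarrow> t \<le> l e \<Longrightarrow>
      on_edge G l f e t = hinge (on_edge G l f e 0) (k e) (?c e) (?S e) t"
    by metis
  have S: "0 < s \<and> s < l e" if "s \<in> ?S e" for s e
    using that keys by (auto simp: edge_support_def points_def)
  have left: "left_slope (on_edge G l f e) (l e) = k e - on_edge_count e ?A" if e: "e \<in> arcs G" for e
    by (subst left_slope_hinge[OF k[OF e]])
      (auto simp: l[OF e] ev_edge_fun S intro!: sum.cong)
  have right: "right_slope (on_edge G l f e) 0 = k e" if e: "e \<in> arcs G" for e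
    by (subst right_slope_hinge[OF k[OF e]]) (auto simp: l[OF e] intro!: sum.neutral dest: S)
  have "potential G l k (\<lambda>v. f (Vert v)) ?A"
    unfolding potential_def
  proof (intro conjI ballI)
    fix e assume e: "e \<in> arcs G"
    have "f (Vert (head G e)) = on_edge G l f e (l e)" "f (Vert (tail G e)) = on_edge G l f e 0"
      using l[OF e] by (auto simp: on_edge_def)
    moreover have "on_edge G l f e (l e) = on_edge G l f e 0 + of_int (k e) * l e - moment l e ?A"
      using l[OF e] S[of _ e] by (subst k[OF e]) (simp_all add: hinge_end less_imp_le)
    ultimately show "f (Vert (head G e)) - f (Vert (tail G e)) = of_int (k e) * l e - moment l e ?A"
      by simp
  next
    fix v assume "v \<in> verts G"
    then have "lookup ?A (Vert v) = div_at G l f (Vert v)"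
      by (intro div) (simp add: points_def)
    also have "\<dots> = (\<Sum>e\<in>in_arcs G v. k e - on_edge_count e ?A) + (\<Sum>e\<in>out_arcs G v. - k e)"
      by (simp add: left right)
    finally show "lookup ?A (Vert v) =
        (\<Sum>e\<in>arcs G. (if head G e = v then k e - on_edge_count e ?A else 0) -
          (if tail G e = v then k e else 0))"
      by (simp only: sum_in_out_arcs[OF G])
  qed
  then show ?thesis unfolding principal_def by blast
qed

text \<open>Hinge functions started from the vertex values fit together, because the edge equation
  is the matching condition at the head; the vertex equation then identifies the divisor.\<close>

lemma principal_imp_lin_equiv:
  assumes G: "fin_digraph G" and l: "\<And>e. e \<in> arcs G \<Longrightarrow> 0 < l e"
    and keys: "keys (D - D') \<subseteq> points G l"
    and prin: "principal G l (D - D')"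
  shows "lin_equiv G l D D'"
proof -
  let ?A = "D - D'"
  let ?c = "\<lambda>e t. lookup ?A (Inner e t)"
  let ?S = "\<lambda>e. edge_support e ?A"
  obtain k \<phi> where pot: "potential G l k \<phi> ?A"
    using prin unfolding principal_def by auto
  have S: "0 < s \<and> s < l e" if "s \<in> ?S e" for s e
    using that keys by (auto simp: edge_support_def points_def)
  define f where "f p = (case p of Vert v \<Rightarrow> \<phi> v
    | Inner e t \<Rightarrow> hinge (\<phi> (tail G e)) (k e) (?c e) (?S e) t)" for p
  have h: "on_edge G l f e u = hinge (\<phi> (tail G e)) (k e) (?c e) (?S e) u"
    if e: "e \<in> arcs G" and u: "0 \<le> u" "u \<le> l e" for e u
  proof -
    have "hinge (\<phi> (tail G e)) (k e) (?c e) (?S e) 0 = \<phi> (tail G e)"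
      using S[of _ e] by (intro hinge_0) (simp add: less_imp_le)
    moreover have "\<phi> (head G e) - \<phi> (tail G e) = of_int (k e) * l e - moment l e ?A"
      using pot e by (simp add: potential_def)
    then have "hinge (\<phi> (tail G e)) (k e) (?c e) (?S e) (l e) = \<phi> (head G e)"
      using S[of _ e] by (simp add: hinge_end less_imp_le)
    ultimately show ?thesis using u l[OF e] by (auto simp: on_edge_def f_def)
  qed
  have rat: "rational_function G l f"
    unfolding rational_function_def
    using pl_integer_slopes_hinge[OF h finite_edge_support] by blast
  have "lookup ?A p = div_at G l f p" if p: "p \<in> points G l" for p
  proof (cases p)
    case (Vert v)
    then have v: "v \<in> verts G" using p by (auto simp: points_def)
    have left: "left_slope (on_edge G l f e) (l e) = k e - on_edge_count e ?A" if e: "e \<in> arcs G" for e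
      by (subst left_slope_hinge[OF h[OF e]])
        (auto simp: l[OF e] ev_edge_fun S intro!: sum.cong)
    have right: "right_slope (on_edge G l f e) 0 = k e" if e: "e \<in> arcs G" for e
      by (subst right_slope_hinge[OF h[OF e]]) (auto simp: l[OF e] intro!: sum.neutral dest: S)
    have "div_at G l f p = (\<Sum>e\<in>in_arcs G v. k e - on_edge_count e ?A) + (\<Sum>e\<in>out_arcs G v. - k e)"
      unfolding Vert by (simp add: left right)
    also have "\<dots> = lookup ?A (Vert v)"
      using pot v by (simp only: sum_in_out_arcs[OF G] potential_def)
    finally show ?thesis using Vert by simp
  next
    case (Inner e t)
    then have e: "e \<in> arcs G" and t: "0 < t" "t < l e" using p by (auto simp: points_def)
    have *: "(if s \<le> t then ?c e s else 0) = (if s < t then ?c e s else 0) + (if s = t then ?c e s else 0)" for s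
      by auto
    have "(\<Sum>s\<in>?S e. if s \<le> t then ?c e s else 0) =
        (\<Sum>s\<in>?S e. if s < t then ?c e s else 0) + ?c e t"
      unfolding * sum.distrib by simp (simp add: edge_support_def in_keys_iff)
    then show ?thesis
      using Inner t
        left_slope_hinge[OF h[OF e], where t = t] right_slope_hinge[OF h[OF e], where t = t]
      by simp
  qed
  then show ?thesis unfolding lin_equiv_def using rat by blast
qed

section \<open>Group structure and degree of principal divisors\<close>

lemma potential_add:
  assumes "potential G l k \<phi> A" "potential G l k' \<phi>' B"
  shows "potential G l (\<lambda>e. k e + k' e) (\<lambda>v. \<phi> v + \<phi>' v) (A + B)"
  using assms unfolding potential_def
  by (auto simp: ev_add lookup_add algebra_simps sum.distrib[symmetric] intro!: sum.cong)

lemma potential_uminus: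
  assumes "potential G l k \<phi> A"
  shows "potential G l (\<lambda>e. - k e) (\<lambda>v. - \<phi> v) (- A)"
  using assms unfolding potential_def
  by (auto simp: ev_uminus algebra_simps sum_negf[symmetric] intro!: sum.cong)

lemma principal_add: "principal G l A \<Longrightarrow> principal G l B \<Longrightarrow> principal G l (A + B)"
  unfolding principal_def using potential_add by blast

lemma principal_uminus: "principal G l A \<Longrightarrow> principal G l (- A)"
  unfolding principal_def using potential_uminus by blast

lemma principal_diff: "principal G l A \<Longrightarrow> principal G l B \<Longrightarrow> principal G l (A - B)"
  using principal_add[of G l A "- B"] principal_uminus by auto

text \<open>Chips at the ends of an edge need not be moved to the vertices.\<close>

definition closed_points :: "('v, 'e) pre_digraph \<Rightarrow> ('e \<Rightarrow> real) \<Rightarrow> ('v, 'e) point set" where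
  "closed_points G l = Vert ` verts G \<union> {Inner e t |e t. e \<in> arcs G \<and> 0 \<le> t \<and> t \<le> l e}"

lemma points_subset_closed_points: "points G l \<subseteq> closed_points G l"
  by (auto simp: points_def closed_points_def)

lemma deg_eq_sum:
  assumes G: "fin_digraph G" and keys: "keys A \<subseteq> closed_points G l"
  shows "deg A = (\<Sum>v\<in>verts G. lookup A (Vert v)) + (\<Sum>e\<in>arcs G. on_edge_count e A)"
proof -
  interpret fin_digraph G by fact
  have "deg A = ev (\<lambda>p. (\<Sum>v\<in>verts G. if p = Vert v then 1 else 0) + (\<Sum>e\<in>arcs G. edge_fun e (\<lambda>_. 1) p)) A"
    unfolding deg_eq_ev
  proof (rule ev_cong)
    fix p assume "p \<in> keys A"
    with keys have "p \<in> closed_points G l" by auto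
    then show "1 = (\<Sum>v\<in>verts G. if p = Vert v then 1 else 0) + (\<Sum>e\<in>arcs G. edge_fun e (\<lambda>_. 1) p)"
      by (auto simp: closed_points_def)
  qed
  also have "\<dots> = (\<Sum>v\<in>verts G. lookup A (Vert v)) + (\<Sum>e\<in>arcs G. on_edge_count e A)"
    by (simp add: ev_add_fun ev_sum_fun lookup_eq_ev)
  finally show ?thesis .
qed

lemma sum_heads:
  fixes f :: "'e \<Rightarrow> 'b::comm_monoid_add"
  assumes "fin_digraph G"
  shows "(\<Sum>v\<in>verts G. \<Sum>e\<in>arcs G. if head G e = v then f e else 0) = (\<Sum>e\<in>arcs G. f e)"
    and "(\<Sum>v\<in>verts G. \<Sum>e\<in>arcs G. if tail G e = v then f e else 0) = (\<Sum>e\<in>arcs G. f e)"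
proof -
  interpret fin_digraph G by fact
  show "(\<Sum>v\<in>verts G. \<Sum>e\<in>arcs G. if head G e = v then f e else 0) = (\<Sum>e\<in>arcs G. f e)"
    "(\<Sum>v\<in>verts G. \<Sum>e\<in>arcs G. if tail G e = v then f e else 0) = (\<Sum>e\<in>arcs G. f e)"
    by (subst sum.swap, simp)+
qed

text \<open>An edge contributes \<open>k e\<close> minus its chips at the head and
  \<open>- k e\<close> at the tail, so the coefficients at the vertices add up to minus the number
  of chips on edges.\<close>

lemma deg_principal:
  assumes G: "fin_digraph G" and keys: "keys A \<subseteq> closed_points G l"
    and prin: "principal G l A"
  shows "deg A = 0"
proof -
  obtain k \<phi> where "potential G l k \<phi> A" using prin by (auto simp: principal_def)
  then have "(\<Sum>v\<in>verts G. lookup A (Vert v)) =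
      (\<Sum>v\<in>verts G. \<Sum>e\<in>arcs G. (if head G e = v then k e - on_edge_count e A else 0) -
        (if tail G e = v then k e else 0))"
    by (simp add: potential_def)
  also have "\<dots> = (\<Sum>e\<in>arcs G. k e - on_edge_count e A) - (\<Sum>e\<in>arcs G. k e)"
    by (simp only: sum_subtractf[of _ _ "arcs G"] sum_subtractf[of _ _ "verts G"] sum_heads[OF G])
  finally show ?thesis by (simp add: deg_eq_sum[OF G keys] sum_subtractf)
qed

section \<open>Slopes bounded by the number of chips\<close>

lemma abs_ev_le:
  fixes g :: "'p \<Rightarrow> 'a::linordered_idom"
  assumes "effective D" "effective D'" "\<And>p. p \<in> keys (D + D') \<Longrightarrow> 0 \<le> g p"
  shows "\<bar>ev g (D - D')\<bar> \<le> ev g (D + D')"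
proof -
  have "0 \<le> ev g D" "0 \<le> ev g D'"
    using assms(3) by (auto intro!: ev_nonneg assms simp: effective_keys_add[OF assms(1,2)])
  then show ?thesis by (simp add: ev_add ev_diff)
qed

lemma count_nonneg: "effective A \<Longrightarrow> 0 \<le> on_edge_count e A"
  by (rule ev_nonneg) (auto simp: edge_fun_def split: point.split)

text \<open>
  If the slope at the tail of \<open>e\<close> is large then \<open>e\<close> leaves a sublevel set of the potential. The
  total slope out of a sublevel set is bounded by the number of chips, and every edge leaving or
  entering it contributes negatively only through its own chips.
\<close>

lemma slope_le:
  assumes G: "fin_digraph G" and l: "\<And>e. e \<in> arcs G \<Longrightarrow> 0 < l e"
    and D: "effective D" "effective D'"
    and keys: "keys (D + D') \<subseteq> closed_points G l"
    and pot: "potential G l k \<phi> (D - D')" and e: "e \<in> arcs G"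
  shows "k e \<le> 2 * (deg D + deg D')"
proof -
  interpret fin_digraph G by fact
  let ?A = "D - D'" let ?B = "D + D'"
  define N where "N e = on_edge_count e ?B" for e
  have B: "effective ?B" using D by (rule effective_add)
  have N0: "0 \<le> N e" for e unfolding N_def using B by (rule count_nonneg)
  have cA: "\<bar>on_edge_count e ?A\<bar> \<le> N e" for e
    unfolding N_def by (rule abs_ev_le[OF D]) (auto simp: edge_fun_def split: point.split)
  have mA: "\<bar>moment l e ?A\<bar> \<le> of_int (N e) * l e" if "e \<in> arcs G" for e
  proof -
    have "\<bar>moment l e ?A\<bar> \<le> moment l e ?B"
      by (rule abs_ev_le[OF D]) (use keys in \<open>auto simp: edge_fun_def closed_points_def split: point.split\<close>)
    also have "\<dots> \<le> ev (\<lambda>p. l e * of_int (edge_fun e (\<lambda>_. 1) p)) ?B"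
      by (rule ev_mono[OF B]) (use keys in \<open>auto simp: edge_fun_def closed_points_def split: point.split\<close>)
    also have "\<dots> = of_int (N e) * l e"
      by (simp add: ev_cmult_fun N_def of_int_ev)
    finally show ?thesis .
  qed
  have d: "deg D + deg D' = (\<Sum>v\<in>verts G. lookup ?B (Vert v)) + (\<Sum>e\<in>arcs G. N e)"
    using deg_eq_sum[OF G keys] by (simp add: deg_add N_def)
  have NB: "0 \<le> (\<Sum>v\<in>verts G. lookup ?B (Vert v))"
    using B by (intro sum_nonneg) (simp add: effective_def)
  have edge: "\<phi> (head G e) - \<phi> (tail G e) = of_int (k e) * l e - moment l e ?A" if "e \<in> arcs G" for e
    using pot that by (simp add: potential_def)
  show ?thesis
  \<comment> \<open>A slope exceeding the number of chips on \<open>e\<close> cannot be cancelled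
    along \<open>e\<close>, so the potential strictly increases from tail to head and
    \<open>e\<close> does leave the sublevel set.\<close>
  proof (cases "k e \<le> N e")
    case True
    have "N e \<le> (\<Sum>e\<in>arcs G. N e)"
      using e N0 by (intro member_le_sum) auto
    with True NB N0[of e] d show ?thesis unfolding distrib_left by linarith
  next
    case False
    have "0 < (of_int (k e) - of_int (N e)) * l e"
      using False l[OF e] by simp
    also have "\<dots> \<le> \<phi> (head G e) - \<phi> (tail G e)"
      using edge[OF e] mA[OF e] by (simp add: left_diff_distrib)
    finally have up: "\<phi> (tail G e) < \<phi> (head G e)" by simp
    define U where "U = {v \<in> verts G. \<phi> v \<le> \<phi> (tail G e)}"
    have fU: "finite U" by (simp add: U_def)
    \<comment> \<open>\<open>T e\<close> is what \<open>e\<close> contributes to the total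
      coefficient of the vertices in \<open>U\<close>; for an edge inside \<open>U\<close> only its
      own chips remain, with reversed sign.\<close>
    define T where "T e = (if head G e \<in> U then k e - on_edge_count e ?A else 0) -
      (if tail G e \<in> U then k e else 0)" for e
    have "(\<Sum>v\<in>U. lookup ?A (Vert v)) =
        (\<Sum>v\<in>U. \<Sum>e\<in>arcs G. (if head G e = v then k e - on_edge_count e ?A else 0) -
          (if tail G e = v then k e else 0))"
      using pot by (intro sum.cong) (auto simp: U_def potential_def)
    also have "\<dots> = (\<Sum>e\<in>arcs G. T e)"
      by (subst sum.swap) (simp add: sum_subtractf fU T_def cong: sum.cong)
    finally have 1: "(\<Sum>v\<in>U. lookup ?A (Vert v)) = (\<Sum>e\<in>arcs G. T e)" .
    have "- lookup ?B (Vert v) \<le> lookup ?A (Vert v)" for v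
      using D by (simp add: lookup_add lookup_minus effective_def)
    then have "- (\<Sum>v\<in>U. lookup ?B (Vert v)) \<le> (\<Sum>v\<in>U. lookup ?A (Vert v))"
      by (simp add: sum_negf[symmetric] sum_mono)
    moreover have "(\<Sum>v\<in>U. lookup ?B (Vert v)) \<le> (\<Sum>v\<in>verts G. lookup ?B (Vert v))"
      using B by (intro sum_mono2) (auto simp: U_def effective_def)
    ultimately have 2: "- (\<Sum>v\<in>verts G. lookup ?B (Vert v)) \<le> (\<Sum>e\<in>arcs G. T e)"
      using 1 by linarith
    \<comment> \<open>An edge entering \<open>U\<close> goes downhill, which bounds its slope above
      by \<open>N e'\<close>; one leaving \<open>U\<close> goes uphill, which bounds its slope below
      by \<open>- N e'\<close>. Chips on the edge account for the second
      \<open>N e'\<close>.\<close>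
    have T: "T e' \<le> 2 * N e'" if e': "e' \<in> arcs G" for e'
    proof -
      have V: "head G e' \<in> verts G" "tail G e' \<in> verts G" using e' by auto
      note m = mA[OF e'] and ed = edge[OF e'] and c = cA[of e'] and n = N0[of e']
      consider "head G e' \<in> U" "tail G e' \<in> U" | "head G e' \<in> U" "tail G e' \<notin> U"
        | "head G e' \<notin> U" "tail G e' \<in> U" | "head G e' \<notin> U" "tail G e' \<notin> U" by blast
      then show ?thesis
      proof cases
        case 1
        then show ?thesis using c n by (simp add: T_def)
      next
        case 2
        then have "\<phi> (head G e') < \<phi> (tail G e')" using V by (auto simp: U_def)
        then have "of_int (k e') * l e' < of_int (N e') * l e'" using m ed by linarith
        then have "k e' < N e'" using l[OF e'] by simp
        then show ?thesis using 2 c by (simp add: T_def)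
      next
        case 3
        then have "\<phi> (tail G e') < \<phi> (head G e')" using V by (auto simp: U_def)
        then have "of_int (- N e') * l e' < of_int (k e') * l e'" using m ed by simp
        then have "of_int (- N e') < (of_int (k e') :: real)"
          unfolding mult_less_cancel_right_pos[OF l[OF e']] .
        then have "- N e' < k e'" unfolding of_int_less_iff .
        then show ?thesis using 3 n by (simp add: T_def)
      next
        case 4
        then show ?thesis using n by (simp add: T_def)
      qed
    qed
    have "tail G e \<in> U" "head G e \<notin> U" using e up by (auto simp: U_def)
    then have Te: "T e = - k e" by (simp add: T_def)
    have "(\<Sum>e\<in>arcs G. T e) = T e + (\<Sum>e'\<in>arcs G - {e}. T e')"
      using e by (simp add: sum.remove)
    also have "(\<Sum>e'\<in>arcs G - {e}. T e') \<le> (\<Sum>e'\<in>arcs G - {e}. 2 * N e')"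
      by (intro sum_mono T) auto
    also have "\<dots> \<le> (\<Sum>e'\<in>arcs G. 2 * N e')"
      by (intro sum_mono2) (auto simp: N0)
    finally have "(\<Sum>e\<in>arcs G. T e) \<le> - k e + 2 * (\<Sum>e\<in>arcs G. N e)"
      by (simp add: Te sum_distrib_left)
    with 2 d NB show ?thesis unfolding distrib_left by linarith
  qed
qed

text \<open>The lower bound is the upper bound for the negated function, whose divisor is
  \<open>D' - D\<close>.\<close>

lemma slope_bound:
  assumes "fin_digraph G" "\<And>e. e \<in> arcs G \<Longrightarrow> 0 < l e" "effective D" "effective D'"
    and "keys (D + D') \<subseteq> closed_points G l" "potential G l k \<phi> (D - D')" "e \<in> arcs G"
  shows "\<bar>k e\<bar> \<le> 2 * (deg D + deg D')"
proof -
  have "potential G l (\<lambda>e. - k e) (\<lambda>v. - \<phi> v) (D' - D)"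
    using potential_uminus[OF assms(6)] by simp
  then have "- k e \<le> 2 * (deg D' + deg D)"
    by (intro slope_le[where G = G and l = l]) (use assms in \<open>auto simp: add.commute\<close>)
  moreover have "k e \<le> 2 * (deg D + deg D')"
    by (rule slope_le) (use assms in auto)
  ultimately show ?thesis unfolding distrib_left by linarith
qed


section \<open>Moving chips from the ends of edges to vertices\<close>

definition normalise :: "('v, 'e) pre_digraph \<Rightarrow> ('e \<Rightarrow> real) \<Rightarrow> ('v, 'e) point \<Rightarrow> ('v, 'e) point" where
  "normalise G l p = (case p of Vert v \<Rightarrow> Vert v
    | Inner e t \<Rightarrow> if t \<le> 0 then Vert (tail G e) else if l e \<le> t then Vert (head G e) else Inner e t)"

lemma normalise_in_points:
  assumes "wf_digraph G" "p \<in> closed_points G l"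
  shows "normalise G l p \<in> points G l"
  using assms by (auto simp: normalise_def closed_points_def points_def wf_digraph_def)

lemma normalise_points: "p \<in> points G l \<Longrightarrow> normalise G l p = p"
  by (auto simp: normalise_def points_def)

text \<open>The vertex values can be kept: dropping the \<open>z e\<close> chips at the tail is
  offset by lowering the initial slope by \<open>z e\<close>, and chips at the head have moment 0.
  The changes in the vertex equations are precisely the chips that arrive.\<close>

lemma principal_normalise:
  assumes G: "fin_digraph G" and l: "\<And>e. e \<in> arcs G \<Longrightarrow> 0 < l e"
    and keys: "keys A \<subseteq> closed_points G l"
    and prin: "principal G l A"
  shows "principal G l (push (normalise G l) A)"
proof -
  interpret fin_digraph G by fact
  let ?A' = "push (normalise G l) A"
  define z :: "_ \<Rightarrow> int" where "z e = ev (edge_fun e (\<lambda>t. if t \<le> 0 then 1 else 0)) A" for e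
  define w :: "_ \<Rightarrow> int" where "w e = ev (edge_fun e (\<lambda>t. if l e \<le> t then 1 else 0)) A" for e
  obtain k \<phi> where pot: "potential G l k \<phi> A" using prin by (auto simp: principal_def)
  have count: "on_edge_count e ?A' = on_edge_count e A - z e - w e" if "e \<in> arcs G" for e
    unfolding ev_push z_def w_def ev_diff_fun[symmetric]
    by (rule ev_cong) (use keys l[OF that] in \<open>auto simp: normalise_def edge_fun_def split: point.split\<close>)
  have mom: "moment l e ?A' = moment l e A - l e * of_int (z e)" if "e \<in> arcs G" for e
    unfolding ev_push z_def w_def of_int_ev ev_cmult_fun[symmetric] ev_diff_fun[symmetric]
    by (rule ev_cong)
      (use keys l[OF that] in \<open>auto simp: closed_points_def normalise_def edge_fun_def split: point.split\<close>)
  have vert: "lookup ?A' (Vert v) = lookup A (Vert v) +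
      (\<Sum>e\<in>arcs G. (if tail G e = v then z e else 0) + (if head G e = v then w e else 0))" for v
  proof -
    have "lookup ?A' (Vert v) = ev (\<lambda>p. (if p = Vert v then 1 else 0) +
      (\<Sum>e\<in>arcs G. (if tail G e = v then 1 else 0) * edge_fun e (\<lambda>t. if t \<le> 0 then 1 else 0) p +
        (if head G e = v then 1 else 0) * edge_fun e (\<lambda>t. if l e \<le> t then 1 else 0) p)) A"
      unfolding lookup_push
    proof (rule ev_cong)
      fix p assume "p \<in> keys A"
      then have "p \<in> closed_points G l" using keys by auto
      then consider u where "p = Vert u" | e t where "p = Inner e t" "e \<in> arcs G" "0 \<le> t" "t \<le> l e"
        by (auto simp: closed_points_def)
      then show "(if normalise G l p = Vert v then 1 else 0 :: int) = (if p = Vert v then 1 else 0) +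
        (\<Sum>e\<in>arcs G. (if tail G e = v then 1 else 0) * edge_fun e (\<lambda>t. if t \<le> 0 then 1 else 0) p +
          (if head G e = v then 1 else 0) * edge_fun e (\<lambda>t. if l e \<le> t then 1 else 0) p)"
      proof cases
        case 2
        have "(\<Sum>e'\<in>arcs G. (if tail G e' = v then 1 else 0) * edge_fun e' (\<lambda>t. if t \<le> 0 then 1 else 0) p +
          (if head G e' = v then 1 else 0) * edge_fun e' (\<lambda>t. if l e' \<le> t then 1 else 0) p) =
          (\<Sum>e'\<in>arcs G. if e = e' then (if tail G e = v then 1 else 0) * (if t \<le> 0 then 1 else 0) +
          (if head G e = v then 1 else 0) * (if l e \<le> t then 1 else 0) else (0::int))"
          by (rule sum.cong) (auto simp: 2)
        also have "\<dots> = (if tail G e = v then 1 else 0) * (if t \<le> 0 then 1 else 0) +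
          (if head G e = v then 1 else 0) * (if l e \<le> t then 1 else 0)"
          using 2 by simp
        finally have *: "(\<Sum>e'\<in>arcs G. (if tail G e' = v then 1 else 0) * edge_fun e' (\<lambda>t. if t \<le> 0 then 1 else 0) p +
          (if head G e' = v then 1 else 0) * edge_fun e' (\<lambda>t. if l e' \<le> t then 1 else 0) p) =
          (if tail G e = v then 1 else 0) * (if t \<le> 0 then 1 else 0) +
          (if head G e = v then 1 else 0) * (if l e \<le> t then 1 else (0::int))" .
        show ?thesis unfolding * using 2 l[of e] by (simp add: normalise_def)
      qed (simp add: normalise_def)
    qed
    also have "\<dots> = lookup A (Vert v) +
      (\<Sum>e\<in>arcs G. (if tail G e = v then z e else 0) + (if head G e = v then w e else 0))"
      unfolding ev_add_fun ev_sum_fun ev_cmult_fun lookup_eq_ev z_def[symmetric] w_def[symmetric]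
      by (intro arg_cong2[where f = "(+)"] sum.cong) auto
    finally show ?thesis .
  qed
  have "potential G l (\<lambda>e. k e - z e) \<phi> ?A'"
    unfolding potential_def
  proof (intro conjI ballI)
    fix e assume "e \<in> arcs G"
    then show "\<phi> (head G e) - \<phi> (tail G e) = of_int (k e - z e) * l e - moment l e ?A'"
      using pot by (simp add: mom potential_def algebra_simps)
  next
    fix v assume "v \<in> verts G"
    then have "lookup A (Vert v) = (\<Sum>e\<in>arcs G.
      (if head G e = v then k e - on_edge_count e A else 0) - (if tail G e = v then k e else 0))"
      using pot by (simp add: potential_def)
    then show "lookup ?A' (Vert v) = (\<Sum>e\<in>arcs G.
      (if head G e = v then k e - z e - on_edge_count e ?A' else 0) - (if tail G e = v then k e - z e else 0))"
      unfolding vert by (simp only: sum.distrib[symmetric]) (rule sum.cong, auto simp: count)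
  qed
  then show ?thesis by (auto simp: principal_def)
qed

section \<open>Contracting edges\<close>

definition link :: "('v, 'e) pre_digraph \<Rightarrow> 'e set \<Rightarrow> ('v \<times> 'v) set" where
  "link G F = (\<Union>e\<in>F. {(tail G e, head G e), (head G e, tail G e)})"

lemma sym_link: "sym (link G F)"
  by (auto simp: link_def sym_def)

lemma link_rtrancl_sym: "(u, v) \<in> (link G F)\<^sup>* \<Longrightarrow> (v, u) \<in> (link G F)\<^sup>*"
  using sym_rtrancl[OF sym_link] by (rule symD)

lemma link_mono: "F \<subseteq> F' \<Longrightarrow> link G F \<subseteq> link G F'"
  by (auto simp: link_def)

lemma link_invariant:
  assumes "(u, v) \<in> (link G F)\<^sup>*" "\<And>e. e \<in> F \<Longrightarrow> f (tail G e) = f (head G e)"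
  shows "f u = f v"
  using assms(1) by (induction rule: rtrancl_induct) (auto simp: link_def assms(2))

text \<open>\<open>\<psi>\<close> names the surviving edges and all others are collapsed. Ends are
  compared as unordered pairs, as orientations may be reversed. Isomorphisms, contractions of
  shrinking edges and removals of attached loops are all instances.\<close>

locale contraction =
  fixes H :: "('v, 'e) pre_digraph" and G :: "('u, 'f) pre_digraph"
    and \<pi> :: "'v \<Rightarrow> 'u" and \<psi> :: "'f \<Rightarrow> 'e"
  assumes H: "fin_digraph H" and G: "fin_digraph G"
    and verts: "\<pi> ` verts H = verts G"
    and inj: "inj_on \<psi> (arcs G)" and arcs: "\<psi> ` arcs G \<subseteq> arcs H"
    and ends: "\<And>e. e \<in> arcs G \<Longrightarrow> {tail G e, head G e} = {\<pi> (tail H (\<psi> e)), \<pi> (head H (\<psi> e))}"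
    and collapsed: "\<And>e. e \<in> arcs H - \<psi> ` arcs G \<Longrightarrow> \<pi> (tail H e) = \<pi> (head H e)"
    and fibre_connected: "\<And>u v. u \<in> verts H \<Longrightarrow> v \<in> verts H \<Longrightarrow> \<pi> u = \<pi> v \<Longrightarrow>
      (u, v) \<in> (link H (arcs H - \<psi> ` arcs G))\<^sup>*"
begin

abbreviation "collapsed_arcs \<equiv> arcs H - \<psi> ` arcs G"

text \<open>When the image is a loop both orientations match; the edge then counts as direct, so the
  coordinate on it is still determined.\<close>

definition direct :: "'f \<Rightarrow> bool" where
  "direct e \<longleftrightarrow> tail G e = \<pi> (tail H (\<psi> e))"

lemma direct_ends:
  assumes "e \<in> arcs G"
  shows "direct e \<Longrightarrow> tail G e = \<pi> (tail H (\<psi> e)) \<and> head G e = \<pi> (head H (\<psi> e))"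
    and "\<not> direct e \<Longrightarrow> tail G e = \<pi> (head H (\<psi> e)) \<and> head G e = \<pi> (tail H (\<psi> e))"
  using ends[OF assms] by (auto simp: direct_def doubleton_eq_iff)

text \<open>A reversed edge is reflected. A collapsed edge goes to the image of its tail, which
  \<open>collapsed\<close> makes the image of its head as well.\<close>

definition collapse_point :: "('e \<Rightarrow> real) \<Rightarrow> ('v, 'e) point \<Rightarrow> ('u, 'f) point" where
  "collapse_point l p = (case p of Vert v \<Rightarrow> Vert (\<pi> v)
    | Inner e t \<Rightarrow> if e \<in> \<psi> ` arcs G
        then let f = inv_into (arcs G) \<psi> e in Inner f (if direct f then t else l e - t)
        else Vert (\<pi> (tail H e)))"

lemma collapse_point_Vert [simp]: "collapse_point l (Vert v) = Vert (\<pi> v)"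
  by (simp add: collapse_point_def)

lemma collapse_point_arc:
  "f \<in> arcs G \<Longrightarrow> collapse_point l (Inner (\<psi> f) t) = Inner f (if direct f then t else l (\<psi> f) - t)"
  by (simp add: collapse_point_def inv_into_f_f[OF inj] Let_def)

lemma collapse_point_collapsed [simp]:
  "e \<notin> \<psi> ` arcs G \<Longrightarrow> collapse_point l (Inner e t) = Vert (\<pi> (tail H e))"
  by (simp add: collapse_point_def)

lemma closed_points_cases:
  assumes "p \<in> closed_points H l"
  obtains v where "p = Vert v" "v \<in> verts H"
    | f t where "p = Inner (\<psi> f) t" "f \<in> arcs G" "0 \<le> t" "t \<le> l (\<psi> f)"
    | e t where "p = Inner e t" "e \<in> arcs H" "e \<notin> \<psi> ` arcs G" "0 \<le> t" "t \<le> l e"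
  using assms unfolding closed_points_def by blast

lemma collapse_point_in_closed_points:
  assumes "p \<in> closed_points H l" "\<And>e. e \<in> arcs G \<Longrightarrow> m e = l (\<psi> e)"
  shows "collapse_point l p \<in> closed_points G m"
proof -
  interpret H: fin_digraph H by (rule H)
  show ?thesis
    using assms(1)
    by (cases rule: closed_points_cases)
      (use verts assms(2) in \<open>auto simp: closed_points_def collapse_point_arc\<close>)
qed

lemma sum_arcs_split:
  fixes a :: "'e \<Rightarrow> 'b::comm_monoid_add"
  shows "(\<Sum>e\<in>arcs H. a e) = (\<Sum>f\<in>arcs G. a (\<psi> f)) + (\<Sum>e\<in>collapsed_arcs. a e)"
proof -
  interpret H: fin_digraph H by (rule H)
  have "(\<Sum>e\<in>arcs H. a e) = (\<Sum>e\<in>\<psi> ` arcs G. a e) + (\<Sum>e\<in>collapsed_arcs. a e)"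
    using sum.subset_diff[OF arcs H.finite_arcs] by (simp add: add.commute)
  then show ?thesis by (simp add: sum.reindex[OF inj])
qed

text \<open>
  Along a contracted edge of length zero, and around a contracted loop, the potential does not
  change, so it descends; summing the vertex conditions over a fibre leaves only the chips on
  contracted edges.
\<close>

lemma principal_collapse:
  assumes keys: "keys A \<subseteq> closed_points H l"
    and m: "\<And>e. e \<in> arcs G \<Longrightarrow> m e = l (\<psi> e)"
    and l: "\<And>e. e \<in> collapsed_arcs \<Longrightarrow> l e = 0 \<or> tail H e = head H e"
    and prin: "principal H l A"
  shows "principal G m (push (collapse_point l) A)"
proof -
  interpret H: fin_digraph H by (rule H)
  interpret G: fin_digraph G by (rule G)
  let ?A' = "push (collapse_point l) A"
  obtain k \<phi> where pot: "potential H l k \<phi> A" using prin by (auto simp: principal_def)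
  have const: "\<phi> (tail H e) = \<phi> (head H e)" if e: "e \<in> collapsed_arcs" for e
  proof (cases "l e = 0")
    case True
    \<comment> \<open>On an edge of length 0 all chips sit at 0, so each has moment 0.\<close>
    have "moment l e A = 0"
      by (rule ev_eq_0) (use keys True in \<open>auto simp: edge_fun_def closed_points_def split: point.split\<close>)
    moreover have "\<phi> (head H e) - \<phi> (tail H e) = of_int (k e) * l e - moment l e A"
      using pot e unfolding potential_def by blast
    ultimately show ?thesis using True by (simp only:)
  qed (use l[OF e] in simp)
  define \<phi>' where "\<phi>' u = \<phi> (SOME v. v \<in> verts H \<and> \<pi> v = u)" for u
  have \<phi>': "\<phi>' (\<pi> v) = \<phi> v" if v: "v \<in> verts H" for v
  proof -
    let ?w = "SOME w. w \<in> verts H \<and> \<pi> w = \<pi> v"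
    have "?w \<in> verts H \<and> \<pi> ?w = \<pi> v" by (rule someI[of _ v]) (simp add: v)
    then have "(?w, v) \<in> (link H collapsed_arcs)\<^sup>*" using v by (intro fibre_connected) simp_all
    then show ?thesis unfolding \<phi>'_def by (rule link_invariant[where f = \<phi>]) (rule const)
  qed
  \<comment> \<open>Read from the other end, the initial slope is the negative of the final slope,
    and the final slope is \<open>k\<close> minus the number of chips on the edge.\<close>
  define k' where "k' f = (if direct f then k (\<psi> f) else on_edge_count (\<psi> f) A - k (\<psi> f))" for f
  have aux: "edge_fun f F (collapse_point l p) =
      edge_fun (\<psi> f) (\<lambda>t. F (if direct f then t else l (\<psi> f) - t)) p"
    if "f \<in> arcs G" "p \<in> keys A" for f p and F :: "real \<Rightarrow> 'x::zero"
  proof -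
    from that keys have "p \<in> closed_points H l" by auto
    then show ?thesis
    proof (cases rule: closed_points_cases)
      case (2 f' t)
      then show ?thesis using that inj by (auto simp: collapse_point_arc inj_on_eq_iff)
    qed (use that in auto)
  qed
  have count: "on_edge_count f ?A' = on_edge_count (\<psi> f) A" if "f \<in> arcs G" for f
    unfolding ev_push by (rule ev_cong) (simp add: aux that)
  have mom: "moment m f ?A' = (if direct f then moment l (\<psi> f) A
      else of_int (on_edge_count (\<psi> f) A) * l (\<psi> f) - moment l (\<psi> f) A)" if "f \<in> arcs G" for f
  proof -
    have "moment m f ?A' = ev (edge_fun (\<psi> f) (\<lambda>t. m f - (if direct f then t else l (\<psi> f) - t))) A"
      unfolding ev_push by (rule ev_cong) (simp add: aux that)
    also have "\<dots> = (if direct f then moment l (\<psi> f) A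
      else ev (\<lambda>p. l (\<psi> f) * of_int (edge_fun (\<psi> f) (\<lambda>_. 1) p) - edge_fun (\<psi> f) (\<lambda>t. l (\<psi> f) - t) p) A)"
      unfolding m[OF that] by (auto simp: edge_fun_def split: point.split intro!: ev_cong)
    finally show ?thesis by (simp add: ev_diff_fun ev_cmult_fun of_int_ev)
  qed
  have vert: "lookup ?A' (Vert u) =
      (\<Sum>v\<in>{v\<in>verts H. \<pi> v = u}. lookup A (Vert v)) +
      (\<Sum>e\<in>collapsed_arcs. if \<pi> (tail H e) = u then on_edge_count e A else 0)" for u
  proof -
    have "lookup ?A' (Vert u) = ev (\<lambda>p.
      (\<Sum>v\<in>{v\<in>verts H. \<pi> v = u}. if p = Vert v then 1 else 0) +
      (\<Sum>e\<in>collapsed_arcs. (if \<pi> (tail H e) = u then 1 else 0) * edge_fun e (\<lambda>_. 1) p)) A"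
      unfolding lookup_push
    proof (rule ev_cong)
      fix p assume "p \<in> keys A"
      then have "p \<in> closed_points H l" using keys by auto
      then show "(if collapse_point l p = Vert u then 1 else 0) =
        (\<Sum>v\<in>{v\<in>verts H. \<pi> v = u}. if p = Vert v then 1 else 0) +
        (\<Sum>e\<in>collapsed_arcs. (if \<pi> (tail H e) = u then 1 else 0) * edge_fun e (\<lambda>_. 1) p :: int)"
      proof (cases rule: closed_points_cases)
        case (2 f t)
        have "(\<Sum>e\<in>collapsed_arcs. (if \<pi> (tail H e) = u then 1 else 0) * edge_fun e (\<lambda>_. 1) p :: int) = 0"
          using 2 by (intro sum.neutral) auto
        then show ?thesis using 2 by (simp add: collapse_point_arc)
      next
        case (3 e t)
        have "(\<Sum>e'\<in>collapsed_arcs. (if \<pi> (tail H e') = u then 1 else 0) * edge_fun e' (\<lambda>_. 1) p :: int) =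
          (\<Sum>e'\<in>collapsed_arcs. if e = e' then (if \<pi> (tail H e) = u then 1 else 0) else 0)"
          by (intro sum.cong) (auto simp: 3)
        also have "\<dots> = (if \<pi> (tail H e) = u then 1 else 0)"
          using 3 by simp
        finally show ?thesis using 3 by simp
      qed simp
    qed
    also have "\<dots> = (\<Sum>v\<in>{v\<in>verts H. \<pi> v = u}. lookup A (Vert v)) +
      (\<Sum>e\<in>collapsed_arcs. if \<pi> (tail H e) = u then on_edge_count e A else 0)"
      unfolding ev_add_fun ev_sum_fun ev_cmult_fun lookup_eq_ev
      by (intro arg_cong2[where f = "(+)"] sum.cong) auto
    finally show ?thesis .
  qed
  have "potential G m k' \<phi>' ?A'"
    unfolding potential_def
  proof (intro conjI ballI)
    fix f assume f: "f \<in> arcs G"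
    then have e: "\<psi> f \<in> arcs H" using arcs by auto
    then have "\<phi> (head H (\<psi> f)) - \<phi> (tail H (\<psi> f)) = of_int (k (\<psi> f)) * l (\<psi> f) - moment l (\<psi> f) A"
      using pot by (simp add: potential_def)
    then show "\<phi>' (head G f) - \<phi>' (tail G f) = of_int (k' f) * m f - moment m f ?A'"
      unfolding mom[OF f] unfolding m[OF f] using f e direct_ends[OF f]
      by (cases "direct f") (simp_all add: k'_def \<phi>' left_diff_distrib)
  next
    fix u assume "u \<in> verts G"
    let ?F = "{v\<in>verts H. \<pi> v = u}"
    have "(\<Sum>v\<in>?F. lookup A (Vert v)) =
      (\<Sum>v\<in>?F. \<Sum>e\<in>arcs H. (if head H e = v then k e - on_edge_count e A else 0) -
        (if tail H e = v then k e else 0))"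
      using pot by (intro sum.cong) (auto simp: potential_def)
    also have "\<dots> = (\<Sum>e\<in>arcs H. (if \<pi> (head H e) = u then k e - on_edge_count e A else 0) -
        (if \<pi> (tail H e) = u then k e else 0))"
      by (subst sum.swap) (rule sum.cong, auto simp: sum_subtractf)
    also have "\<dots> = (\<Sum>f\<in>arcs G. (if \<pi> (head H (\<psi> f)) = u then k (\<psi> f) - on_edge_count (\<psi> f) A else 0) -
        (if \<pi> (tail H (\<psi> f)) = u then k (\<psi> f) else 0)) +
        (\<Sum>e\<in>collapsed_arcs. (if \<pi> (head H e) = u then k e - on_edge_count e A else 0) -
        (if \<pi> (tail H e) = u then k e else 0))"
      by (rule sum_arcs_split)
    also have "(\<Sum>f\<in>arcs G. (if \<pi> (head H (\<psi> f)) = u then k (\<psi> f) - on_edge_count (\<psi> f) A else 0) -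
        (if \<pi> (tail H (\<psi> f)) = u then k (\<psi> f) else 0)) =
        (\<Sum>f\<in>arcs G. (if head G f = u then k' f - on_edge_count f ?A' else 0) -
          (if tail G f = u then k' f else 0))"
    proof (rule sum.cong)
      fix f assume f: "f \<in> arcs G"
      show "(if \<pi> (head H (\<psi> f)) = u then k (\<psi> f) - on_edge_count (\<psi> f) A else 0) -
        (if \<pi> (tail H (\<psi> f)) = u then k (\<psi> f) else 0) =
        (if head G f = u then k' f - on_edge_count f ?A' else 0) - (if tail G f = u then k' f else 0)"
        using direct_ends[OF f] by (cases "direct f") (simp_all add: count f k'_def)
    qed simp
    also have "(\<Sum>e\<in>collapsed_arcs. (if \<pi> (head H e) = u then k e - on_edge_count e A else 0) -
        (if \<pi> (tail H e) = u then k e else 0)) =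
        - (\<Sum>e\<in>collapsed_arcs. if \<pi> (tail H e) = u then on_edge_count e A else 0)"
      unfolding sum_negf[symmetric] by (rule sum.cong) (auto simp: collapsed)
    finally show "lookup ?A' (Vert u) =
        (\<Sum>f\<in>arcs G. (if head G f = u then k' f - on_edge_count f ?A' else 0) -
          (if tail G f = u then k' f else 0))"
      unfolding vert by simp
  qed
  then show ?thesis by (auto simp: principal_def)
qed

end


section \<open>Attached loops\<close>

lemma attach_loops_simps [simp]:
  "verts (attach_loops G w) = verts G"
  "arcs (attach_loops G w) = Inl ` arcs G \<union> Inr ` (SIGMA v:verts G. {..<w v})"
  "tail (attach_loops G w) (Inl e) = tail G e" "tail (attach_loops G w) (Inr x) = fst x"
  "head (attach_loops G w) (Inl e) = head G e" "head (attach_loops G w) (Inr x) = fst x"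
  by (simp_all add: attach_loops_def)

lemma attach_loops_length_simps [simp]:
  "attach_loops_length \<epsilon> l (Inl e) = l e" "attach_loops_length \<epsilon> l (Inr x) = \<epsilon>"
  by (simp_all add: attach_loops_length_def)

lemma fin_digraph_attach_loops:
  assumes "fin_digraph G"
  shows "fin_digraph (attach_loops G w)"
proof -
  interpret fin_digraph G by fact
  show ?thesis by unfold_locales auto
qed

text \<open>Fibres are single vertices and the collapsed edges are loops, so
  \<open>principal_collapse\<close> applies although their length is positive.\<close>

lemma contraction_attach_loops:
  assumes "fin_digraph G"
  shows "contraction (attach_loops G w) G (\<lambda>v. v) Inl"
  by (rule contraction.intro) (use assms fin_digraph_attach_loops in auto)

lemma include_point_in_points:
  "include_point p \<in> points (attach_loops G w) (attach_loops_length \<epsilon> l) \<longleftrightarrow> p \<in> points G l"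
  by (cases p) (auto simp: points_def)

lemma edge_fun_include_point [simp]:
  "edge_fun (Inl e) F (include_point p) = edge_fun e F p"
  "edge_fun (Inr x) F (include_point p) = 0"
  by (cases p; simp)+

lemma include_point_eq_Vert [simp]: "include_point p = Vert v \<longleftrightarrow> p = Vert v"
  by (cases p) auto

text \<open>The function is extended over each attached loop as a constant, with slope 0.\<close>

lemma principal_include:
  assumes G: "fin_digraph G" and prin: "principal G l A"
  shows "principal (attach_loops G w) (attach_loops_length \<epsilon> l) (push include_point A)"
proof -
  interpret fin_digraph G by fact
  obtain k \<phi> where pot: "potential G l k \<phi> A" using prin by (auto simp: principal_def)
  have fin: "finite (Inr ` (SIGMA v:verts G. {..<w v}) :: ('b + 'a \<times> nat) set)" by simp
  have "potential (attach_loops G w) (attach_loops_length \<epsilon> l) (case_sum k (\<lambda>_. 0)) \<phi> (push include_point A)"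
    unfolding potential_def
  proof (intro conjI ballI)
    fix e assume "e \<in> arcs (attach_loops G w)"
    then show "\<phi> (head (attach_loops G w) e) - \<phi> (tail (attach_loops G w) e) =
        of_int (case_sum k (\<lambda>_. 0) e) * attach_loops_length \<epsilon> l e -
        moment (attach_loops_length \<epsilon> l) e (push include_point A)"
      using pot by (auto simp: ev_push potential_def)
  next
    fix v assume "v \<in> verts (attach_loops G w)"
    then have "lookup A (Vert v) = (\<Sum>e\<in>arcs G.
        (if head G e = v then k e - on_edge_count e A else 0) - (if tail G e = v then k e else 0))"
      using pot by (simp add: potential_def)
    then show "lookup (push include_point A) (Vert v) =
      (\<Sum>e\<in>arcs (attach_loops G w).
        (if head (attach_loops G w) e = v then case_sum k (\<lambda>_. 0) e - on_edge_count e (push include_point A) else 0) -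
        (if tail (attach_loops G w) e = v then case_sum k (\<lambda>_. 0) e else 0))"
      unfolding attach_loops_simps
      by (subst sum.union_disjoint[OF _ fin])
        (auto simp: lookup_push lookup_eq_ev[symmetric] sum.reindex ev_push o_def intro!: sum.neutral cong: if_cong)
  qed
  then show ?thesis by (auto simp: principal_def)
qed

text \<open>
  A divisor of degree \<open>n\<close> on a circle is equivalent to \<open>(n + 1) v - q\<close> for a suitable \<open>q\<close>, where
  \<open>v\<close> is the base point.
\<close>

definition retract_loops :: "('v, 'e) pre_digraph \<Rightarrow> 'e set \<Rightarrow> ('v, 'e) point \<Rightarrow> ('v, 'e) point" where
  "retract_loops H L p = (case p of Vert v \<Rightarrow> Vert v
    | Inner e t \<Rightarrow> if e \<in> L then Vert (tail H e) else Inner e t)"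

lemma principal_loop_moves:
  fixes B :: "('v, 'e) point divisor"
  assumes H: "fin_digraph H" and L: "L \<subseteq> arcs H"
    and loop: "\<And>e. e \<in> L \<Longrightarrow> tail H e = head H e \<and> 0 < l e"
  obtains q where "\<And>e. e \<in> L \<Longrightarrow> 0 \<le> q e \<and> q e < l e"
    and "principal H l (push (retract_loops H L) B + (\<Sum>e\<in>L. frag_of (Vert (tail H e))) -
      (B + (\<Sum>e\<in>L. frag_of (Inner e (q e)))))"
proof -
  interpret fin_digraph H by fact
  have fL: "finite L" using L by (rule finite_subset) simp
  \<comment> \<open>With all vertex values 0, the equation on a loop reads
    \<open>q e = k e * l e + moment l e B + l e\<close>; \<open>k e\<close> is the one integer for
    which \<open>0 \<le> q e < l e\<close>. The value 0, the base point itself, can occur.\<close>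
  define k where "k e = (if e \<in> L then - \<lfloor>moment l e B / l e\<rfloor> - 1 else 0)" for e
  define q where "q e = of_int (k e) * l e + moment l e B + l e" for e
  have q: "0 \<le> q e \<and> q e < l e" if "e \<in> L" for e
  proof -
    let ?y = "moment l e B / l e"
    have "q e = (?y - of_int \<lfloor>?y\<rfloor>) * l e"
      using that loop[OF that] by (simp add: q_def k_def field_simps)
    moreover have "0 \<le> ?y - of_int \<lfloor>?y\<rfloor>" "?y - of_int \<lfloor>?y\<rfloor> < 1"
      by linarith+
    ultimately show ?thesis using loop[OF that] by simp
  qed
  let ?A = "push (retract_loops H L) B + (\<Sum>e\<in>L. frag_of (Vert (tail H e))) -
      (B + (\<Sum>e\<in>L. frag_of (Inner e (q e))))"
  have evA: "ev (edge_fun e F) ?A = (if e \<in> L then - ev (edge_fun e F) B - F (q e) else 0)"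
    for e and F :: "real \<Rightarrow> 'x::comm_ring_1"
  proof -
    have "ev (edge_fun e F) (push (retract_loops H L) B) = (if e \<in> L then 0 else ev (edge_fun e F) B)"
      unfolding ev_push
      by (auto simp: retract_loops_def edge_fun_def intro!: ev_cong ev_eq_0 split: point.split)
    moreover have "(\<Sum>e'\<in>L. edge_fun e F (Inner e' (q e'))) = (if e \<in> L then F (q e) else 0)"
      using fL by (simp cong: if_cong)
    ultimately show ?thesis by (simp add: ev_add ev_diff ev_sum)
  qed
  have vert: "lookup ?A (Vert v) =
      (\<Sum>e\<in>L. if tail H e = v then on_edge_count e B + 1 else 0)" for v
  proof -
    have "lookup (push (retract_loops H L) B) (Vert v) =
        ev (\<lambda>p. (if p = Vert v then 1 else 0) + (\<Sum>e\<in>L. (if tail H e = v then 1 else 0) * edge_fun e (\<lambda>_. 1) p)) B"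
      unfolding lookup_push
    proof (rule ev_cong)
      fix p
      show "(if retract_loops H L p = Vert v then 1 else 0) =
        (if p = Vert v then 1 else 0) + (\<Sum>e\<in>L. (if tail H e = v then 1 else 0) * edge_fun e (\<lambda>_. 1) p :: int)"
      proof (cases p)
        case (Inner e t)
        have "(\<Sum>e'\<in>L. (if tail H e' = v then 1 else 0) * edge_fun e' (\<lambda>_. 1) p :: int) =
          (\<Sum>e'\<in>L. if e = e' then (if tail H e = v then 1 else 0) else 0)"
          by (intro sum.cong) (auto simp: Inner)
        then show ?thesis using Inner fL by (simp add: retract_loops_def)
      qed (simp add: retract_loops_def)
    qed
    then have "lookup (push (retract_loops H L) B) (Vert v) =
        lookup B (Vert v) + (\<Sum>e\<in>L. if tail H e = v then on_edge_count e B else 0)"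
      unfolding ev_add_fun ev_sum_fun ev_cmult_fun lookup_eq_ev[symmetric]
      by (auto intro!: sum.cong)
    then show ?thesis
      by (simp add: lookup_add lookup_minus lookup_sum sum.distrib[symmetric])
        (rule sum.cong, auto)
  qed
  have "potential H l k (\<lambda>_. 0) ?A"
    unfolding potential_def
  proof (intro conjI ballI)
    fix e assume "e \<in> arcs H"
    show "0 - 0 = of_int (k e) * l e - moment l e ?A"
      unfolding evA by (simp add: q_def k_def)
  next
    fix v assume "v \<in> verts H"
    have "(\<Sum>e\<in>L. if tail H e = v then on_edge_count e B + 1 else 0) =
      (\<Sum>e\<in>arcs H. (if head H e = v then k e - on_edge_count e ?A else 0) - (if tail H e = v then k e else 0))"
      unfolding evA
      by (rule sum.mono_neutral_cong_left) (use L loop in \<open>auto simp: k_def\<close>)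
    then show "lookup ?A (Vert v) =
      (\<Sum>e\<in>arcs H. (if head H e = v then k e - on_edge_count e ?A else 0) - (if tail H e = v then k e else 0))"
      unfolding vert .
  qed
  then have "principal H l ?A" by (auto simp: principal_def)
  with q show ?thesis using that by blast
qed

section \<open>Generic positions\<close>

text \<open>Genericity is rational independence: slopes and multiplicities are integers, so
  potentials relate lengths and positions only by rational linear combinations.\<close>

interpretation rat: vector_space "\<lambda>(q::rat) (x::real). of_rat q * x"
  by unfold_locales (auto simp: algebra_simps of_rat_add of_rat_mult)

lemma countable_rat_span: "finite S \<Longrightarrow> countable (rat.span S)"
proof (induction S rule: finite_induct)
  case (insert a S)
  have "rat.span (insert a S) \<subseteq> (\<lambda>(q, y). of_rat q * a + y) ` (UNIV \<times> rat.span S)"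
  proof
    fix x assume "x \<in> rat.span (insert a S)"
    then obtain q where "x - of_rat q * a \<in> rat.span S"
      unfolding rat.span_insert by auto
    then show "x \<in> (\<lambda>(q, y). of_rat q * a + y) ` (UNIV \<times> rat.span S)"
      by (intro image_eqI[of _ _ "(q, x - of_rat q * a)"]) auto
  qed
  moreover have "countable ((\<lambda>(q, y). of_rat q * a + y) ` ((UNIV :: rat set) \<times> rat.span S))"
    using insert.IH by (intro countable_image countable_SIGMA) auto
  ultimately show ?case by (rule countable_subset)
qed simp

lemma rat_span_of_int_mult:
  assumes "x \<in> rat.span S"
  shows "of_int k * x \<in> rat.span S"
  using rat.span_scale[OF assms, of "of_int k"] by simp

text \<open>Countable spans cannot fill an interval, so positions are added one by one, independent
  over a basis of \<open>M\<close>. The exchange inequality then shows that new data spanning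
  \<open>card R'\<close> of them must have at least that many members. All subsets \<open>R'\<close>
  are covered, because one joint choice has to serve every fibre.\<close>

lemma generic_positions:
  fixes b :: "'e \<Rightarrow> real"
  assumes M: "finite M" and R: "finite R" and b: "\<And>e. e \<in> R \<Longrightarrow> 0 < b e"
  obtains x where "\<And>e. e \<in> R \<Longrightarrow> 0 < x e \<and> x e < b e"
    and "\<And>R' Y. R' \<subseteq> R \<Longrightarrow> finite Y \<Longrightarrow> x ` R' \<subseteq> rat.span (M \<union> Y) \<Longrightarrow> card R' \<le> card Y"
proof -
  obtain B where B: "B \<subseteq> M" "rat.independent B" "M \<subseteq> rat.span B"
    using rat.maximal_independent_subset[of M] by metis
  have fB: "finite B" using B(1) M by (rule finite_subset)
  have "\<exists>x. (\<forall>e\<in>R. 0 < x e \<and> x e < b e) \<and> inj_on x R \<and> B \<inter> x ` R = {} \<and>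
      rat.independent (B \<union> x ` R)"
    using R b
  proof (induction R rule: finite_induct)
    case empty
    then show ?case using B by simp
  next
    case (insert e R)
    then obtain x where x: "\<forall>e\<in>R. 0 < x e \<and> x e < b e" "inj_on x R" "B \<inter> x ` R = {}"
      "rat.independent (B \<union> x ` R)" by auto
    have "countable (rat.span (B \<union> x ` R))"
      by (rule countable_rat_span) (use fB insert.hyps in auto)
    moreover have "uncountable {0<..<b e}"
      using insert.prems by (simp add: uncountable_open_interval)
    ultimately have "\<not> {0<..<b e} \<subseteq> rat.span (B \<union> x ` R)"
      using countable_subset by blast
    then obtain y where "y \<in> {0<..<b e}" and y3: "y \<notin> rat.span (B \<union> x ` R)" by blast
    then have y: "0 < y" "y < b e" "y \<notin> rat.span (B \<union> x ` R)" by auto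
    have y': "y \<notin> B \<union> x ` R" using y3 rat.span_base[of y "B \<union> x ` R"] by metis
    have im: "(x(e := y)) ` insert e R = insert y (x ` R)" using insert.hyps by auto
    have "rat.independent (insert y (B \<union> x ` R))"
      using x(4) y(3) by (simp add: rat.independent_insert y')
    moreover have "B \<union> insert y (x ` R) = insert y (B \<union> x ` R)" by auto
    ultimately have "rat.independent (B \<union> (x(e := y)) ` insert e R)"
      unfolding im by simp
    moreover have "inj_on (x(e := y)) (insert e R)"
      using x(2) y' insert.hyps by (auto simp: inj_on_def)
    moreover have "B \<inter> (x(e := y)) ` insert e R = {}" unfolding im using x(3) y' by auto
    moreover have "\<forall>e'\<in>insert e R. 0 < (x(e := y)) e' \<and> (x(e := y)) e' < b e'"
      using x(1) y by simp
    ultimately show ?case by blast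
  qed
  then obtain x where x: "\<forall>e\<in>R. 0 < x e \<and> x e < b e" "inj_on x R" "B \<inter> x ` R = {}"
    "rat.independent (B \<union> x ` R)" by auto
  have "card R' \<le> card Y" if R': "R' \<subseteq> R" and Y: "finite Y" and sp: "x ` R' \<subseteq> rat.span (M \<union> Y)" for R' Y
  proof -
    have ind: "rat.independent (B \<union> x ` R')"
      by (rule rat.independent_mono[OF x(4)]) (use R' in auto)
    have "M \<union> Y \<subseteq> rat.span (B \<union> Y)"
      using B(3) rat.span_mono[of B "B \<union> Y"] rat.span_superset[of "B \<union> Y"] by auto
    then have "rat.span (M \<union> Y) \<subseteq> rat.span (B \<union> Y)"
      by (rule rat.span_minimal) (rule rat.subspace_span)
    then have "B \<union> x ` R' \<subseteq> rat.span (B \<union> Y)"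
      using sp rat.span_superset[of "B \<union> Y"] by auto
    with ind have "card (B \<union> x ` R') \<le> card (B \<union> Y)"
      using rat.independent_span_bound[of "B \<union> Y"] fB Y by auto
    also have "\<dots> \<le> card B + card Y" by (rule card_Un_le)
    also have "card (B \<union> x ` R') = card B + card (x ` R')"
      using x(3) R' R fB by (intro card_Un_disjoint) (auto dest: finite_subset)
    also have "card (x ` R') = card R'"
      using x(2) R' by (intro card_image) (rule inj_on_subset)
    finally show ?thesis by simp
  qed
  with x(1) show ?thesis using that by blast
qed


section \<open>Removable edges\<close>

lemma rtrancl_exit:
  assumes "(u, v) \<in> R\<^sup>*" "u \<in> W" "v \<notin> W"
  obtains a b where "(a, b) \<in> R" "a \<in> W" "b \<notin> W"
  using assms by (induction rule: rtrancl_induct) blast+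

text \<open>A spanning tree grown from \<open>r\<close>: each new vertex is reached by one edge
  leaving the set reached so far.\<close>

lemma spanning_edges:
  assumes U: "finite U" "U \<noteq> {}" and F: "finite F"
    and ends: "\<And>e. e \<in> F \<Longrightarrow> tail G e \<in> U \<and> head G e \<in> U"
    and conn: "\<And>u v. u \<in> U \<Longrightarrow> v \<in> U \<Longrightarrow> (u, v) \<in> (link G F)\<^sup>*"
  obtains T where "T \<subseteq> F" "card T < card U" "\<And>u v. u \<in> U \<Longrightarrow> v \<in> U \<Longrightarrow> (u, v) \<in> (link G T)\<^sup>*"
proof -
  obtain r where r: "r \<in> U" using U by auto
  have "\<exists>W T. r \<in> W \<and> W \<subseteq> U \<and> card W = Suc m \<and> T \<subseteq> F \<and> card T \<le> m \<and> (\<forall>w\<in>W. (r, w) \<in> (link G T)\<^sup>*)"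
    if "Suc m \<le> card U" for m
    using that
  proof (induction m)
    case 0
    show ?case by (intro exI[of _ "{r}"] exI[of _ "{}"]) (use r in auto)
  next
    case (Suc m)
    then obtain W T where W: "r \<in> W" "W \<subseteq> U" "card W = Suc m" "T \<subseteq> F" "card T \<le> m"
      "\<forall>w\<in>W. (r, w) \<in> (link G T)\<^sup>*" by auto
    have "W \<noteq> U" using W(3) Suc.prems by auto
    then obtain u where u: "u \<in> U" "u \<notin> W" using W(2) by auto
    from rtrancl_exit[OF conn[OF r u(1)] W(1) u(2)]
    obtain a c where ac: "(a, c) \<in> link G F" "a \<in> W" "c \<notin> W" .
    then obtain e where e: "e \<in> F" "(a, c) \<in> link G {e}" by (auto simp: link_def)
    have c: "c \<in> U" using e ends by (auto simp: link_def)
    have fW: "finite W" and fT: "finite T" using W F U by (auto dest: finite_subset)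
    have mono: "(link G T)\<^sup>* \<subseteq> (link G (insert e T))\<^sup>*" "link G {e} \<subseteq> link G (insert e T)"
      by (intro rtrancl_mono link_mono; auto)+
    then have "(r, c) \<in> (link G (insert e T))\<^sup>*"
      using W(6) ac(2) e(2) by (meson rtrancl.rtrancl_into_rtrancl subsetD)
    then have "\<forall>w\<in>insert c W. (r, w) \<in> (link G (insert e T))\<^sup>*"
      using W(6) mono by auto
    moreover have "card (insert c W) = Suc (Suc m)" using fW ac(3) W(3) by simp
    moreover have "card (insert e T) \<le> Suc m" using fT W(5) by (simp add: card_insert_if)
    ultimately show ?case
      by (intro exI[of _ "insert c W"] exI[of _ "insert e T"]) (use W c e in auto)
  qed
  from this[of "card U - 1"] obtain W T where W: "r \<in> W" "W \<subseteq> U" "card W = card U" "T \<subseteq> F"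
    "card T \<le> card U - 1" "\<forall>w\<in>W. (r, w) \<in> (link G T)\<^sup>*"
    using U by (auto simp: card_gt_0_iff Suc_le_eq)
  have "W = U" using card_subset_eq[OF U(1) W(2,3)] .
  moreover have "0 < card U" using U by (simp add: card_gt_0_iff)
  then have "card T < card U" using W(5) by linarith
  moreover have "(u, v) \<in> (link G T)\<^sup>*" if "u \<in> U" "v \<in> U" for u v
    by (rule rtrancl_trans[OF link_rtrancl_sym[of r]]) (use that W(6) \<open>W = U\<close> in auto)
  ultimately show ?thesis using that[OF W(4)] by blast
qed

text \<open>Off a spanning tree at least \<open>card F - card U + 1\<close> edges remain, the first
  Betti number, and any \<open>n\<close> of them can go.\<close>

lemma removable_edges:
  assumes "finite U" "U \<noteq> {}" "finite F"
    and "\<And>e. e \<in> F \<Longrightarrow> tail G e \<in> U \<and> head G e \<in> U"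
    and "\<And>u v. u \<in> U \<Longrightarrow> v \<in> U \<Longrightarrow> (u, v) \<in> (link G F)\<^sup>*"
    and n: "n = 0 \<or> int n \<le> int (card F) - int (card U) + 1"
  obtains R where "R \<subseteq> F" "card R = n" "\<And>u v. u \<in> U \<Longrightarrow> v \<in> U \<Longrightarrow> (u, v) \<in> (link G (F - R))\<^sup>*"
proof -
  from spanning_edges[OF assms(1-5)] obtain T where
    T: "T \<subseteq> F" "card T < card U" "\<And>u v. u \<in> U \<Longrightarrow> v \<in> U \<Longrightarrow> (u, v) \<in> (link G T)\<^sup>*" by metis
  have "card (F - T) = card F - card T" "card T \<le> card F"
    using T(1) assms(3) by (auto intro: card_Diff_subset card_mono dest: finite_subset)
  then have "n \<le> card (F - T)" using n T(2) by auto
  then obtain R where R: "R \<subseteq> F - T" "card R = n"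
    by (metis obtain_subset_with_card_n)
  have "link G T \<subseteq> link G (F - R)" using R(1) T(1) by (intro link_mono) auto
  then show ?thesis using that[of R] R T(3) rtrancl_mono[of "link G T" "link G (F - R)"] by blast
qed

text \<open>
  The potential differences between vertices of \<open>U\<close> are computed along edges outside \<open>S\<close>, so they lie
  in the rational span of \<open>M\<close> and the positions of \<open>C\<close>. Going along an edge of \<open>R\<close> instead puts the
  generic position on that edge into the same span.
\<close>

lemma generic_demand:
  fixes H :: "('v, 'e) pre_digraph"
  assumes H: "fin_digraph H" and F: "F \<subseteq> arcs H" and R: "R \<subseteq> F" "R = S \<inter> F" and S: "S \<subseteq> arcs H"
    and conn: "\<And>u v. u \<in> U \<Longrightarrow> v \<in> U \<Longrightarrow> (u, v) \<in> (link H (F - R))\<^sup>*"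
    and ends: "\<And>e. e \<in> F \<Longrightarrow> tail H e \<in> U \<and> head H e \<in> U"
    and M: "\<And>e. e \<in> F \<Longrightarrow> l e \<in> M \<and> edge_support e D \<subseteq> M \<and> edge_support e E \<subseteq> M"
    and generic: "\<And>Y. finite Y \<Longrightarrow> x ` R \<subseteq> rat.span (M \<union> Y) \<Longrightarrow> card R \<le> card Y"
    and C: "effective C"
    and prin: "principal H l (D - (E + (\<Sum>e\<in>S. frag_of (Inner e (x e))) + C))"
  shows "int (card R) \<le> (\<Sum>e\<in>F. on_edge_count e C)"
proof -
  interpret fin_digraph H by fact
  have fin: "finite F" "finite S" using F S finite_subset[OF _ finite_arcs] by auto
  let ?A = "D - (E + (\<Sum>e\<in>S. frag_of (Inner e (x e))) + C)"
  \<comment> \<open>\<open>Y\<close> collects the only positions that are not under control, those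
    of the chips of \<open>C\<close> on \<open>F\<close>.\<close>
  define Y where "Y = (\<Union>e\<in>F. edge_support e C)"
  let ?V = "rat.span (M \<union> Y)"
  obtain k \<phi> where pot: "potential H l k \<phi> ?A" using prin by (auto simp: principal_def)
  have sp: "M \<union> Y \<subseteq> ?V" by (rule rat.span_superset)
  have mom: "moment l e X \<in> ?V" if "l e \<in> ?V" "edge_support e X \<subseteq> ?V" for e X
    unfolding ev_edge_fun
    by (intro rat.span_sum rat_span_of_int_mult rat.span_diff) (use that in auto)
  have A: "moment l e ?A = moment l e D - moment l e E - moment l e C -
      (if e \<in> S then l e - x e else 0)" for e
  proof -
    have "(\<Sum>e'\<in>S. edge_fun e (\<lambda>t. l e - t) (Inner e' (x e'))) = (if e \<in> S then l e - x e else 0)"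
      using fin by (simp cong: if_cong)
    then show ?thesis by (simp add: ev_diff ev_add ev_sum)
  qed
  have edge: "\<phi> (head H e) - \<phi> (tail H e) =
      of_int (k e) * l e - (moment l e D - moment l e E - moment l e C) + (if e \<in> S then l e - x e else 0)"
    if "e \<in> F" for e
    using pot that F by (auto simp: potential_def A)
  have inV: "of_int (k e) * l e - (moment l e D - moment l e E - moment l e C) \<in> ?V" "l e \<in> ?V"
    if "e \<in> F" for e
  proof -
    have le: "l e \<in> ?V" using M[OF that] sp by auto
    moreover have "edge_support e D \<subseteq> ?V" "edge_support e E \<subseteq> ?V" "edge_support e C \<subseteq> ?V"
      using M[OF that] sp that by (auto simp: Y_def)
    ultimately show "of_int (k e) * l e - (moment l e D - moment l e E - moment l e C) \<in> ?V" "l e \<in> ?V"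
      by (auto intro!: rat.span_diff rat_span_of_int_mult mom)
  qed
  have diff: "\<phi> v - \<phi> u \<in> ?V" if "(u, v) \<in> (link H (F - R))\<^sup>*" for u v
    using that
  proof (induction rule: rtrancl_induct)
    case base
    then show ?case by (simp add: rat.span_zero)
  next
    case (step v w)
    then obtain e where e: "e \<in> F" "e \<notin> S" "(v, w) \<in> link H {e}" using R(2) by (auto simp: link_def)
    have "\<phi> (head H e) - \<phi> (tail H e) \<in> ?V" using edge[OF e(1)] e(2) inV[OF e(1)] by simp
    then have "\<phi> w - \<phi> v \<in> ?V" using e(3) rat.span_neg[of "\<phi> (head H e) - \<phi> (tail H e)"]
      by (auto simp: link_def)
    from rat.span_add[OF this step.IH] show ?case by simp
  qed
  have "x ` R \<subseteq> ?V"
  proof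
    fix y assume "y \<in> x ` R"
    then obtain e where e: "e \<in> R" "y = x e" by auto
    then have eF: "e \<in> F" "e \<in> S" using R by auto
    have "\<phi> (head H e) - \<phi> (tail H e) \<in> ?V" using ends[OF eF(1)] by (intro diff conn) auto
    then have "of_int (k e) * l e - (moment l e D - moment l e E - moment l e C) + l e -
        (\<phi> (head H e) - \<phi> (tail H e)) \<in> ?V"
      by (intro rat.span_diff[of _ _ "\<phi> (head H e) - \<phi> (tail H e)"] rat.span_add inV eF)
    then show "y \<in> ?V" using edge[OF eF(1)] eF(2) e(2) by simp
  qed
  then have "card R \<le> card Y"
    using generic[of Y] fin by (simp add: Y_def)
  also have "\<dots> \<le> (\<Sum>e\<in>F. card (edge_support e C))"
    unfolding Y_def by (rule card_UN_le[OF fin(1)])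
  finally have "int (card R) \<le> (\<Sum>e\<in>F. int (card (edge_support e C)))"
    by (simp add: of_nat_sum[symmetric] del: of_nat_sum)
  \<comment> \<open>Linear algebra bounds the number of distinct positions; effectivity of
    \<open>C\<close> puts at least one chip at each.\<close>
  also have "\<dots> \<le> (\<Sum>e\<in>F. on_edge_count e C)"
  proof (rule sum_mono)
    fix e
    have "(\<Sum>t\<in>edge_support e C. 1) \<le> (\<Sum>t\<in>edge_support e C. lookup C (Inner e t))"
    proof (rule sum_mono)
      fix t assume "t \<in> edge_support e C"
      then show "1 \<le> lookup C (Inner e t)"
        using C by (simp add: edge_support_def in_keys_iff effective_def order_less_le
            int_one_le_iff_zero_less)
    qed
    then show "int (card (edge_support e C)) \<le> on_edge_count e C" by (simp add: ev_edge_fun)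
  qed
  finally show ?thesis .
qed

section \<open>Limits of divisors\<close>

lemma constant_subseq:
  fixes f :: "nat \<Rightarrow> 'a"
  assumes "finite S" "\<And>n. f n \<in> S"
  obtains \<sigma> :: "nat \<Rightarrow> nat" and c where "strict_mono \<sigma>" "\<And>n. f (\<sigma> n) = c" "c \<in> S"
proof -
  have "finite (f ` UNIV)" by (rule finite_subset[OF _ assms(1)]) (use assms(2) in auto)
  from pigeonhole_infinite[OF infinite_UNIV_nat this] obtain n where "infinite {m. f m = f n}" by auto
  from infinite_enumerate[OF this] obtain \<sigma> :: "nat \<Rightarrow> nat" where "strict_mono \<sigma>" "\<And>n'. f (\<sigma> n') = f n"
    by auto
  then show ?thesis using assms(2)[of n] that by blast
qed

text \<open>A chip keeps its vertex or its edge throughout, and its limit keeps the edge even on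
  reaching an end. Coefficients at vertices and counts on edges are thus constant along the
  sequence; identifying ends with vertices is left to \<open>normalise\<close>.\<close>

definition point_conv :: "(nat \<Rightarrow> ('v, 'e) point) \<Rightarrow> ('v, 'e) point \<Rightarrow> bool" where
  "point_conv p q \<longleftrightarrow> (case q of Vert v \<Rightarrow> \<forall>n. p n = Vert v
    | Inner e t \<Rightarrow> \<exists>\<tau>. (\<forall>n. p n = Inner e (\<tau> n)) \<and> \<tau> \<longlonglongrightarrow> t)"

text \<open>Convergence chip by chip for a fixed labelling, which makes all divisors involved
  effective and of the same degree.\<close>

definition div_conv :: "(nat \<Rightarrow> ('v, 'e) point divisor) \<Rightarrow> ('v, 'e) point divisor \<Rightarrow> bool" where
  "div_conv D Dl \<longleftrightarrow> (\<exists>(d::nat) x y. (\<forall>n. D n = (\<Sum>i<d. frag_of (x i n))) \<and>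
     Dl = (\<Sum>i<d. frag_of (y i)) \<and> (\<forall>i<d. point_conv (x i) (y i)))"

lemma point_conv_subseq:
  assumes "point_conv p q" "strict_mono \<sigma>"
  shows "point_conv (\<lambda>n. p (\<sigma> n)) q"
proof (cases q)
  case (Inner e t)
  with assms(1) obtain \<tau> where "\<forall>n. p n = Inner e (\<tau> n)" "\<tau> \<longlonglongrightarrow> t"
    by (auto simp: point_conv_def)
  then have "(\<forall>n. p (\<sigma> n) = Inner e ((\<tau> \<circ> \<sigma>) n)) \<and> (\<tau> \<circ> \<sigma>) \<longlonglongrightarrow> t"
    using LIMSEQ_subseq_LIMSEQ[OF _ assms(2)] by auto
  then show ?thesis unfolding Inner point_conv_def by (simp only: point.case) blast
qed (use assms in \<open>simp add: point_conv_def\<close>)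

lemma div_conv_subseq:
  assumes "div_conv D Dl" "strict_mono \<sigma>"
  shows "div_conv (\<lambda>n. D (\<sigma> n)) Dl"
proof -
  obtain d :: nat and x y where *: "\<forall>n. D n = (\<Sum>i<d. frag_of (x i n))"
    "Dl = (\<Sum>i<d. frag_of (y i))" "\<forall>i<d. point_conv (x i) (y i)"
    using assms(1) unfolding div_conv_def by auto
  then show ?thesis unfolding div_conv_def
    by (intro exI[of _ d] exI[of _ "\<lambda>i n. x i (\<sigma> n)"] exI[of _ y]) (auto intro: point_conv_subseq assms)
qed

lemma div_conv_0: "div_conv (\<lambda>_. 0) 0"
  unfolding div_conv_def by (intro exI[of _ 0]) simp

lemma div_conv_frag_of: "point_conv p q \<Longrightarrow> div_conv (\<lambda>n. frag_of (p n)) (frag_of q)"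
  unfolding div_conv_def by (intro exI[of _ 1] exI[of _ "\<lambda>_. p"] exI[of _ "\<lambda>_. q"]) simp

lemma div_conv_add:
  assumes "div_conv D Dl" "div_conv E El"
  shows "div_conv (\<lambda>n. D n + E n) (Dl + El)"
proof -
  obtain d :: nat and x y where D: "\<forall>n. D n = (\<Sum>i<d. frag_of (x i n))"
    "Dl = (\<Sum>i<d. frag_of (y i))" "\<forall>i<d. point_conv (x i) (y i)"
    using assms(1) unfolding div_conv_def by auto
  obtain d' :: nat and x' y' where E: "\<forall>n. E n = (\<Sum>i<d'. frag_of (x' i n))"
    "El = (\<Sum>i<d'. frag_of (y' i))" "\<forall>i<d'. point_conv (x' i) (y' i)"
    using assms(2) unfolding div_conv_def by auto
  have split: "(\<Sum>i<d + d'. g (if i < d then a i else b (i - d))) = (\<Sum>i<d. g (a i)) + (\<Sum>i<d'. g (b i))"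
    for g :: "'z \<Rightarrow> 'y::comm_monoid_add" and a b :: "nat \<Rightarrow> 'z"
  proof -
    have "(\<Sum>i<d + d'. g (if i < d then a i else b (i - d))) =
        (\<Sum>i<d. g (if i < d then a i else b (i - d))) + (\<Sum>i\<in>{d..<d+d'}. g (if i < d then a i else b (i - d)))"
      by (subst sum.union_disjoint[symmetric]) (auto intro!: sum.cong)
    also have "(\<Sum>i\<in>{d..<d+d'}. g (if i < d then a i else b (i - d))) = (\<Sum>i<d'. g (b i))"
      by (rule sum.reindex_bij_witness[of _ "\<lambda>i. i + d" "\<lambda>i. i - d"]) auto
    finally show ?thesis by simp
  qed
  show ?thesis
    unfolding div_conv_def
  proof (intro exI conjI allI impI)
    show "D n + E n = (\<Sum>i<d + d'. frag_of ((if i < d then x i else x' (i - d)) n))" for n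
      using split[of "\<lambda>p. frag_of (p n)" x x'] D(1) E(1) by simp
    show "Dl + El = (\<Sum>i<d + d'. frag_of (if i < d then y i else y' (i - d)))"
      using split[of frag_of y y'] D(2) E(2) by simp
    fix i assume "i < d + d'"
    then show "point_conv (if i < d then x i else x' (i - d)) (if i < d then y i else y' (i - d))"
      using D(3) E(3) by auto
  qed
qed

lemma div_conv_sum:
  assumes "finite J" "\<And>j. j \<in> J \<Longrightarrow> div_conv (D j) (Dl j)"
  shows "div_conv (\<lambda>n. \<Sum>j\<in>J. D j n) (\<Sum>j\<in>J. Dl j)"
  using assms by (induction J rule: finite_induct) (auto simp: div_conv_0 div_conv_add)

lemma div_conv_effective: "div_conv D Dl \<Longrightarrow> effective Dl \<and> effective (D n) \<and> deg (D n) = deg Dl"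
  unfolding div_conv_def by (auto intro!: effective_sum simp: deg_sum)

lemma div_conv_count:
  fixes Dl :: "('v, 'e) point divisor"
  assumes "div_conv D Dl"
  shows "on_edge_count e (D n) = on_edge_count e Dl"
proof -
  have point: "edge_fun e (\<lambda>_. 1::int) (p n) = edge_fun e (\<lambda>_. 1) q" if "point_conv p q" for p and q :: "('v, 'e) point"
    using that by (cases q) (auto simp: point_conv_def)
  obtain d :: nat and x y where *: "\<forall>n. D n = (\<Sum>i<d. frag_of (x i n))"
    "Dl = (\<Sum>i<d. frag_of (y i))" "\<forall>i<d. point_conv (x i) (y i)"
    using assms(1) unfolding div_conv_def by auto
  have "edge_fun e (\<lambda>_. 1::int) (x i n) = edge_fun e (\<lambda>_. 1) (y i)" if "i < d" for i
    by (rule point) (use *(3) that in blast)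
  then show ?thesis by (simp add: *(1,2) ev_sum)
qed

lemma div_conv_lookup_Vert:
  fixes Dl :: "('v, 'e) point divisor"
  assumes "div_conv D Dl"
  shows "lookup (D n) (Vert v) = lookup Dl (Vert v)"
proof -
  have point: "(p n = Vert v) = (q = Vert v)" if "point_conv p q" for p and q :: "('v, 'e) point"
    using that by (cases q) (auto simp: point_conv_def)
  obtain d :: nat and x y where *: "\<forall>n. D n = (\<Sum>i<d. frag_of (x i n))"
    "Dl = (\<Sum>i<d. frag_of (y i))" "\<forall>i<d. point_conv (x i) (y i)"
    using assms(1) unfolding div_conv_def by auto
  have "(x i n = Vert v) = (y i = Vert v)" if "i < d" for i
    by (rule point) (use *(3) that in blast)
  then have "(if Vert v = x i n then 1 else 0) = (if Vert v = y i then 1 else 0 :: int)" if "i < d" for i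
    using that by metis
  then show ?thesis by (simp add: *(1,2) lookup_sum)
qed

lemma div_conv_moment:
  fixes Dl :: "('v, 'e) point divisor"
  assumes "div_conv D Dl" "(\<lambda>n. l n e) \<longlonglongrightarrow> m e"
  shows "(\<lambda>n. moment (l n) e (D n)) \<longlonglongrightarrow> moment m e Dl"
proof -
  have point: "(\<lambda>n. edge_fun e (\<lambda>t. l n e - t) (p n)) \<longlonglongrightarrow> edge_fun e (\<lambda>t. m e - t) q" if "point_conv p q" for p and q :: "('v, 'e) point"
    using that assms(2) by (cases q) (auto simp: point_conv_def intro!: tendsto_intros)
  obtain d :: nat and x y where *: "\<forall>n. D n = (\<Sum>i<d. frag_of (x i n))"
    "Dl = (\<Sum>i<d. frag_of (y i))" "\<forall>i<d. point_conv (x i) (y i)"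
    using assms(1) unfolding div_conv_def by auto
  have "(\<lambda>n. edge_fun e (\<lambda>t. l n e - t) (x i n)) \<longlonglongrightarrow> edge_fun e (\<lambda>t. m e - t) (y i)" if "i < d" for i
    by (rule point) (use *(3) that in blast)
  then show ?thesis by (auto simp: *(1,2) ev_sum intro!: tendsto_sum)
qed

lemma div_conv_keys:
  assumes conv: "div_conv D Dl" and keys: "\<And>n. keys (D n) \<subseteq> closed_points G (l n)"
    and l: "\<And>e. e \<in> arcs G \<Longrightarrow> (\<lambda>n. l n e) \<longlonglongrightarrow> m e"
  shows "keys Dl \<subseteq> closed_points G m"
proof -
  obtain d :: nat and x y where *: "\<forall>n. D n = (\<Sum>i<d. frag_of (x i n))"
    "Dl = (\<Sum>i<d. frag_of (y i))" "\<forall>i<d. point_conv (x i) (y i)"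
    using conv unfolding div_conv_def by auto
  have "y i \<in> closed_points G m" if i: "i < d" for i
  proof -
    have x: "x i n \<in> closed_points G (l n)" for n
      using keys[of n] i *(1) by (auto simp: keys_indexed)
    show ?thesis
    proof (cases "y i")
      case (Vert v)
      then show ?thesis using x[of 0] *(3) i by (auto simp: point_conv_def closed_points_def)
    next
      case (Inner e t)
      then obtain \<tau> where \<tau>: "\<And>n. x i n = Inner e (\<tau> n)" "\<tau> \<longlonglongrightarrow> t"
        using *(3)[rule_format, OF i] by (auto simp: point_conv_def)
      have e: "e \<in> arcs G" and b: "\<And>n. 0 \<le> \<tau> n" "\<And>n. \<tau> n \<le> l n e"
        using x by (auto simp: \<tau>(1) closed_points_def)
      have "0 \<le> t" by (rule LIMSEQ_le_const[OF \<tau>(2)]) (use b in auto)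
      moreover have "t \<le> m e" by (rule LIMSEQ_le[OF \<tau>(2) l[OF e]]) (use b in auto)
      ultimately show ?thesis using Inner e by (auto simp: closed_points_def)
    qed
  qed
  then show ?thesis unfolding *(2) keys_indexed by auto
qed

text \<open>Among finitely many vertices and edges one occurs for infinitely many \<open>n\<close>;
  on an edge the coordinates lie in \<open>{0..C e}\<close>. The bound is uniform because the curves
  vary with \<open>n\<close>.\<close>

lemma point_conv_compact:
  assumes G: "fin_digraph G" and l: "\<And>n e. e \<in> arcs G \<Longrightarrow> l n e \<le> C e"
    and p: "\<And>n. p n \<in> closed_points G (l n)"
  obtains \<sigma> :: "nat \<Rightarrow> nat" and q where "strict_mono \<sigma>" "point_conv (\<lambda>n. p (\<sigma> n)) q"
proof -
  interpret fin_digraph G by fact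
  define f where "f n = (case p n of Vert v \<Rightarrow> Inl v | Inner e t \<Rightarrow> Inr e)" for n
  have "f n \<in> Inl ` verts G \<union> Inr ` arcs G" for n
    using p[of n] by (auto simp: f_def closed_points_def)
  then obtain \<sigma> :: "nat \<Rightarrow> nat" and c where \<sigma>: "strict_mono \<sigma>" "\<And>n. f (\<sigma> n) = c" "c \<in> Inl ` verts G \<union> Inr ` arcs G"
    using constant_subseq[of "Inl ` verts G \<union> Inr ` arcs G" f] by (metis finite_UnI finite_imageI finite_verts finite_arcs)
  show ?thesis
  proof (cases c)
    case (Inl v)
    then have "p (\<sigma> n) = Vert v" for n
      using \<sigma>(2)[of n] by (auto simp: f_def split: point.splits)
    then have "point_conv (\<lambda>n. p (\<sigma> n)) (Vert v)" by (simp add: point_conv_def)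
    with \<sigma>(1) show ?thesis by (rule that)
  next
    case (Inr e)
    then have e: "e \<in> arcs G" using \<sigma>(3) by auto
    have "\<exists>t. p (\<sigma> n) = Inner e t" for n
      using \<sigma>(2)[of n] Inr by (auto simp: f_def split: point.splits)
    then obtain \<tau> where \<tau>: "\<And>n. p (\<sigma> n) = Inner e (\<tau> n)" by metis
    have "\<forall>n. \<tau> n \<in> {0..C e}"
    proof
      fix n
      show "\<tau> n \<in> {0..C e}" using p[of "\<sigma> n"] l[OF e, of "\<sigma> n"] by (auto simp: \<tau> closed_points_def)
    qed
    moreover have "seq_compact {0..C e}" by (intro compact_imp_seq_compact compact_Icc)
    ultimately obtain t and \<rho> :: "nat \<Rightarrow> nat" where \<rho>: "strict_mono \<rho>" "(\<tau> \<circ> \<rho>) \<longlonglongrightarrow> t"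
      by (metis seq_compactE)
    have "point_conv (\<lambda>n. p ((\<sigma> \<circ> \<rho>) n)) (Inner e t)"
      using \<rho>(2) \<tau> by (auto simp: point_conv_def o_def)
    moreover have "strict_mono (\<sigma> \<circ> \<rho>)" using \<sigma>(1) \<rho>(1) by (rule strict_mono_o)
    ultimately show ?thesis using that by blast
  qed
qed

text \<open>One subsequence is extracted per chip, and the convergence of the earlier chips
  persists.\<close>

lemma div_conv_compact:
  assumes G: "fin_digraph G" and l: "\<And>n e. e \<in> arcs G \<Longrightarrow> l n e \<le> C e"
    and keys: "\<And>n. keys (D n) \<subseteq> closed_points G (l n)"
    and eff: "\<And>n. effective (D n)" and deg: "\<And>n. deg (D n) = int d"
  obtains \<sigma> :: "nat \<Rightarrow> nat" and Dl where "strict_mono \<sigma>" "div_conv (\<lambda>n. D (\<sigma> n)) Dl"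
proof -
  have "\<exists>x. D n = (\<Sum>i<d. frag_of (x i)) \<and> (\<forall>i<d. x i \<in> closed_points G (l n))" for n
    using effective_indexed[OF eff deg] keys by (metis subsetD)
  then obtain x where x: "\<And>n. D n = (\<Sum>i<d. frag_of (x n i))"
    "\<And>n i. i < d \<Longrightarrow> x n i \<in> closed_points G (l n)" by metis
  have "\<exists>(\<sigma> :: nat \<Rightarrow> nat) y. strict_mono \<sigma> \<and> (\<forall>i<k. point_conv (\<lambda>n. x (\<sigma> n) i) (y i))" if "k \<le> d" for k
    using that
  proof (induction k)
    case 0
    show ?case by (intro exI[of _ id]) (auto simp: strict_mono_def)
  next
    case (Suc k)
    then obtain \<sigma> :: "nat \<Rightarrow> nat" and y where \<sigma>: "strict_mono \<sigma>" "\<forall>i<k. point_conv (\<lambda>n. x (\<sigma> n) i) (y i)" by auto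
    obtain \<rho> :: "nat \<Rightarrow> nat" and q where \<rho>: "strict_mono \<rho>" "point_conv (\<lambda>n. x (\<sigma> (\<rho> n)) k) q"
      by (rule point_conv_compact[OF G, of "\<lambda>n. l (\<sigma> n)" C "\<lambda>n. x (\<sigma> n) k"])
        (use l x(2) Suc.prems in auto)
    have "strict_mono (\<sigma> \<circ> \<rho>)" using \<sigma>(1) \<rho>(1) by (rule strict_mono_o)
    moreover have "point_conv (\<lambda>n. x ((\<sigma> \<circ> \<rho>) n) i) ((y(k := q)) i)" if "i < Suc k" for i
      using that \<rho>(2) point_conv_subseq[OF _ \<rho>(1)] \<sigma>(2) by (auto simp: less_Suc_eq)
    ultimately show ?case by blast
  qed
  from this[of d] obtain \<sigma> :: "nat \<Rightarrow> nat" and y where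
    "strict_mono \<sigma>" "\<forall>i<d. point_conv (\<lambda>n. x (\<sigma> n) i) (y i)" by auto
  then have "div_conv (\<lambda>n. D (\<sigma> n)) (\<Sum>i<d. frag_of (y i))"
    unfolding div_conv_def by (intro exI[of _ d] exI[of _ "\<lambda>i n. x (\<sigma> n) i"] exI[of _ y]) (auto simp: x(1))
  with \<open>strict_mono \<sigma>\<close> show ?thesis by (rule that)
qed

text \<open>
  Slopes are bounded integers, hence constant along a subsequence. The potential differences along
  edges then converge, and connectedness makes the suitably normalised potentials converge.
\<close>

lemma principal_limit:
  assumes G: "fin_digraph G" and conn: "\<And>u v. u \<in> verts G \<Longrightarrow> v \<in> verts G \<Longrightarrow> (u, v) \<in> (link G (arcs G))\<^sup>*"
    and l: "\<And>n e. e \<in> arcs G \<Longrightarrow> 0 < l n e" "\<And>e. e \<in> arcs G \<Longrightarrow> (\<lambda>n. l n e) \<longlonglongrightarrow> m e"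
    and D: "div_conv D Dl" "div_conv D' Dl'"
    and keys: "\<And>n. keys (D n) \<subseteq> closed_points G (l n)"
      "\<And>n. keys (D' n) \<subseteq> closed_points G (l n)"
    and prin: "\<And>n. principal G (l n) (D n - D' n)"
  shows "principal G m (Dl - Dl')"
proof -
  interpret fin_digraph G by fact
  obtain k \<phi> where pot: "\<And>n. potential G (l n) (k n) (\<phi> n) (D n - D' n)"
    using prin unfolding principal_def by metis
  define N where "N = 2 * (deg Dl + deg Dl')"
  note eff = div_conv_effective[OF D(1)] div_conv_effective[OF D(2)]
  have k: "\<bar>k n e\<bar> \<le> N" if "e \<in> arcs G" for n e
  proof -
    have "keys (D n + D' n) \<subseteq> closed_points G (l n)"
      using keys[of n] keys_add[of "D n" "D' n"] by blast
    then have "\<bar>k n e\<bar> \<le> 2 * (deg (D n) + deg (D' n))"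
      by (intro slope_bound[OF G, of "l n" _ _ "k n" "\<phi> n"]) (use l pot that eff in auto)
    then show ?thesis using eff by (simp add: N_def)
  qed
  \<comment> \<open>Slopes off \<open>arcs G\<close> are arbitrary; restriction leaves only finitely
    many functions.\<close>
  define f where "f n = restrict (k n) (arcs G)" for n
  have "f n \<in> arcs G \<rightarrow>\<^sub>E {-N..N}" for n
  proof (rule PiE_I)
    fix e assume "e \<in> arcs G"
    then show "f n e \<in> {-N..N}" using k[of e n] by (simp add: f_def abs_le_iff)
  qed (simp add: f_def)
  moreover have "finite (arcs G \<rightarrow>\<^sub>E {-N..N})" by (intro finite_PiE) auto
  ultimately obtain \<sigma> :: "nat \<Rightarrow> nat" and \<kappa> where \<sigma>: "strict_mono \<sigma>" "\<And>n. f (\<sigma> n) = \<kappa>"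
    using constant_subseq by metis
  have k\<sigma>: "k (\<sigma> n) e = \<kappa> e" if "e \<in> arcs G" for n e
    using \<sigma>(2)[of n] that by (auto simp: f_def)
  have l\<sigma>: "(\<lambda>n. l (\<sigma> n) e) \<longlonglongrightarrow> m e" if "e \<in> arcs G" for e
    using LIMSEQ_subseq_LIMSEQ[OF l(2)[OF that] \<sigma>(1)] by (simp add: o_def)
  note D\<sigma> = div_conv_subseq[OF D(1) \<sigma>(1)] div_conv_subseq[OF D(2) \<sigma>(1)]
  have diff: "(\<lambda>n. \<phi> (\<sigma> n) (head G e) - \<phi> (\<sigma> n) (tail G e)) \<longlonglongrightarrow> of_int (\<kappa> e) * m e - moment m e (Dl - Dl')"
    if e: "e \<in> arcs G" for e
  proof -
    have "\<phi> (\<sigma> n) (head G e) - \<phi> (\<sigma> n) (tail G e) = of_int (\<kappa> e) * l (\<sigma> n) e -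
        (moment (l (\<sigma> n)) e (D (\<sigma> n)) - moment (l (\<sigma> n)) e (D' (\<sigma> n)))" for n
      using pot[of "\<sigma> n"] e by (simp add: potential_def k\<sigma> ev_diff)
    moreover have "(\<lambda>n. of_int (\<kappa> e) * l (\<sigma> n) e -
        (moment (l (\<sigma> n)) e (D (\<sigma> n)) - moment (l (\<sigma> n)) e (D' (\<sigma> n)))) \<longlonglongrightarrow>
        of_int (\<kappa> e) * m e - (moment m e Dl - moment m e Dl')"
      by (intro tendsto_intros l\<sigma> e div_conv_moment[of _ _ "\<lambda>n. l (\<sigma> n)"] D\<sigma>)
    ultimately show ?thesis by (simp add: ev_diff)
  qed
  obtain \<Phi> where \<Phi>: "\<And>e. e \<in> arcs G \<Longrightarrow> \<Phi> (head G e) - \<Phi> (tail G e) = of_int (\<kappa> e) * m e - moment m e (Dl - Dl')"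
  proof (cases "verts G = {}")
    case True
    then have "arcs G = {}" using wellformed by blast
    then show ?thesis using that by simp
  next
    case False
    then obtain r where r: "r \<in> verts G" by auto
    have "\<exists>a. (\<lambda>n. \<phi> (\<sigma> n) v - \<phi> (\<sigma> n) r) \<longlonglongrightarrow> a" if "v \<in> verts G" for v
      using conn[OF r that]
    proof (induction rule: rtrancl_induct)
      case base
      then show ?case by auto
    next
      case (step u v)
      then obtain a e where a: "(\<lambda>n. \<phi> (\<sigma> n) u - \<phi> (\<sigma> n) r) \<longlonglongrightarrow> a" and e: "e \<in> arcs G" "(u, v) \<in> link G {e}"
        by (auto simp: link_def)
      obtain c where "(\<lambda>n. \<phi> (\<sigma> n) v - \<phi> (\<sigma> n) u) \<longlonglongrightarrow> c"
        using diff[OF e(1)] tendsto_minus[OF diff[OF e(1)]] e(2) by (auto simp: link_def)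
      from tendsto_add[OF a this] show ?case by auto
    qed
    then obtain \<Phi> where \<Phi>: "\<And>v. v \<in> verts G \<Longrightarrow> (\<lambda>n. \<phi> (\<sigma> n) v - \<phi> (\<sigma> n) r) \<longlonglongrightarrow> \<Phi> v" by metis
    have "\<Phi> (head G e) - \<Phi> (tail G e) = of_int (\<kappa> e) * m e - moment m e (Dl - Dl')" if e: "e \<in> arcs G" for e
    proof (rule LIMSEQ_unique[OF _ diff[OF e]])
      have "(\<lambda>n. (\<phi> (\<sigma> n) (head G e) - \<phi> (\<sigma> n) r) - (\<phi> (\<sigma> n) (tail G e) - \<phi> (\<sigma> n) r)) \<longlonglongrightarrow> \<Phi> (head G e) - \<Phi> (tail G e)"
        by (intro tendsto_diff \<Phi>) (use e in auto)
      then show "(\<lambda>n. \<phi> (\<sigma> n) (head G e) - \<phi> (\<sigma> n) (tail G e)) \<longlonglongrightarrow> \<Phi> (head G e) - \<Phi> (tail G e)" by simp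
    qed
    then show ?thesis using that by blast
  qed
  have "potential G m \<kappa> \<Phi> (Dl - Dl')"
    unfolding potential_def
  proof (intro conjI ballI)
    fix v assume v: "v \<in> verts G"
    \<comment> \<open>Every term of the vertex equation is an integer that no longer depends on
      \<open>n\<close>, so the equation at index 0 is already the limit equation.\<close>
    have "lookup (D (\<sigma> 0) - D' (\<sigma> 0)) (Vert v) = (\<Sum>e\<in>arcs G.
      (if head G e = v then k (\<sigma> 0) e - on_edge_count e (D (\<sigma> 0) - D' (\<sigma> 0)) else 0) - (if tail G e = v then k (\<sigma> 0) e else 0))"
      using pot[of "\<sigma> 0"] v by (simp only: potential_def)
    then show "lookup (Dl - Dl') (Vert v) = (\<Sum>e\<in>arcs G.
      (if head G e = v then \<kappa> e - on_edge_count e (Dl - Dl') else 0) - (if tail G e = v then \<kappa> e else 0))"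
      by (simp add: lookup_minus div_conv_lookup_Vert[OF D(1)] div_conv_lookup_Vert[OF D(2)] ev_diff
        div_conv_count[OF D(1)] div_conv_count[OF D(2)] k\<sigma> cong: if_cong)
  qed (rule \<Phi>)
  then show ?thesis by (auto simp: principal_def)
qed

section \<open>Rank and Brill-Noether rank\<close>

lemma contained_in_trans:
  assumes "effective (D - (E + F))" "effective F"
  shows "effective (D - E)"
  using effective_add[OF assms] by (simp add: algebra_simps)

lemma divisor_on_add: "divisor_on P A \<Longrightarrow> divisor_on P B \<Longrightarrow> divisor_on P (A + B)"
  unfolding divisor_on_def using keys_add[of A B] by blast

lemma keys_diff_subset: "keys (A - B) \<subseteq> keys A \<union> keys B"
  by (auto simp: in_keys_iff lookup_minus)

lemma divisor_on_diff: "divisor_on P A \<Longrightarrow> divisor_on P B \<Longrightarrow> divisor_on P (A - B)"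
  unfolding divisor_on_def using keys_diff_subset[of A B] by blast

lemma divisor_on_sum: "(\<And>i. i \<in> I \<Longrightarrow> divisor_on P (A i)) \<Longrightarrow> divisor_on P (\<Sum>i\<in>I. A i)"
  by (induction I rule: infinite_finite_induct) (auto simp: divisor_on_add, auto simp: divisor_on_def)

lemma divisor_on_frag_of [simp]: "divisor_on P (frag_of p) \<longleftrightarrow> p \<in> P"
  by (simp add: divisor_on_def)

lemma divisor_on_push: "divisor_on P A \<Longrightarrow> (\<And>p. p \<in> P \<Longrightarrow> \<theta> p \<in> Q) \<Longrightarrow> divisor_on Q (push \<theta> A)"
  unfolding divisor_on_def using keys_push[of \<theta> A] by blast

lemma divisor_on_mono: "divisor_on P A \<Longrightarrow> P \<subseteq> Q \<Longrightarrow> divisor_on Q A"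
  by (auto simp: divisor_on_def)

lemma effective_exists:
  assumes "p \<in> P"
  obtains E where "divisor_on P E" "effective E" "deg E = int n"
proof -
  let ?E = "\<Sum>i<n. frag_of p"
  have "divisor_on P ?E" by (rule divisor_on_sum) (simp add: assms)
  moreover have "effective ?E" by (rule effective_sum) simp
  moreover have "deg ?E = int n" by (simp add: deg_sum)
  ultimately show ?thesis by (rule that)
qed

lemma deg_mono: "effective (D - E) \<Longrightarrow> deg E \<le> deg D"
  using effective_deg_nonneg[of "D - E"] by (simp add: deg_diff)

locale pure_curve =
  fixes G :: "('v, 'e) pre_digraph" and l :: "'e \<Rightarrow> real"
  assumes G: "fin_digraph G" and nonempty: "verts G \<noteq> {}" and l: "\<And>e. e \<in> arcs G \<Longrightarrow> 0 < l e"
begin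

lemma point_exists: obtains p where "p \<in> points G l"
  using nonempty by (auto simp: points_def)

lemma divisor_on_closed: "divisor_on (points G l) D \<Longrightarrow> divisor_on (closed_points G l) D"
  using points_subset_closed_points by (rule divisor_on_mono[rotated])

lemma lin_equiv_iff:
  assumes "divisor_on (points G l) D" "divisor_on (points G l) D'"
  shows "lin_equiv G l D D' \<longleftrightarrow> principal G l (D - D')"
proof -
  have "keys (D - D') \<subseteq> points G l"
    using divisor_on_diff[OF assms] by (simp add: divisor_on_def)
  then show ?thesis
    using lin_equiv_imp_principal[OF G, of l D D'] principal_imp_lin_equiv[OF G, of l D D'] l by blast
qed

lemma deg_eqI:
  assumes "divisor_on (closed_points G l) D" "divisor_on (closed_points G l) D'" "principal G l (D - D')"
  shows "deg D = deg D'"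
  using deg_principal[OF G _ assms(3)] divisor_on_diff[OF assms(1,2)] by (simp add: divisor_on_def deg_diff)

lemma equiv_containing_iff:
  assumes "divisor_on (points G l) D"
  shows "equiv_to_effective_containing G l D E \<longleftrightarrow>
    (\<exists>D'. divisor_on (points G l) D' \<and> effective D' \<and> principal G l (D - D') \<and> effective (D' - E))"
  unfolding equiv_to_effective_containing_def contained_in_def using lin_equiv_iff[OF assms] by auto

text \<open>Enlarging a demand by chips at some point shows that the condition passes to smaller
  \<open>r\<close>, and the degree bounds it, so the greatest value is attained and decides all
  smaller ones. For \<open>r = 0\<close> the condition means being equivalent to an effective
  divisor.\<close>

lemma pure_rank_ge_iff:
  assumes D: "divisor_on (points G l) D"
  shows "int r \<le> pure_rank G l D \<longleftrightarrow>
    (\<forall>E. divisor_on (points G l) E \<and> effective E \<and> deg E = int r \<longrightarrow>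
      (\<exists>D'. divisor_on (points G l) D' \<and> effective D' \<and> principal G l (D - D') \<and> effective (D' - E)))"
proof -
  obtain p where p: "p \<in> points G l" by (rule point_exists)
  let ?Q = "\<lambda>r. \<forall>E. divisor_on (points G l) E \<and> effective E \<and> deg E = int r \<longrightarrow>
    equiv_to_effective_containing G l D E"
  let ?eff = "\<exists>D'. divisor_on (points G l) D' \<and> effective D' \<and> lin_equiv G l D D'"
  have bound: "r \<le> nat (deg D)" if Q: "?Q r" for r
  proof -
    obtain E where E: "divisor_on (points G l) E" "effective E" "deg E = int r"
      using effective_exists[OF p] .
    then obtain D' where D': "divisor_on (points G l) D'" "principal G l (D - D')" "effective (D' - E)"
      using Q equiv_containing_iff[OF D] by blast
    have "deg E \<le> deg D"
      using deg_eqI[OF divisor_on_closed[OF D] divisor_on_closed[OF D'(1)] D'(2)] deg_mono[OF D'(3)] by simp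
    with E(3) show ?thesis by linarith
  qed
  have down: "?Q r" if Q: "?Q r'" and le: "r \<le> r'" for r r'
  proof (intro allI impI, elim conjE)
    fix E :: "('v, 'e) point divisor"
    assume E: "divisor_on (points G l) E" "effective E" "deg E = int r"
    obtain F where F: "divisor_on (points G l) F" "effective F" "deg F = int (r' - r)"
      using effective_exists[OF p] .
    have "equiv_to_effective_containing G l D (E + F)"
      using Q E F le by (auto simp: divisor_on_add effective_add deg_add)
    then show "equiv_to_effective_containing G l D E"
      unfolding equiv_containing_iff[OF D] using contained_in_trans[OF _ F(2)] by blast
  qed
  have eff: "?eff" if "?Q r" for r
    using that effective_exists[OF p, of r] unfolding equiv_to_effective_containing_def by metis
  have Q0: "?Q 0" if ?eff
  proof (intro allI impI, elim conjE)
    fix E :: "('v, 'e) point divisor"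
    assume "effective E" "deg E = int 0"
    then have "E = 0" using effective_deg_0 by simp
    then show "equiv_to_effective_containing G l D E"
      using that by (auto simp: equiv_to_effective_containing_def contained_in_def)
  qed
  have "int r \<le> pure_rank G l D \<longleftrightarrow> ?Q r"
  proof
    assume r: "int r \<le> pure_rank G l D"
    then have e: ?eff by (auto simp: pure_rank_def split: if_splits)
    with r have "r \<le> (GREATEST r. ?Q r)" by (simp add: pure_rank_def)
    moreover have "?Q (GREATEST r. ?Q r)"
      by (rule GreatestI_nat[of ?Q 0 "nat (deg D)"]) (use Q0[OF e] bound in blast)+
    ultimately show "?Q r" by (rule down[rotated])
  next
    assume Q: "?Q r"
    then have "r \<le> (GREATEST r. ?Q r)"
      by (intro Greatest_le_nat[of ?Q _ "nat (deg D)"]) (use bound in blast)+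
    with eff[OF Q] show "int r \<le> pure_rank G l D" by (simp add: pure_rank_def)
  qed
  then show ?thesis by (simp only: equiv_containing_iff[OF D])
qed

end

section \<open>Comparison of a weighted curve with its looped model\<close>

definition retract :: "('v, 'e + 'v \<times> nat) point \<Rightarrow> ('v, 'e) point" where
  "retract p = (case p of Vert v \<Rightarrow> Vert v
    | Inner e t \<Rightarrow> (case e of Inl e' \<Rightarrow> Inner e' t | Inr x \<Rightarrow> Vert (fst x)))"

lemma retract_simps [simp]:
  "retract (Vert v) = Vert v" "retract (Inner (Inl e) t) = Inner e t" "retract (Inner (Inr x) t) = Vert (fst x)"
  by (simp_all add: retract_def)

lemma retract_include [simp]: "retract (include_point p) = p"
  by (cases p) auto

lemma push_retract_include [simp]: "push retract (push include_point A) = A"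
  by (simp add: push_push push_id)

locale weighted_curve = pure_curve G l for G :: "('v, 'e) pre_digraph" and l +
  fixes w :: "'v \<Rightarrow> nat" and \<epsilon> :: real
  assumes \<epsilon>: "0 < \<epsilon>"
begin

abbreviation "H \<equiv> attach_loops G w"
abbreviation "lH \<equiv> attach_loops_length \<epsilon> l"

sublocale looped: pure_curve H lH
proof (rule pure_curve.intro)
  show "fin_digraph H" using G by (rule fin_digraph_attach_loops)
  show "verts H \<noteq> {}" using nonempty by simp
  show "0 < lH e" if "e \<in> arcs H" for e using that l \<epsilon> by auto
qed

lemma divisor_on_include: "divisor_on (points G l) A \<Longrightarrow> divisor_on (points H lH) (push include_point A)"
  by (rule divisor_on_push) (simp_all add: include_point_in_points)

lemma retract_in_points: "p \<in> points H lH \<Longrightarrow> retract p \<in> points G l"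
  by (auto simp: points_def)

lemma divisor_on_retract: "divisor_on (points H lH) A \<Longrightarrow> divisor_on (points G l) (push retract A)"
  by (erule divisor_on_push) (rule retract_in_points)

lemma principal_retract:
  assumes "divisor_on (points H lH) A" "principal H lH A"
  shows "principal G l (push retract A)"
proof -
  interpret c: contraction H G "\<lambda>v. v" Inl using G by (rule contraction_attach_loops)
  have keys: "keys A \<subseteq> closed_points H lH"
    using looped.divisor_on_closed[OF assms(1)] by (simp add: divisor_on_def)
  have "principal G l (push (c.collapse_point lH) A)"
    by (rule c.principal_collapse[OF keys _ _ assms(2)]) auto
  moreover have "push (c.collapse_point lH) A = push retract A"
  proof (rule frag_extend_eq)
    fix p assume "p \<in> keys A"
    then have "p \<in> closed_points H lH" using keys by auto
    then show "frag_of (c.collapse_point lH p) = frag_of (retract p)"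
      by (cases rule: c.closed_points_cases) (auto simp: c.collapse_point_arc c.direct_def)
  qed
  ultimately show ?thesis by simp
qed

lemma rank_ge_iff:
  assumes "divisor_on (points G l) D"
  shows "int r \<le> rank \<epsilon> (G, w, l) D \<longleftrightarrow>
    (\<forall>E. divisor_on (points H lH) E \<and> effective E \<and> deg E = int r \<longrightarrow>
      (\<exists>D'. divisor_on (points H lH) D' \<and> effective D' \<and>
        principal H lH (push include_point D - D') \<and> effective (D' - E)))"
  using looped.pure_rank_ge_iff[OF divisor_on_include[OF assms]] by simp

text \<open>
  It suffices to meet demands on the underlying pure curve, where a demanded chip on one of the loops
  at \<open>v\<close> is replaced by two chips at \<open>v\<close>: any further chip on the same loop costs only one.
\<close>

lemma rank_geI:
  assumes D: "divisor_on (points G l) D"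
    and demand: "\<And>E L. divisor_on (points G l) E \<Longrightarrow> effective E \<Longrightarrow> L \<subseteq> (SIGMA v:verts G. {..<w v}) \<Longrightarrow>
      deg E + int (card L) = int r \<Longrightarrow>
      \<exists>D'. divisor_on (points G l) D' \<and> principal G l (D - D') \<and>
        effective (D' - (E + (\<Sum>x\<in>L. frag_of (Vert (fst x))) + (\<Sum>x\<in>L. frag_of (Vert (fst x)))))"
  shows "int r \<le> rank \<epsilon> (G, w, l) D"
  unfolding rank_ge_iff[OF D]
proof (intro allI impI, elim conjE)
  interpret fin_digraph G by (rule G)
  fix E' assume E': "divisor_on (points H lH) E'" "effective E'" "deg E' = int r"
  define L where "L = {x \<in> (SIGMA v:verts G. {..<w v}). \<exists>t. Inner (Inr x) t \<in> keys E'}"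
  have fL: "finite L" unfolding L_def by (rule finite_subset[of _ "SIGMA v:verts G. {..<w v}"]) auto
  have "\<exists>t. Inner (Inr x) t \<in> keys E'" if "x \<in> L" for x using that by (auto simp: L_def)
  then obtain t where t: "\<And>x. x \<in> L \<Longrightarrow> Inner (Inr x) (t x) \<in> keys E'" by metis
  define g where "g x = (Inner (Inr x) (t x) :: ('v, 'e + 'v \<times> nat) point)" for x
  \<comment> \<open>One demanded chip is set aside on each loop that carries any. It is charged
    twice; the other chips of \<open>E'\<close> are charged once.\<close>
  define F where "F = (\<Sum>x\<in>L. frag_of (g x))"
  have lookupF: "lookup F p = (if p \<in> g ` L then 1 else 0)" for p
  proof -
    have "F = (\<Sum>q\<in>g ` L. frag_of q)"
      unfolding F_def by (subst sum.reindex) (auto simp: g_def inj_on_def)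
    then show ?thesis using fL by (simp add: lookup_sum)
  qed
  have "effective (E' - F)"
    unfolding effective_def
  proof
    fix p
    show "0 \<le> lookup (E' - F) p"
    proof (cases "p \<in> g ` L")
      case True
      then have "lookup E' p \<noteq> 0" using t by (auto simp: g_def in_keys_iff)
      moreover have "0 \<le> lookup E' p" using E'(2) by (simp add: effective_def)
      ultimately show ?thesis using True by (simp add: lookup_minus lookupF)
    next
      case False
      then show ?thesis using E'(2) by (simp add: lookup_minus lookupF effective_def)
    qed
  qed
  then have E0: "effective (push retract (E' - F))" by (rule effective_push)
  let ?E0 = "push retract (E' - F)" and ?V = "\<Sum>x\<in>L. frag_of (Vert (fst x))"
  have rF: "push retract F = ?V" by (simp add: F_def push_sum g_def)
  have T: "push retract E' = ?E0 + ?V" by (simp add: frag_extend_diff rF)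
  have degF: "deg F = int (card L)" by (simp add: F_def deg_sum)
  have onF: "divisor_on (points H lH) F"
    unfolding F_def by (rule divisor_on_sum) (use t E'(1) in \<open>auto simp: divisor_on_def g_def\<close>)
  have "divisor_on (points G l) ?E0"
    by (intro divisor_on_retract divisor_on_diff E' onF)
  moreover have "deg ?E0 + int (card L) = int r"
    by (simp add: deg_push deg_diff degF E'(3))
  moreover have "L \<subseteq> (SIGMA v:verts G. {..<w v})" by (auto simp: L_def)
  ultimately obtain D' where D': "divisor_on (points G l) D'" "principal G l (D - D')" "effective (D' - (?E0 + ?V + ?V))"
    using demand[OF _ E0] by blast
  \<comment> \<open>The surplus of \<open>D'\<close> after paying for the retracted demand and for
    one more chip at the base of each loop in \<open>L\<close>; \<open>principal_loop_moves\<close>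
    trades these payments for \<open>E'\<close> and the chips of \<open>?Q\<close>.\<close>
  define X where "X = D' - (push retract E' + ?V)"
  have X: "effective X" using D'(3) by (simp add: X_def T)
  have onV: "divisor_on (points G l) ?V"
    by (rule divisor_on_sum) (auto simp: points_def L_def)
  have onX: "divisor_on (points G l) X"
    unfolding X_def by (intro divisor_on_diff divisor_on_add D' divisor_on_retract E' onV)
  obtain q where q: "\<And>e. e \<in> Inr ` L \<Longrightarrow> 0 \<le> q e \<and> q e < lH e"
    and prin: "principal H lH (push (retract_loops H (Inr ` L)) E' + (\<Sum>e\<in>Inr ` L. frag_of (Vert (tail H e))) -
      (E' + (\<Sum>e\<in>Inr ` L. frag_of (Inner e (q e)))))"
  proof (rule principal_loop_moves[OF looped.G, of "Inr ` L" lH E'])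
    show "Inr ` L \<subseteq> arcs H" by (auto simp: L_def)
    show "tail H e = head H e \<and> 0 < lH e" if "e \<in> Inr ` L" for e using that \<epsilon> by auto
  qed (use that in blast)
  let ?Q = "\<Sum>e\<in>Inr ` L. frag_of (Inner e (q e)) :: ('v, 'e + 'v \<times> nat) point divisor"
  have "push (retract_loops H (Inr ` L)) E' = push (\<lambda>p. include_point (retract p)) E'"
  proof (rule frag_extend_eq)
    fix p assume p: "p \<in> keys E'"
    then have "p \<in> points H lH" using E'(1) by (auto simp: divisor_on_def)
    then have "retract_loops H (Inr ` L) p = include_point (retract p)"
      using p by (auto simp: points_def retract_loops_def L_def intro!: imageI)
    then show "frag_of (retract_loops H (Inr ` L) p) = frag_of (include_point (retract p))" by simp
  qed
  also have "\<dots> = push include_point (push retract E')" by (simp add: push_push)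
  finally have r1: "push (retract_loops H (Inr ` L)) E' = push include_point (push retract E')" .
  have r2: "(\<Sum>e\<in>Inr ` L. frag_of (Vert (tail H e))) = push include_point ?V"
    by (simp add: push_sum sum.reindex)
  let ?D1 = "push include_point X + E' + ?Q"
  have "principal H lH (push include_point (D - D'))"
    using principal_include[OF G D'(2)] .
  from principal_add[OF this prin]
  have p1: "principal H lH (push include_point D - ?D1)"
    unfolding r1 r2 X_def by (simp add: frag_extend_diff frag_extend_add algebra_simps)
  have onQ: "divisor_on (closed_points H lH) ?Q"
    by (rule divisor_on_sum) (use q in \<open>auto simp: closed_points_def L_def less_imp_le\<close>)
  have onD1: "divisor_on (closed_points H lH) ?D1"
    by (intro divisor_on_add looped.divisor_on_closed divisor_on_include onX E' onQ)
  \<comment> \<open>A chip of \<open>?Q\<close> may fall on the base point of its loop, so the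
    result lives on \<open>closed_points\<close> and still has to be normalised; \<open>E'\<close>
    itself is not moved by this.\<close>
  let ?N = "push (normalise H lH)"
  have N: "?N A = A" if "divisor_on (points H lH) A" for A
    by (rule push_id) (use that normalise_points in \<open>auto simp: divisor_on_def\<close>)
  have "divisor_on (closed_points H lH) (push include_point D - ?D1)"
    by (intro divisor_on_diff onD1 looped.divisor_on_closed divisor_on_include D)
  then have "principal H lH (?N (push include_point D - ?D1))"
    by (intro principal_normalise looped.G looped.l p1) (auto simp: divisor_on_def)
  then have p2: "principal H lH (push include_point D - ?N ?D1)"
    by (simp add: frag_extend_diff N divisor_on_include D)
  have "effective (?N ?D1 - E')"
    by (simp add: frag_extend_add N E' divisor_on_include onX)
      (intro effective_add effective_push effective_sum X; simp)
  moreover have "effective (?N ?D1)"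
    by (intro effective_add effective_push effective_sum X E') simp
  moreover have "divisor_on (points H lH) (?N ?D1)"
    by (rule divisor_on_push[OF onD1])
      (rule normalise_in_points, use looped.G in \<open>auto simp: fin_digraph_def\<close>)
  ultimately show "\<exists>D'. divisor_on (points H lH) D' \<and> effective D' \<and>
        principal H lH (push include_point D - D') \<and> effective (D' - E')"
    using p2 by blast
qed

end

section \<open>The Brill-Noether rank as a threshold\<close>

definition bn_property :: "real \<Rightarrow> nat \<Rightarrow> nat \<Rightarrow> int \<Rightarrow> ('v, 'e) trop_curve \<Rightarrow> bool" where
  "bn_property \<epsilon> r d k \<Gamma> \<longleftrightarrow> (case \<Gamma> of (G, w, l) \<Rightarrow>
     \<forall>E. divisor_on (points G l) E \<and> effective E \<and> deg E = k \<longrightarrow>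
       (\<exists>D. divisor_on (points G l) D \<and> effective D \<and> deg D = int d \<and>
         int r \<le> rank \<epsilon> (G, w, l) D \<and> contained_in E D))"

lemma int_greatest:
  fixes P :: "int \<Rightarrow> bool"
  assumes "P k" "\<And>y. P y \<Longrightarrow> y \<le> b"
  shows "P (GREATEST x. P x)" "k \<le> (GREATEST x. P x)"
proof -
  let ?S = "{y. P y \<and> k \<le> y}"
  have fin: "finite ?S" by (rule finite_subset[of _ "{k..b}"]) (use assms in auto)
  have "?S \<noteq> {}" using assms(1) by auto
  then have M: "P (Max ?S)" "k \<le> Max ?S" using Max_in[OF fin] by auto
  have "y \<le> Max ?S" if "P y" for y
    using that M Max_ge[OF fin, of y] by (cases "k \<le> y") auto
  with M(1) have "(GREATEST x. P x) = Max ?S" by (rule Greatest_equality)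
  with M show "P (GREATEST x. P x)" "k \<le> (GREATEST x. P x)" by simp_all
qed

context weighted_curve
begin

text \<open>Bridges the existence clause of \<open>bn_rank\<close>, whose \<open>D\<close> may fail
  to be effective, and the case \<rho> = 0: moving \<open>D\<close> so that it contains
  \<open>E\<close> and retracting the result to the curve yields an effective divisor, and the rank
  depends only on the equivalence class.\<close>

lemma bn_property_0:
  assumes D: "divisor_on (points G l) D" "deg D = int d" "int r \<le> rank \<epsilon> (G, w, l) D"
  shows "bn_property \<epsilon> r d (int r) (G, w, l)"
  unfolding bn_property_def prod.case contained_in_def
proof (intro allI impI, elim conjE)
  fix E :: "('v, 'e) point divisor"
  assume E: "divisor_on (points G l) E" "effective E" "deg E = int r"
  note rank = D(3)[unfolded rank_ge_iff[OF D(1)], rule_format]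
  obtain D' where D': "divisor_on (points H lH) D'" "effective D'" "principal H lH (push include_point D - D')"
    "effective (D' - push include_point E)"
    using rank[of "push include_point E"] E by (auto simp: divisor_on_include effective_push deg_push)
  let ?D = "push retract D'"
  have on: "divisor_on (points G l) ?D" using D'(1) by (rule divisor_on_retract)
  have "principal G l (push retract (push include_point D - D'))"
    by (intro principal_retract D' divisor_on_diff divisor_on_include D)
  then have prin: "principal G l (D - ?D)" by (simp add: frag_extend_diff)
  have "deg ?D = int d"
    using deg_eqI[OF divisor_on_closed[OF D(1)] divisor_on_closed[OF on] prin] D(2) by simp
  moreover have "effective (?D - E)"
    using effective_push[OF D'(4), of retract] by (simp add: frag_extend_diff)
  moreover have "int r \<le> rank \<epsilon> (G, w, l) ?D"
    unfolding rank_ge_iff[OF on]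
  proof (intro allI impI)
    fix E' :: "('v, 'e + 'v \<times> nat) point divisor"
    assume "divisor_on (points H lH) E' \<and> effective E' \<and> deg E' = int r"
    from rank[OF this] obtain D1 where D1: "divisor_on (points H lH) D1" "effective D1"
      "principal H lH (push include_point D - D1)" "effective (D1 - E')" by blast
    have "principal H lH (push include_point ?D - D1)"
      using principal_diff[OF D1(3) principal_include[OF G prin]] by (simp add: frag_extend_diff)
    with D1 show "\<exists>D'. divisor_on (points H lH) D' \<and> effective D' \<and>
        principal H lH (push include_point ?D - D') \<and> effective (D' - E')" by blast
  qed
  ultimately show "\<exists>D. divisor_on (points G l) D \<and> effective D \<and> deg D = int d \<and>
      int r \<le> rank \<epsilon> (G, w, l) D \<and> effective (D - E)"
    using on effective_push[OF D'(2)] by blast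
qed

text \<open>The property passes to smaller \<rho>, fails beyond \<open>d\<close>, and holds for 0
  whenever the existence clause does. So the greatest integer exists, and each threshold
  \<open>k\<close> is tested by a single condition that can be carried to limits.\<close>

lemma bn_rank_ge:
  shows "- 1 \<le> bn_rank \<epsilon> r d (G, w, l)"
    and "int k \<le> bn_rank \<epsilon> r d (G, w, l) \<longleftrightarrow> bn_property \<epsilon> r d (int r + int k) (G, w, l)"
proof -
  obtain p where p: "p \<in> points G l" by (rule point_exists)
  let ?ex = "\<exists>D. divisor_on (points G l) D \<and> deg D = int d \<and> int r \<le> rank \<epsilon> (G, w, l) D"
  let ?P = "\<lambda>k. bn_property \<epsilon> r d (int r + k) (G, w, l)"
  have bn: "bn_rank \<epsilon> r d (G, w, l) = (if ?ex then GREATEST \<rho>. ?P \<rho> else - 1)"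
    by (cases ?ex) (simp_all only: bn_rank.simps bn_property_def prod.case if_True if_False
      not_True_eq_False not_False_eq_True)
  have bound: "\<rho> \<le> int d" if P: "?P \<rho>" for \<rho>
  proof (cases "0 \<le> int r + \<rho>")
    case True
    obtain E where E: "divisor_on (points G l) E" "effective E" "deg E = int (nat (int r + \<rho>))"
      using effective_exists[OF p] .
    then obtain D where D: "deg D = int d" "effective (D - E)"
      using P True unfolding bn_property_def prod.case contained_in_def by auto
    then show ?thesis using deg_mono[OF D(2)] E(3) True by (auto split: if_splits)
  qed auto
  have down: "?P k" if P: "?P k'" and le: "k \<le> k'" for k k'
    unfolding bn_property_def prod.case contained_in_def
  proof (intro allI impI, elim conjE)
    fix E :: "('v, 'e) point divisor"
    assume E: "divisor_on (points G l) E" "effective E" "deg E = int r + k"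
    obtain F where F: "divisor_on (points G l) F" "effective F" "deg F = int (nat (k' - k))"
      using effective_exists[OF p] .
    have "divisor_on (points G l) (E + F) \<and> effective (E + F) \<and> deg (E + F) = int r + k'"
      using E F le by (auto simp: divisor_on_add effective_add deg_add)
    then obtain D where "divisor_on (points G l) D \<and> effective D \<and> deg D = int d \<and>
      int r \<le> rank \<epsilon> (G, w, l) D \<and> effective (D - (E + F))"
      using P unfolding bn_property_def prod.case contained_in_def by blast
    then show "\<exists>D. divisor_on (points G l) D \<and> effective D \<and> deg D = int d \<and>
      int r \<le> rank \<epsilon> (G, w, l) D \<and> effective (D - E)"
      using contained_in_trans[OF _ F(2)] by blast
  qed
  have P0: "?P 0" if ?ex using that bn_property_0 by auto
  have g: "?P (GREATEST \<rho>. ?P \<rho>)" "0 \<le> (GREATEST \<rho>. ?P \<rho>)" if ?ex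
    using int_greatest[of ?P 0 "int d", OF P0[OF that] bound] by auto
  show "- 1 \<le> bn_rank \<epsilon> r d (G, w, l)"
  proof (cases ?ex)
    case True
    then show ?thesis using g(2)[OF True] unfolding bn by (simp only: if_True)
  qed (simp only: bn if_False)
  show "int k \<le> bn_rank \<epsilon> r d (G, w, l) \<longleftrightarrow> ?P (int k)"
  proof
    assume le: "int k \<le> bn_rank \<epsilon> r d (G, w, l)"
    then have ex: ?ex unfolding bn by (auto split: if_splits)
    then have "int k \<le> (GREATEST \<rho>. ?P \<rho>)" using le unfolding bn by (simp only: if_True)
    then show "?P (int k)" using down[OF g(1)[OF ex]] by blast
  next
    assume P: "?P (int k)"
    obtain E where "divisor_on (points G l) E" "effective E" "deg E = int (r + k)"
      using effective_exists[OF p] .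
    then have ex: ?ex using P unfolding bn_property_def prod.case by auto
    have "int k \<le> (GREATEST \<rho>. ?P \<rho>)" by (rule int_greatest(2)[of ?P, OF P bound])
    then show "int k \<le> bn_rank \<epsilon> r d (G, w, l)" unfolding bn using ex by (simp only: if_True)
  qed
qed

end

section \<open>Degenerations\<close>

lemma link_attach_loops: "link (attach_loops G w) (Inl ` F) = link G F"
  by (auto simp: link_def)

lemma div_conv_push:
  fixes \<theta>' :: "'p \<Rightarrow> ('v, 'e) point"
  assumes A: "effective A" and conv: "\<And>p. p \<in> keys A \<Longrightarrow> point_conv (\<lambda>n. \<theta> n p) (\<theta>' p)"
  shows "div_conv (\<lambda>n. push (\<theta> n) A) (push \<theta>' A)"
proof -
  obtain k where "deg A = int k" using effective_deg_nonneg[OF A] nonneg_int_cases by metis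
  then obtain y where y: "A = (\<Sum>i<k. frag_of (y i))" "\<And>i. i < k \<Longrightarrow> y i \<in> keys A"
    using effective_indexed[OF A] by metis
  have "div_conv (\<lambda>n. \<Sum>i<k. frag_of (\<theta> n (y i))) (\<Sum>i<k. frag_of (\<theta>' (y i)))"
    by (intro div_conv_sum div_conv_frag_of conv y(2)) auto
  moreover have "push \<theta>'' A = (\<Sum>i<k. frag_of (\<theta>'' (y i)))" for \<theta>'' :: "'p \<Rightarrow> ('v, 'e) point"
    by (subst y(1)) (simp add: push_sum)
  ultimately show ?thesis by simp
qed

lemma point_conv_include:
  assumes "point_conv p q"
  shows "point_conv (\<lambda>n. include_point (p n)) (include_point q)"
proof (cases q)
  case (Inner e t)
  with assms obtain \<tau> where "\<forall>n. p n = Inner e (\<tau> n)" "\<tau> \<longlonglongrightarrow> t"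
    by (auto simp: point_conv_def)
  then show ?thesis unfolding Inner point_conv_def by auto
qed (use assms in \<open>simp add: point_conv_def\<close>)

context contraction
begin

text \<open>Composes the contraction with the removal of the loops: the collapsed edges of the
  looped curve are those of \<open>H\<close> together with all attached loops.\<close>

lemma contraction_attach: "contraction (attach_loops H w) G \<pi> (\<lambda>f. Inl (\<psi> f))"
proof (rule contraction.intro)
  show "inj_on (\<lambda>f. Inl (\<psi> f)) (arcs G)" using inj by (auto simp: inj_on_def)
  fix u v assume "u \<in> verts (attach_loops H w)" "v \<in> verts (attach_loops H w)" "\<pi> u = \<pi> v"
  then have "(u, v) \<in> (link H collapsed_arcs)\<^sup>*" by (auto intro: fibre_connected)
  moreover have "link H collapsed_arcs \<subseteq>
      link (attach_loops H w) (arcs (attach_loops H w) - (\<lambda>f. Inl (\<psi> f)) ` arcs G)"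
    unfolding link_attach_loops[symmetric, of H collapsed_arcs w] by (rule link_mono) auto
  ultimately show "(u, v) \<in> (link (attach_loops H w) (arcs (attach_loops H w) - (\<lambda>f. Inl (\<psi> f)) ` arcs G))\<^sup>*"
    using rtrancl_mono by blast
next
  fix e assume e: "e \<in> arcs (attach_loops H w) - (\<lambda>f. Inl (\<psi> f)) ` arcs G"
  show "\<pi> (tail (attach_loops H w) e) = \<pi> (head (attach_loops H w) e)"
  proof (cases e)
    case (Inl x)
    with e have "x \<in> collapsed_arcs" by (auto simp: image_iff)
    then show ?thesis using Inl collapsed by simp
  qed simp
qed (use G fin_digraph_attach_loops[OF H] verts arcs ends in auto)

text \<open>A collapsed edge has both ends in one fibre, so the path can use edges of that fibre
  only; removable edges are chosen fibre by fibre.\<close>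

lemma fibre_path:
  assumes "(a, b) \<in> (link H collapsed_arcs)\<^sup>*"
  shows "\<pi> b = \<pi> a \<and> (a, b) \<in> (link H {e \<in> collapsed_arcs. \<pi> (tail H e) = \<pi> a})\<^sup>*"
  using assms
proof (induction rule: rtrancl_induct)
  case (step b c)
  then obtain e where e: "e \<in> collapsed_arcs" "(b, c) \<in> link H {e}" by (auto simp: link_def)
  then have "\<pi> (tail H e) = \<pi> a" "\<pi> c = \<pi> a"
    using step.IH collapsed[of e] by (auto simp: link_def)
  then have "(b, c) \<in> link H {e \<in> collapsed_arcs. \<pi> (tail H e) = \<pi> a}"
    using e by (auto simp: link_def)
  with step.IH \<open>\<pi> c = \<pi> a\<close> show ?case by (auto intro: rtrancl_into_rtrancl)
qed simp

text \<open>Positions are rescaled proportionally, since an edge of a nearby curve has a length that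
  only tends to that of its image. A vertex is lifted to an arbitrary vertex of its fibre; all
  choices agree after collapsing.\<close>

definition lift_point :: "('e \<Rightarrow> real) \<Rightarrow> ('f \<Rightarrow> real) \<Rightarrow> ('u, 'f) point \<Rightarrow> ('v, 'e) point" where
  "lift_point l m p = (case p of Vert u \<Rightarrow> Vert (SOME v. v \<in> verts H \<and> \<pi> v = u)
    | Inner f t \<Rightarrow> Inner (\<psi> f) (if direct f then t * l (\<psi> f) / m f else l (\<psi> f) - t * l (\<psi> f) / m f))"

lemma some_fibre:
  assumes "u \<in> verts G"
  shows "(SOME v. v \<in> verts H \<and> \<pi> v = u) \<in> verts H" "\<pi> (SOME v. v \<in> verts H \<and> \<pi> v = u) = u"
proof -
  obtain v where "v \<in> verts H \<and> \<pi> v = u" using assms unfolding verts[symmetric] by auto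
  from someI[of "\<lambda>v. v \<in> verts H \<and> \<pi> v = u", OF this]
  show "(SOME v. v \<in> verts H \<and> \<pi> v = u) \<in> verts H" "\<pi> (SOME v. v \<in> verts H \<and> \<pi> v = u) = u" by auto
qed

lemma lift_point_in_points:
  assumes p: "p \<in> points G m" and l: "\<And>e. e \<in> arcs H \<Longrightarrow> 0 < l e"
  shows "lift_point l m p \<in> points H l"
proof (cases p)
  case (Vert u)
  then show ?thesis using p some_fibre[of u] by (auto simp: lift_point_def points_def)
next
  case (Inner f t)
  then have f: "f \<in> arcs G" "0 < t" "t < m f" using p by (auto simp: points_def)
  then have e: "\<psi> f \<in> arcs H" using arcs by auto
  have "0 < t / m f" "t / m f < 1" using f by auto
  then have "0 < (t / m f) * l (\<psi> f)" "(t / m f) * l (\<psi> f) < 1 * l (\<psi> f)"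
    using l[OF e] by (auto simp only: mult_pos_pos mult_strict_right_mono)
  then show ?thesis using Inner e by (auto simp: lift_point_def points_def)
qed

lemma lift_point_conv:
  assumes "p \<in> points G m" "\<And>e. e \<in> arcs H \<Longrightarrow> (\<lambda>n. l n e) \<longlonglongrightarrow> l' e"
  shows "point_conv (\<lambda>n. lift_point (l n) m p) (lift_point l' m p)"
proof (cases p)
  case (Vert u)
  then show ?thesis by (simp add: lift_point_def point_conv_def)
next
  case (Inner f t)
  then have f: "f \<in> arcs G" "0 < t" "t < m f" using assms(1) by (auto simp: points_def)
  then have e: "\<psi> f \<in> arcs H" using arcs by auto
  have "(\<lambda>n. if direct f then t * l n (\<psi> f) / m f else l n (\<psi> f) - t * l n (\<psi> f) / m f) \<longlonglongrightarrow>
    (if direct f then t * l' (\<psi> f) / m f else l' (\<psi> f) - t * l' (\<psi> f) / m f)"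
    using assms(2)[OF e] f by (auto intro!: tendsto_intros)
  then show ?thesis unfolding Inner lift_point_def point_conv_def by auto
qed

text \<open>Every chip on an edge collapsed to \<open>u\<close> lands on \<open>u\<close>, so counts
  on collapsed edges, which limits preserve, become lower bounds for coefficients at
  vertices.\<close>

lemma effective_fibre_chips:
  assumes C: "effective C" and keys: "keys C \<subseteq> closed_points H l" and L: "finite L"
    and f: "\<And>x. x \<in> L \<Longrightarrow> f x \<in> verts G"
    and count: "\<And>u. u \<in> verts G \<Longrightarrow> int (card {x \<in> L. f x = u}) \<le>
      (\<Sum>e\<in>{e \<in> collapsed_arcs. \<pi> (tail H e) = u}. on_edge_count e C)"
  shows "effective (push (normalise G m) (push (collapse_point l) C) - (\<Sum>x\<in>L. frag_of (Vert (f x))))"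
  unfolding effective_def
proof
  interpret H: fin_digraph H by (rule H)
  fix p
  let ?C = "push (normalise G m) (push (collapse_point l) C)"
  have C': "0 \<le> lookup ?C p"
    using effective_push[OF effective_push[OF C], of "normalise G m" "collapse_point l"]
    by (simp add: effective_def)
  show "0 \<le> lookup (?C - (\<Sum>x\<in>L. frag_of (Vert (f x)))) p"
  proof (cases "\<exists>u\<in>verts G. p = Vert u")
    case True
    then obtain u where u: "u \<in> verts G" "p = Vert u" by auto
    let ?F = "{e \<in> collapsed_arcs. \<pi> (tail H e) = u}"
    have "(\<Sum>e\<in>?F. on_edge_count e C) = ev (\<lambda>q. \<Sum>e\<in>?F. edge_fun e (\<lambda>_. 1) q) C"
      by (simp add: ev_sum_fun)
    also have "\<dots> \<le> ev (\<lambda>q. if normalise G m (collapse_point l q) = Vert u then 1 else 0) C"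
    proof (rule ev_mono[OF C])
      fix q
      show "(\<Sum>e\<in>?F. edge_fun e (\<lambda>_. 1) q) \<le> (if normalise G m (collapse_point l q) = Vert u then 1 else 0 :: int)"
      proof (cases q)
        case (Inner e t)
        have "(\<Sum>e'\<in>?F. edge_fun e' (\<lambda>_. 1) q) = (\<Sum>e'\<in>?F. if e = e' then 1 else (0::int))"
          by (rule sum.cong) (auto simp: Inner)
        also have "\<dots> = (if e \<in> ?F then 1 else 0)" by simp
        finally show ?thesis by (auto simp: Inner normalise_def)
      qed simp
    qed
    also have "\<dots> = lookup ?C p" by (simp add: lookup_push ev_push u(2))
    finally have "int (card {x \<in> L. f x = u}) \<le> lookup ?C p" using count[OF u(1)] by simp
    moreover have "lookup (\<Sum>x\<in>L. frag_of (Vert (f x))) p = int (card {x \<in> L. f x = u})"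
    proof -
      have "lookup (\<Sum>x\<in>L. frag_of (Vert (f x))) p = (\<Sum>x\<in>L. if f x = u then 1 else 0)"
        by (auto simp: lookup_sum u(2) intro!: sum.cong)
      also have "\<dots> = int (card {x \<in> L. f x = u})"
        using L by (simp add: sum.If_cases Int_def)
      finally show ?thesis .
    qed
    ultimately show ?thesis by (simp add: lookup_minus)
  next
    case False
    then have "lookup (\<Sum>x\<in>L. frag_of (Vert (f x))) p = 0"
      using f by (auto simp: lookup_sum intro!: sum.neutral)
    then show ?thesis using C' by (simp add: lookup_minus)
  qed
qed

end

text \<open>The bound in \<open>weight\<close> is the genus of the fibre over \<open>u\<close>, its
  first Betti number plus its weights. Only an inequality is asked, which the truncation of genera
  to natural numbers in \<open>contract\<close> respects; the alternative 0 is the truncated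
  case.\<close>

locale degeneration = contraction H G \<pi> \<psi>
  for H :: "('v, 'e) pre_digraph" and G :: "('u, 'f) pre_digraph" and \<pi> and \<psi> +
  fixes l :: "nat \<Rightarrow> 'e \<Rightarrow> real" and l' :: "'e \<Rightarrow> real" and m :: "'f \<Rightarrow> real"
    and w :: "'v \<Rightarrow> nat" and w' :: "'u \<Rightarrow> nat" and \<epsilon> :: real
  assumes connected: "\<And>u v. u \<in> verts H \<Longrightarrow> v \<in> verts H \<Longrightarrow> (u, v) \<in> (link H (arcs H))\<^sup>*"
    and nonempty: "verts H \<noteq> {}"
    and l: "\<And>n e. e \<in> arcs H \<Longrightarrow> 0 < l n e" "\<And>e. e \<in> arcs H \<Longrightarrow> (\<lambda>n. l n e) \<longlonglongrightarrow> l' e"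
    and m: "\<And>f. f \<in> arcs G \<Longrightarrow> 0 < m f" "\<And>f. f \<in> arcs G \<Longrightarrow> l' (\<psi> f) = m f"
    and l'_collapsed: "\<And>e. e \<in> collapsed_arcs \<Longrightarrow> l' e = 0"
    and \<epsilon>: "0 < \<epsilon>"
    and weight: "\<And>u. u \<in> verts G \<Longrightarrow> w' u = 0 \<or>
      int (w' u) \<le> (\<Sum>v\<in>{v \<in> verts H. \<pi> v = u}. int (w v)) +
        int (card {e \<in> collapsed_arcs. \<pi> (tail H e) = u}) - int (card {v \<in> verts H. \<pi> v = u}) + 1"
begin

abbreviation "K \<equiv> attach_loops H w"
abbreviation "lK n \<equiv> attach_loops_length \<epsilon> (l n)"
abbreviation "lK' \<equiv> attach_loops_length \<epsilon> l'"

sublocale c: contraction K G \<pi> "\<lambda>f. Inl (\<psi> f)" by (rule contraction_attach)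

lemma curve: "weighted_curve H (l n) \<epsilon>"
  by (rule weighted_curve.intro) (use H l \<epsilon> nonempty in \<open>auto intro: pure_curve.intro weighted_curve_axioms.intro\<close>)

sublocale limit: weighted_curve G m w' \<epsilon>
  by (rule weighted_curve.intro)
    (use G m \<epsilon> nonempty verts in \<open>auto intro!: pure_curve.intro weighted_curve_axioms.intro\<close>)

lemma K_connected: "u \<in> verts K \<Longrightarrow> v \<in> verts K \<Longrightarrow> (u, v) \<in> (link K (arcs K))\<^sup>*"
proof -
  assume "u \<in> verts K" "v \<in> verts K"
  then have "(u, v) \<in> (link H (arcs H))\<^sup>*" by (simp add: connected)
  moreover have "link H (arcs H) \<subseteq> link K (arcs K)"
    unfolding link_attach_loops[symmetric, of H "arcs H" w] by (rule link_mono) auto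
  ultimately show "(u, v) \<in> (link K (arcs K))\<^sup>*" using rtrancl_mono by blast
qed

lemma lK: "e \<in> arcs K \<Longrightarrow> 0 < lK n e" "e \<in> arcs K \<Longrightarrow> (\<lambda>n. lK n e) \<longlonglongrightarrow> lK' e"
  using l \<epsilon> by auto

lemma lK_bounded: obtains B where "\<And>n e. e \<in> arcs K \<Longrightarrow> lK n e \<le> B e"
proof -
  have "\<exists>b. \<forall>n. lK n e \<le> b" if e: "e \<in> arcs K" for e
  proof -
    have "convergent (\<lambda>n. lK n e)" using lK(2)[OF e] by (auto simp: convergent_def)
    then have "Bseq (\<lambda>n. lK n e)" by (rule convergent_imp_Bseq)
    then obtain b where "\<forall>n. norm (lK n e) \<le> b" by (auto simp: Bseq_def)
    then have "lK n e \<le> b" for n by (metis abs_le_D1 real_norm_def)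
    then show ?thesis by blast
  qed
  then show ?thesis using that by metis
qed

abbreviation (input) "lim_push X \<equiv> push (normalise G m) (push (c.collapse_point lK') X)"

lemma collapse_in_closed: "p \<in> closed_points K lK' \<Longrightarrow> c.collapse_point lK' p \<in> closed_points G m"
  by (rule c.collapse_point_in_closed_points) (simp_all add: m)

lemma divisor_on_lim_push:
  assumes "divisor_on (closed_points K lK') X"
  shows "divisor_on (points G m) (lim_push X)"
proof (rule divisor_on_push[OF divisor_on_push[OF assms collapse_in_closed]])
  show "normalise G m p \<in> points G m" if "p \<in> closed_points G m" for p
    using that G by (intro normalise_in_points) (auto simp: fin_digraph_def)
qed

text \<open>The collapsed edges of \<open>K\<close> are of the two kinds that
  \<open>principal_collapse\<close> allows: edges of limit length 0, and attached loops, whose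
  length stays \<epsilon>.\<close>

lemma principal_lim_push:
  assumes on: "divisor_on (closed_points K lK') X" and "principal K lK' X"
  shows "principal G m (lim_push X)"
proof (rule principal_normalise[OF G])
  show "principal G m (push (c.collapse_point lK') X)"
  proof (rule c.principal_collapse)
    show "lK' e = 0 \<or> tail K e = head K e" if "e \<in> c.collapsed_arcs" for e
    proof (cases e)
      case (Inl x)
      with that have "x \<in> collapsed_arcs" by (auto simp: image_iff)
      then show ?thesis using Inl l'_collapsed by simp
    qed simp
  qed (use assms m in \<open>auto simp: divisor_on_def\<close>)
  show "keys (push (c.collapse_point lK') X) \<subseteq> closed_points G m"
    using divisor_on_push[OF on collapse_in_closed] by (simp add: divisor_on_def)
qed (rule m)

lemma div_conv_closed:
  assumes "div_conv D Dl" "\<And>n. divisor_on (closed_points K (lK (\<sigma> n))) (D n)" "strict_mono \<sigma>"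
  shows "divisor_on (closed_points K lK') Dl"
  unfolding divisor_on_def
proof (rule div_conv_keys[OF assms(1)])
  show "keys (D n) \<subseteq> closed_points K (lK (\<sigma> n))" for n
    using assms(2) by (simp add: divisor_on_def)
  show "(\<lambda>n. lK (\<sigma> n) e) \<longlonglongrightarrow> lK' e" if "e \<in> arcs K" for e
    using LIMSEQ_subseq_LIMSEQ[OF lK(2)[OF that] assms(3)] by (simp add: o_def)
qed

abbreviation "lift n \<equiv> push (lift_point (l n) m)"
abbreviation "lift' E \<equiv> push include_point (push (lift_point l' m) E)"

lemma divisor_on_lift: "divisor_on (points G m) E \<Longrightarrow> divisor_on (points H (l n)) (lift n E)"
  by (erule divisor_on_push) (rule lift_point_in_points, use l in auto)

lemma div_conv_lift:
  assumes "divisor_on (points G m) E" "effective E"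
  shows "div_conv (\<lambda>n. push include_point (lift n E)) (lift' E)"
  unfolding push_push
  by (rule div_conv_push[OF assms(2)])
    (use assms(1) in \<open>auto simp: divisor_on_def intro!: point_conv_include lift_point_conv l(2)\<close>)

text \<open>On surviving edges the limit lengths \<open>l'\<close> and \<open>m\<close> agree, so
  the rescaling in \<open>lift_point\<close> is trivial and only a possible reversal has to be
  undone.\<close>

lemma lim_push_lift:
  assumes E: "divisor_on (points G m) E"
  shows "lim_push (lift' E) = E"
proof -
  have "normalise G m (c.collapse_point lK' (include_point (lift_point l' m p))) = p"
    if p: "p \<in> keys E" for p
  proof -
    have p': "p \<in> points G m" using E p by (auto simp: divisor_on_def)
    have "c.collapse_point lK' (include_point (lift_point l' m p)) = p"
    proof (cases p)
      case (Vert u)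
      then show ?thesis using p' some_fibre[of u] by (auto simp: lift_point_def points_def)
    next
      case (Inner f t)
      then have f: "f \<in> arcs G" "0 < m f" using p' m by (auto simp: points_def)
      have "c.direct f = direct f" by (simp add: c.direct_def direct_def)
      then show ?thesis using f Inner c.collapse_point_arc[OF f(1), of lK'] m(2)[OF f(1)]
        by (simp add: lift_point_def)
    qed
    then show ?thesis using normalise_points[OF p'] by simp
  qed
  then show ?thesis unfolding push_push by (rule push_id)
qed

definition fibre_arcs :: "'u \<Rightarrow> ('e + 'v \<times> nat) set" where
  "fibre_arcs u = {e \<in> c.collapsed_arcs. \<pi> (tail K e) = u}"

text \<open>In \<open>K\<close> the weights over \<open>u\<close> have turned into attached loops,
  so the bound in \<open>weight\<close> is the first Betti number of the fibre graph and
  \<open>removable_edges\<close> applies.\<close>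

lemma fibre_removable:
  assumes u: "u \<in> verts G" and k: "k \<le> w' u"
  obtains R where "R \<subseteq> fibre_arcs u" "card R = k"
    "\<And>a b. a \<in> verts H \<Longrightarrow> b \<in> verts H \<Longrightarrow> \<pi> a = u \<Longrightarrow> \<pi> b = u \<Longrightarrow> (a, b) \<in> (link K (fibre_arcs u - R))\<^sup>*"
proof -
  interpret H: fin_digraph H by (rule H)
  interpret K: fin_digraph K by (rule c.H)
  let ?U = "{v \<in> verts H. \<pi> v = u}" and ?F0 = "{e \<in> collapsed_arcs. \<pi> (tail H e) = u}"
  have F: "fibre_arcs u = Inl ` ?F0 \<union> Inr ` (SIGMA v:?U. {..<w v})"
    by (auto simp: fibre_arcs_def image_iff)
  have "card (fibre_arcs u) = card (Inl ` ?F0 :: ('e + 'v \<times> nat) set) +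
      card (Inr ` (SIGMA v:?U. {..<w v}) :: ('e + 'v \<times> nat) set)"
    unfolding F by (rule card_Un_disjoint) auto
  also have "\<dots> = card ?F0 + (\<Sum>v\<in>?U. w v)"
    by (simp add: card_image inj_on_def)
  finally have card: "card (fibre_arcs u) = card ?F0 + (\<Sum>v\<in>?U. w v)" .
  obtain R where "R \<subseteq> fibre_arcs u" "card R = k"
    "\<And>a b. a \<in> ?U \<Longrightarrow> b \<in> ?U \<Longrightarrow> (a, b) \<in> (link K (fibre_arcs u - R))\<^sup>*"
  proof (rule removable_edges[of ?U "fibre_arcs u" K k])
    show "?U \<noteq> {}" using u unfolding verts[symmetric] by auto
    show "finite (fibre_arcs u)" unfolding fibre_arcs_def by (rule finite_subset[OF _ K.finite_arcs]) auto
    show "tail K e \<in> ?U \<and> head K e \<in> ?U" if "e \<in> fibre_arcs u" for e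
      using that c.collapsed[of e] K.wellformed[of e] by (auto simp: fibre_arcs_def)
    show "(a, b) \<in> (link K (fibre_arcs u))\<^sup>*" if "a \<in> ?U" "b \<in> ?U" for a b
      using c.fibre_path[OF c.fibre_connected, of a b] that by (auto simp: fibre_arcs_def)
    show "k = 0 \<or> int k \<le> int (card (fibre_arcs u)) - int (card ?U) + 1"
      using weight[OF u] k unfolding card by auto
  qed auto
  then show ?thesis using that by auto
qed

end

context degeneration
begin

text \<open>
  The demand on the limit curve is lifted, the part \<open>L\<close> supported on loops being placed
  generically on edges that contract to the same vertex: by genericity it is then met with twice
  as many chips near that vertex.
\<close>

lemma demand_met:
  assumes D: "divisor_on (points H (l n)) D" "deg D = int d" "int r \<le> rank \<epsilon> (H, w, l n) D"
    and E: "divisor_on (points G m) E" "effective E" and L: "L \<subseteq> (SIGMA u:verts G. {..<w' u})"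
    and deg: "deg E + int (card L) = int r"
  shows "\<exists>X C. divisor_on (points K (lK n)) X \<and> divisor_on (points K (lK n)) C \<and>
    effective X \<and> effective C \<and> deg X = int (card L) \<and> deg C = int d - int r \<and>
    principal K (lK n) (push include_point D - (push include_point (lift n E) + X + C)) \<and>
    (\<forall>u\<in>verts G. int (card {x \<in> L. fst x = u}) \<le> (\<Sum>e\<in>fibre_arcs u. on_edge_count e X)) \<and>
    (\<forall>u\<in>verts G. int (card {x \<in> L. fst x = u}) \<le> (\<Sum>e\<in>fibre_arcs u. on_edge_count e C))"
proof -
  interpret G: fin_digraph G by (rule G)
  interpret H: fin_digraph H by (rule H)
  interpret K: fin_digraph K by (rule c.H)
  interpret W: weighted_curve H "l n" w \<epsilon> by (rule curve)
  have fL: "finite L" using L by (rule finite_subset) auto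
  let ?L = "\<lambda>u. {x \<in> L. fst x = u}"
  have Lu: "card (?L u) \<le> w' u" for u
  proof -
    have "?L u \<subseteq> Pair u ` {..<w' u}" using L by auto
    then have "card (?L u) \<le> card (Pair u ` {..<w' u})" by (intro card_mono) auto
    also have "\<dots> \<le> w' u" using card_image_le[of "{..<w' u}" "Pair u"] by simp
    finally show ?thesis .
  qed
  define Q where "Q u R \<longleftrightarrow> R \<subseteq> fibre_arcs u \<and> card R = card (?L u) \<and>
    (\<forall>a b. a \<in> verts H \<longrightarrow> b \<in> verts H \<longrightarrow> \<pi> a = u \<longrightarrow> \<pi> b = u \<longrightarrow> (a, b) \<in> (link K (fibre_arcs u - R))\<^sup>*)"
    for u R
  have "\<exists>R. Q u R" if "u \<in> verts G" for u
    by (rule fibre_removable[OF that Lu]) (unfold Q_def, blast)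
  then have "\<forall>u\<in>verts G. \<exists>R. Q u R" by blast
  from bchoice[OF this] obtain R where Q: "\<forall>u\<in>verts G. Q u (R u)" ..
  have R: "\<And>u. u \<in> verts G \<Longrightarrow> R u \<subseteq> fibre_arcs u"
    "\<And>u. u \<in> verts G \<Longrightarrow> card (R u) = card (?L u)"
    "\<And>u a b. u \<in> verts G \<Longrightarrow> a \<in> verts H \<Longrightarrow> b \<in> verts H \<Longrightarrow> \<pi> a = u \<Longrightarrow> \<pi> b = u \<Longrightarrow>
      (a, b) \<in> (link K (fibre_arcs u - R u))\<^sup>*"
    using Q[rule_format] unfolding Q_def by auto
  have fibre_sub: "fibre_arcs u \<subseteq> arcs K" for u by (auto simp: fibre_arcs_def)
  have fibre_disj: "fibre_arcs u \<inter> fibre_arcs v = {}" if "u \<noteq> v" for u v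
    using that by (auto simp: fibre_arcs_def)
  have fin_fibre: "finite (fibre_arcs u)" for u
    using fibre_sub by (rule finite_subset) simp
  have fR: "finite (R u)" if "u \<in> verts G" for u
    using R(1)[OF that] fin_fibre by (rule finite_subset)
  \<comment> \<open>The demands of all vertices are placed together, since the rank assumption is
    applied to a single divisor.\<close>
  define S where "S = (\<Union>u\<in>verts G. R u)"
  have S: "S \<subseteq> arcs K" using R(1) fibre_sub unfolding S_def by blast
  have fS: "finite S" using S by (rule finite_subset) simp
  have SF: "R u = S \<inter> fibre_arcs u" if "u \<in> verts G" for u
  proof
    show "R u \<subseteq> S \<inter> fibre_arcs u" using R(1)[OF that] that by (auto simp: S_def)
    show "S \<inter> fibre_arcs u \<subseteq> R u"
    proof
      fix e assume e: "e \<in> S \<inter> fibre_arcs u"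
      then obtain v where v: "v \<in> verts G" "e \<in> R v" by (auto simp: S_def)
      then have "v = u" using e R(1)[OF v(1)] by (auto simp: fibre_arcs_def)
      with v show "e \<in> R u" by simp
    qed
  qed
  have "card S = (\<Sum>u\<in>verts G. card (R u))"
    unfolding S_def
  proof (rule card_UN_disjoint)
    show "\<forall>u\<in>verts G. \<forall>v\<in>verts G. u \<noteq> v \<longrightarrow> R u \<inter> R v = {}"
    proof (intro ballI impI)
      fix u v assume "u \<in> verts G" "v \<in> verts G" "u \<noteq> v"
      then show "R u \<inter> R v = {}" using R(1)[of u] R(1)[of v] fibre_disj[of u v] by auto
    qed
  qed (use fR in auto)
  also have "\<dots> = (\<Sum>u\<in>verts G. card (?L u))" by (simp add: R(2))
  also have "\<dots> = card (\<Union>u\<in>verts G. ?L u)"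
    by (rule card_UN_disjoint[symmetric]) (use fL in auto)
  also have "(\<Union>u\<in>verts G. ?L u) = L" using L by auto
  finally have cardS: "card S = card L" .
  define E1 where "E1 = push include_point (lift n E)"
  have E1: "divisor_on (points K (lK n)) E1" "effective E1" "deg E1 = deg E"
    unfolding E1_def using E by (auto intro: W.divisor_on_include divisor_on_lift effective_push simp: deg_push)
  \<comment> \<open>All lengths and positions known before the generic demand is placed; positions
    independent over \<open>M\<close> can be matched only with the help of chips of
    \<open>C\<close>.\<close>
  define M where "M = lK n ` arcs K \<union>
    (\<Union>e\<in>arcs K. edge_support e (push include_point D) \<union> edge_support e E1)"
  have fM: "finite M" unfolding M_def by auto
  obtain x where x: "\<And>e. e \<in> S \<Longrightarrow> 0 < x e \<and> x e < lK n e"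
    and generic: "\<And>R' Y. R' \<subseteq> S \<Longrightarrow> finite Y \<Longrightarrow> x ` R' \<subseteq> rat.span (M \<union> Y) \<Longrightarrow> card R' \<le> card Y"
  proof (rule generic_positions[OF fM fS, of "lK n"])
    show "0 < lK n e" if "e \<in> S" for e using that S by (intro lK(1)) auto
  qed (use that in blast)
  define X :: "('v, 'e + 'v \<times> nat) point divisor" where "X = (\<Sum>e\<in>S. frag_of (Inner e (x e)))"
  have onX: "divisor_on (points K (lK n)) X"
    unfolding X_def by (rule divisor_on_sum) (use x S in \<open>auto simp: points_def\<close>)
  have effX: "effective X" unfolding X_def by (rule effective_sum) simp
  have degX: "deg X = int (card L)" by (simp add: X_def deg_sum cardS)
  have "divisor_on (points K (lK n)) (E1 + X)" "effective (E1 + X)" "deg (E1 + X) = int r"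
    using E1 onX effX deg degX by (auto intro: divisor_on_add effective_add simp: deg_add)
  then obtain D' where D': "divisor_on (points K (lK n)) D'"
    "principal K (lK n) (push include_point D - D')" "effective (D' - (E1 + X))"
    using D(3)[unfolded W.rank_ge_iff[OF D(1)]] by blast
  define C where "C = D' - (E1 + X)"
  have onC: "divisor_on (points K (lK n)) C"
    unfolding C_def by (intro divisor_on_diff divisor_on_add D' E1 onX)
  have "deg (push include_point D) = deg D'"
    by (rule W.looped.deg_eqI) (intro W.looped.divisor_on_closed W.divisor_on_include D D')+
  then have degC: "deg C = int d - int r"
    using D(2) deg degX E1(3) by (simp add: C_def deg_diff deg_add deg_push)
  have prin: "principal K (lK n) (push include_point D - (E1 + X + C))"
    using D'(2) by (simp add: C_def)
  \<comment> \<open>The second chip per loop: \<open>X\<close> has one on each edge of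
    \<open>R u\<close> by construction, and genericity forces at least as many in the remainder
    \<open>C\<close>.\<close>
  have "int (card (?L u)) \<le> (\<Sum>e\<in>fibre_arcs u. on_edge_count e C)" if u: "u \<in> verts G" for u
    unfolding R(2)[OF u, symmetric]
  proof (rule generic_demand[OF c.H fibre_sub R(1)[OF u] SF[OF u] S])
    show "(a, b) \<in> (link K (fibre_arcs u - R u))\<^sup>*"
      if "a \<in> {v \<in> verts H. \<pi> v = u}" "b \<in> {v \<in> verts H. \<pi> v = u}" for a b
      using R(3)[OF u] that by blast
    show "tail K e \<in> {v \<in> verts H. \<pi> v = u} \<and> head K e \<in> {v \<in> verts H. \<pi> v = u}"
      if "e \<in> fibre_arcs u" for e
      using that c.collapsed[of e] K.wellformed[of e] by (auto simp: fibre_arcs_def)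
    show "lK n e \<in> M \<and> edge_support e (push include_point D) \<subseteq> M \<and> edge_support e E1 \<subseteq> M"
      if "e \<in> fibre_arcs u" for e
      using that fibre_sub[of u] unfolding M_def by blast
    show "card (R u) \<le> card Y" if "finite Y" "x ` R u \<subseteq> rat.span (M \<union> Y)" for Y
      using generic[OF _ that] SF[OF u] by blast
    show "effective C" using D'(3) by (simp add: C_def)
    show "principal K (lK n) (push include_point D - (E1 + (\<Sum>e\<in>S. frag_of (Inner e (x e))) + C))"
      using prin by (simp add: X_def)
  qed
  moreover have "int (card (?L u)) \<le> (\<Sum>e\<in>fibre_arcs u. on_edge_count e X)" if u: "u \<in> verts G" for u
  proof -
    have "on_edge_count e X = (if e \<in> S then 1 else 0)" for e
      using fS by (simp add: X_def ev_sum cong: if_cong)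
    then have "(\<Sum>e\<in>fibre_arcs u. on_edge_count e X) = (\<Sum>e\<in>fibre_arcs u. if e \<in> S then 1 else 0)"
      by simp
    also have "\<dots> = int (card (R u))"
      using fin_fibre by (simp add: sum.If_cases SF[OF u] Int_commute)
    finally show ?thesis using R(2)[OF u] by simp
  qed
  ultimately show ?thesis
    using onX onC effX D'(3) degX degC prin unfolding E1_def[symmetric] C_def[symmetric] by blast
qed

text \<open>\<open>X\<close> and \<open>C\<close> of \<open>demand_met\<close> subconverge along
  with the divisors. Each supplies one chip per demanded loop at the limit vertex, and together they
  give the two that \<open>rank_geI\<close> asks for.\<close>

lemma rank_limit:
  assumes D: "\<And>n. divisor_on (points H (l n)) (D n)" "\<And>n. deg (D n) = int d"
      "\<And>n. int r \<le> rank \<epsilon> (H, w, l n) (D n)"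
    and \<sigma>: "strict_mono \<sigma>" and conv: "div_conv (\<lambda>n. push include_point (D (\<sigma> n))) Dl"
  shows "int r \<le> rank \<epsilon> (G, w', m) (lim_push Dl)"
proof (rule limit.rank_geI)
  interpret G: fin_digraph G by (rule G)
  have onD: "divisor_on (points K (lK n)) (push include_point (D n))" for n
  proof -
    interpret W: weighted_curve H "l n" w \<epsilon> by (rule curve)
    show ?thesis by (rule W.divisor_on_include[OF D(1)])
  qed
  have closed: "divisor_on (points K (lK n)) A \<Longrightarrow> divisor_on (closed_points K (lK n)) A" for A n
    by (rule divisor_on_mono[OF _ points_subset_closed_points])
  have onDl: "divisor_on (closed_points K lK') Dl"
    using div_conv_closed[OF conv closed[OF onD] \<sigma>] .
  then show "divisor_on (points G m) (lim_push Dl)" by (rule divisor_on_lim_push)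
  fix E L
  assume E: "divisor_on (points G m) E" "effective E" and L: "L \<subseteq> (SIGMA u:verts G. {..<w' u})"
    and deg: "deg E + int (card L) = int r"
  have fL: "finite L" using L by (rule finite_subset) auto
  let ?L = "\<lambda>u. {x \<in> L. fst x = u}"
  define Q where "Q n X C \<longleftrightarrow> divisor_on (points K (lK n)) X \<and> divisor_on (points K (lK n)) C \<and>
    effective X \<and> effective C \<and> deg X = int (card L) \<and> deg C = int d - int r \<and>
    principal K (lK n) (push include_point (D n) - (push include_point (lift n E) + X + C)) \<and>
    (\<forall>u\<in>verts G. int (card (?L u)) \<le> (\<Sum>e\<in>fibre_arcs u. on_edge_count e X)) \<and>
    (\<forall>u\<in>verts G. int (card (?L u)) \<le> (\<Sum>e\<in>fibre_arcs u. on_edge_count e C))" for n X C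
  have "\<exists>X C. Q n X C" for n
    unfolding Q_def by (rule demand_met[OF D E L deg])
  then obtain X C where Q: "\<And>n. Q n (X n) (C n)" by metis
  have onX: "\<And>n. divisor_on (points K (lK n)) (X n)" and onC: "\<And>n. divisor_on (points K (lK n)) (C n)"
    and effX: "\<And>n. effective (X n)" and effC: "\<And>n. effective (C n)"
    and degX: "\<And>n. deg (X n) = int (card L)" and degC: "\<And>n. deg (C n) = int d - int r"
    and prin: "\<And>n. principal K (lK n) (push include_point (D n) - (push include_point (lift n E) + X n + C n))"
    and countX: "\<And>n u. u \<in> verts G \<Longrightarrow> int (card (?L u)) \<le> (\<Sum>e\<in>fibre_arcs u. on_edge_count e (X n))"
    and countC: "\<And>n u. u \<in> verts G \<Longrightarrow> int (card (?L u)) \<le> (\<Sum>e\<in>fibre_arcs u. on_edge_count e (C n))"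
    using Q unfolding Q_def by blast+
  \<comment> \<open>Effectivity of \<open>C n\<close> gives \<open>r \<le> d\<close>, so the
    subtraction of natural numbers is exact.\<close>
  have degC': "deg (C n) = int (d - r)" for n
    using degC[of n] effective_deg_nonneg[OF effC[of n]] by linarith
  obtain B where B: "\<And>n e. e \<in> arcs K \<Longrightarrow> lK n e \<le> B e" using lK_bounded by blast
  obtain \<rho> :: "nat \<Rightarrow> nat" and Xl where \<rho>: "strict_mono \<rho>" "div_conv (\<lambda>n. X (\<sigma> (\<rho> n))) Xl"
    by (rule div_conv_compact[OF c.H, of "\<lambda>n. lK (\<sigma> n)" B "\<lambda>n. X (\<sigma> n)" "card L"])
      (use B closed[OF onX] effX degX in \<open>auto simp: divisor_on_def\<close>)
  obtain \<tau> :: "nat \<Rightarrow> nat" and Cl where \<tau>: "strict_mono \<tau>" "div_conv (\<lambda>n. C (\<sigma> (\<rho> (\<tau> n)))) Cl"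
    by (rule div_conv_compact[OF c.H, of "\<lambda>n. lK (\<sigma> (\<rho> n))" B "\<lambda>n. C (\<sigma> (\<rho> n))" "d - r"])
      (use B closed[OF onC] effC degC' in \<open>auto simp: divisor_on_def\<close>)
  define \<sigma>' where "\<sigma>' n = \<sigma> (\<rho> (\<tau> n))" for n
  have \<rho>\<tau>: "strict_mono (\<lambda>n. \<rho> (\<tau> n))" using strict_mono_o[OF \<rho>(1) \<tau>(1)] by (simp add: o_def)
  have \<sigma>': "strict_mono \<sigma>'" using strict_mono_o[OF \<sigma> \<rho>\<tau>] by (simp add: o_def \<sigma>'_def[abs_def])
  have convD: "div_conv (\<lambda>n. push include_point (D (\<sigma>' n))) Dl"
    using div_conv_subseq[OF conv \<rho>\<tau>] by (simp add: \<sigma>'_def)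
  have convX: "div_conv (\<lambda>n. X (\<sigma>' n)) Xl"
    using div_conv_subseq[OF \<rho>(2) \<tau>(1)] by (simp add: \<sigma>'_def)
  have convC: "div_conv (\<lambda>n. C (\<sigma>' n)) Cl" using \<tau>(2) by (simp add: \<sigma>'_def)
  have convE: "div_conv (\<lambda>n. push include_point (lift (\<sigma>' n) E)) (lift' E)"
    using div_conv_subseq[OF div_conv_lift[OF E] \<sigma>'] .
  have onE: "divisor_on (points K (lK n)) (push include_point (lift n E))" for n
  proof -
    interpret W: weighted_curve H "l n" w \<epsilon> by (rule curve)
    show ?thesis by (rule W.divisor_on_include[OF divisor_on_lift[OF E(1)]])
  qed
  let ?D' = "lift' E + Xl + Cl"
  have convD': "div_conv (\<lambda>n. push include_point (lift (\<sigma>' n) E) + X (\<sigma>' n) + C (\<sigma>' n)) ?D'"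
    by (intro div_conv_add convE convX convC)
  have onD': "divisor_on (closed_points K (lK n)) (push include_point (lift n E) + X n + C n)" for n
    by (intro closed divisor_on_add onE onX onC)
  have prin_lim: "principal K lK' (Dl - ?D')"
  proof (rule principal_limit[OF c.H K_connected _ _ convD convD'])
    show "0 < lK (\<sigma>' n) e" if "e \<in> arcs K" for n e using lK(1)[OF that] .
    show "(\<lambda>n. lK (\<sigma>' n) e) \<longlonglongrightarrow> lK' e" if "e \<in> arcs K" for e
      using LIMSEQ_subseq_LIMSEQ[OF lK(2)[OF that] \<sigma>'] by (simp add: o_def)
    show "keys (push include_point (D (\<sigma>' n))) \<subseteq> closed_points K (lK (\<sigma>' n))" for n
      using closed[OF onD] by (simp add: divisor_on_def)
    show "keys (push include_point (lift (\<sigma>' n) E) + X (\<sigma>' n) + C (\<sigma>' n)) \<subseteq> closed_points K (lK (\<sigma>' n))" for n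
      using onD' by (simp add: divisor_on_def)
    show "principal K (lK (\<sigma>' n)) (push include_point (D (\<sigma>' n)) -
        (push include_point (lift (\<sigma>' n) E) + X (\<sigma>' n) + C (\<sigma>' n)))" for n
      by (rule prin)
  qed auto
  have onD'l: "divisor_on (closed_points K lK') ?D'"
    using div_conv_closed[OF convD' onD' \<sigma>'] .
  have onXl: "divisor_on (closed_points K lK') Xl" using div_conv_closed[OF convX closed[OF onX] \<sigma>'] .
  have onCl: "divisor_on (closed_points K lK') Cl" using div_conv_closed[OF convC closed[OF onC] \<sigma>'] .
  have split: "lim_push ?D' = E + lim_push Xl + lim_push Cl"
    by (simp add: frag_extend_add lim_push_lift[OF E(1)])
  have "principal G m (lim_push Dl - lim_push ?D')"
    using principal_lim_push[OF divisor_on_diff[OF onDl onD'l] prin_lim] by (simp add: frag_extend_diff)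
  moreover have "effective (lim_push A - (\<Sum>x\<in>L. frag_of (Vert (fst x))))"
    if "effective A" "divisor_on (closed_points K lK') A"
      "\<And>u. u \<in> verts G \<Longrightarrow> int (card (?L u)) \<le> (\<Sum>e\<in>fibre_arcs u. on_edge_count e A)" for A
    by (rule c.effective_fibre_chips) (use that L fL in \<open>auto simp: divisor_on_def fibre_arcs_def\<close>)
  from this[OF _ onXl] this[OF _ onCl]
  \<comment> \<open>Counts on edges are constant along the convergent sequences, so the bounds at
    one index hold for the limits.\<close>
  have "effective (lim_push Xl - (\<Sum>x\<in>L. frag_of (Vert (fst x))))"
    "effective (lim_push Cl - (\<Sum>x\<in>L. frag_of (Vert (fst x))))"
    using div_conv_effective[OF convX] div_conv_effective[OF convC] countX[of _ "\<sigma>' 0"] countC[of _ "\<sigma>' 0"]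
    by (simp_all add: div_conv_count[OF convX] div_conv_count[OF convC])
  then have "effective (lim_push ?D' - (E + (\<Sum>x\<in>L. frag_of (Vert (fst x))) + (\<Sum>x\<in>L. frag_of (Vert (fst x)))))"
    unfolding split using effective_add by (fastforce simp: algebra_simps)
  ultimately show "\<exists>D'. divisor_on (points G m) D' \<and> principal G m (lim_push Dl - D') \<and>
      effective (D' - (E + (\<Sum>x\<in>L. frag_of (Vert (fst x))) + (\<Sum>x\<in>L. frag_of (Vert (fst x)))))"
    using divisor_on_lim_push[OF onD'l] by blast
qed

text \<open>Compactness is applied to the remainders \<open>D n - lift n E\<close> rather than to
  \<open>D n\<close>: the limit then contains the demand by construction, with its chips in the
  prescribed places.\<close>

theorem bn_property_limit:
  assumes P: "\<And>n. bn_property \<epsilon> r d k (H, w, l n)"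
  shows "bn_property \<epsilon> r d k (G, w', m)"
  unfolding bn_property_def prod.case contained_in_def
proof (intro allI impI, elim conjE)
  fix E :: "('u, 'f) point divisor"
  assume E: "divisor_on (points G m) E" "effective E" "deg E = k"
  have "\<exists>D. divisor_on (points H (l n)) D \<and> effective D \<and> deg D = int d \<and>
      int r \<le> rank \<epsilon> (H, w, l n) D \<and> effective (D - lift n E)" for n
    using P[of n] divisor_on_lift[OF E(1), of n] effective_push[OF E(2)] E(3)
    unfolding bn_property_def prod.case contained_in_def by (metis deg_push)
  then obtain D where D: "\<And>n. divisor_on (points H (l n)) (D n)" "\<And>n. deg (D n) = int d"
      "\<And>n. int r \<le> rank \<epsilon> (H, w, l n) (D n)" and DE: "\<And>n. effective (D n - lift n E)" by metis
  define R where "R n = push include_point (D n - lift n E)" for n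
  have onR: "divisor_on (points K (lK n)) (R n)" for n
  proof -
    interpret W: weighted_curve H "l n" w \<epsilon> by (rule curve)
    show ?thesis unfolding R_def
      by (intro W.divisor_on_include divisor_on_diff D divisor_on_lift E)
  qed
  then have onR': "divisor_on (closed_points K (lK n)) (R n)" for n
    by (rule divisor_on_mono[OF _ points_subset_closed_points])
  have effR: "effective (R n)" for n unfolding R_def by (rule effective_push[OF DE])
  have degR0: "deg (R n) = int d - k" for n
    by (simp add: R_def deg_push deg_diff D E(3))
  then have degR: "deg (R n) = int (nat (int d - k))" for n
    using effective_deg_nonneg[OF effR[of n]] by simp
  obtain B where B: "\<And>n e. e \<in> arcs K \<Longrightarrow> lK n e \<le> B e" using lK_bounded by blast
  obtain \<sigma> :: "nat \<Rightarrow> nat" and Rl where \<sigma>: "strict_mono \<sigma>" "div_conv (\<lambda>n. R (\<sigma> n)) Rl"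
    by (rule div_conv_compact[OF c.H, of lK B R "nat (int d - k)"])
      (use B onR' effR degR in \<open>auto simp: divisor_on_def\<close>)
  have "div_conv (\<lambda>n. push include_point (lift (\<sigma> n) E) + R (\<sigma> n)) (lift' E + Rl)"
    by (intro div_conv_add \<sigma>(2) div_conv_subseq[OF div_conv_lift[OF E(1,2)] \<sigma>(1)])
  then have conv: "div_conv (\<lambda>n. push include_point (D (\<sigma> n))) (lift' E + Rl)"
    by (simp add: R_def frag_extend_diff)
  let ?D = "lim_push (lift' E + Rl)"
  have D_eq: "?D = E + lim_push Rl" by (simp add: frag_extend_add lim_push_lift[OF E(1)])
  have Rl: "effective Rl" "divisor_on (closed_points K lK') Rl" "deg Rl = int d - k"
    using div_conv_effective[OF \<sigma>(2), of 0] div_conv_closed[OF \<sigma>(2) onR' \<sigma>(1)] degR0 by auto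
  have eff: "effective (lim_push Rl)" by (intro effective_push Rl)
  have "divisor_on (points G m) ?D"
    unfolding D_eq by (intro divisor_on_add E divisor_on_lim_push Rl)
  moreover have "effective ?D" "effective (?D - E)"
    unfolding D_eq using eff E(2) by (simp_all add: effective_add)
  moreover have "deg ?D = int d" unfolding D_eq by (simp add: deg_add deg_push E(3) Rl(3))
  moreover have "int r \<le> rank \<epsilon> (G, w', m) ?D"
    by (rule rank_limit[OF D \<sigma>(1) conv])
  ultimately show "\<exists>D. divisor_on (points G m) D \<and> effective D \<and> deg D = int d \<and>
      int r \<le> rank \<epsilon> (G, w', m) D \<and> effective (D - E)" by blast
qed

end

section \<open>Isomorphism invariance\<close>

definition good_curve :: "('v, 'e) trop_curve \<Rightarrow> bool" where
  "good_curve \<Gamma> \<longleftrightarrow> (case \<Gamma> of (G, w, l) \<Rightarrow> fin_digraph G \<and> verts G \<noteq> {} \<and>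
     (\<forall>u\<in>verts G. \<forall>v\<in>verts G. (u, v) \<in> (link G (arcs G))\<^sup>*) \<and> (\<forall>e\<in>arcs G. 0 < l e))"

lemma good_curve_bn_rank:
  assumes "good_curve \<Gamma>" "0 < \<epsilon>"
  shows "- 1 \<le> bn_rank \<epsilon> r d \<Gamma>"
    and "int k \<le> bn_rank \<epsilon> r d \<Gamma> \<longleftrightarrow> bn_property \<epsilon> r d (int r + int k) \<Gamma>"
proof -
  obtain G w l where \<Gamma>: "\<Gamma> = (G, w, l)" by (cases \<Gamma>)
  interpret weighted_curve G l w \<epsilon>
    by (rule weighted_curve.intro) (use assms in \<open>auto simp: \<Gamma> good_curve_def
      intro!: pure_curve.intro weighted_curve_axioms.intro\<close>)
  show "- 1 \<le> bn_rank \<epsilon> r d \<Gamma>" unfolding \<Gamma> by (rule bn_rank_ge)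
  show "int k \<le> bn_rank \<epsilon> r d \<Gamma> \<longleftrightarrow> bn_property \<epsilon> r d (int r + int k) \<Gamma>"
    unfolding \<Gamma> by (rule bn_rank_ge)
qed

lemma wgraph_iso_inverse:
  assumes G: "fin_digraph G" and iso: "wgraph_iso G w H u \<phi> \<psi>"
  shows "wgraph_iso H u G w (inv_into (verts G) \<phi>) (inv_into (arcs G) \<psi>)"
proof -
  interpret G: fin_digraph G by fact
  have \<phi>: "bij_betw \<phi> (verts G) (verts H)" and \<psi>: "bij_betw \<psi> (arcs G) (arcs H)"
    using iso by (auto simp: wgraph_iso_def)
  have ends: "{tail H (\<psi> x), head H (\<psi> x)} = {\<phi> (tail G x), \<phi> (head G x)}" if "x \<in> arcs G" for x
    using iso that unfolding wgraph_iso_def by blast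
  let ?\<phi> = "inv_into (verts G) \<phi>" and ?\<psi> = "inv_into (arcs G) \<psi>"
  show ?thesis
    unfolding wgraph_iso_def
  proof (intro conjI ballI)
    show "bij_betw ?\<phi> (verts H) (verts G)" "bij_betw ?\<psi> (arcs H) (arcs G)"
      using bij_betw_inv_into \<phi> \<psi> by auto
    fix e assume "e \<in> arcs H"
    then have e: "?\<psi> e \<in> arcs G" "\<psi> (?\<psi> e) = e"
      using bij_betw_inv_into_right[OF \<psi>] bij_betwE[OF bij_betw_inv_into[OF \<psi>]] by auto
    then have "{tail H e, head H e} = {\<phi> (tail G (?\<psi> e)), \<phi> (head G (?\<psi> e))}"
      using ends[OF e(1)] by (simp only: e(2))
    then have "?\<phi> ` {tail H e, head H e} = ?\<phi> ` {\<phi> (tail G (?\<psi> e)), \<phi> (head G (?\<psi> e))}" by simp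
    then show "{tail G (?\<psi> e), head G (?\<psi> e)} = {?\<phi> (tail H e), ?\<phi> (head H e)}"
      using e(1) by (simp add: bij_betw_inv_into_left[OF \<phi>])
  next
    fix v assume "v \<in> verts H"
    then have "?\<phi> v \<in> verts G" "\<phi> (?\<phi> v) = v"
      using bij_betw_inv_into_right[OF \<phi>] bij_betwE[OF bij_betw_inv_into[OF \<phi>]] by auto
    then show "w (?\<phi> v) = u v" using iso unfolding wgraph_iso_def by metis
  qed
qed

lemma bn_property_iso:
  assumes \<epsilon>: "0 < \<epsilon>" and good: "good_curve (G, w, l)" "good_curve (H, u, m)"
    and iso: "wgraph_iso G w H u \<phi> \<psi>" and len: "\<And>e. e \<in> arcs G \<Longrightarrow> m (\<psi> e) = l e"
    and P: "bn_property \<epsilon> r d k (G, w, l)"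
  shows "bn_property \<epsilon> r d k (H, u, m)"
proof -
  let ?\<psi> = "inv_into (arcs G) \<psi>"
  have \<phi>: "bij_betw \<phi> (verts G) (verts H)" and \<psi>: "bij_betw \<psi> (arcs G) (arcs H)"
    using iso by (auto simp: wgraph_iso_def)
  have ends: "{tail H (\<psi> x), head H (\<psi> x)} = {\<phi> (tail G x), \<phi> (head G x)}" if "x \<in> arcs G" for x
    using iso that unfolding wgraph_iso_def by blast
  have im: "?\<psi> ` arcs H = arcs G" using bij_betw_inv_into[OF \<psi>] by (simp add: bij_betw_def)
  have e: "?\<psi> e \<in> arcs G" "\<psi> (?\<psi> e) = e" if "e \<in> arcs H" for e
    using that bij_betw_inv_into_right[OF \<psi>] bij_betwE[OF bij_betw_inv_into[OF \<psi>]] by auto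
  \<comment> \<open>Surviving edges are indexed by the target, hence the inverse of
    \<open>\<psi>\<close>. Nothing is collapsed, every fibre is one vertex, and the weight bound
    becomes \<open>u v \<le> w a + 0 - 1 + 1\<close>.\<close>
  interpret degeneration G H \<phi> ?\<psi> "\<lambda>_. l" l m w u \<epsilon>
  proof (intro degeneration.intro contraction.intro degeneration_axioms.intro)
    show "\<phi> ` verts G = verts H" using \<phi> by (simp add: bij_betw_def)
    show "inj_on ?\<psi> (arcs H)" using bij_betw_inv_into[OF \<psi>] by (simp add: bij_betw_def)
    show "{tail H e, head H e} = {\<phi> (tail G (?\<psi> e)), \<phi> (head G (?\<psi> e))}" if "e \<in> arcs H" for e
      using ends[OF e(1)[OF that]] by (simp only: e(2)[OF that])
    show "(a, b) \<in> (link G (arcs G - ?\<psi> ` arcs H))\<^sup>*" if "a \<in> verts G" "b \<in> verts G" "\<phi> a = \<phi> b" for a b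
      using \<phi> that by (auto simp: bij_betw_def inj_on_def)
    show "l (?\<psi> e) = m e" if "e \<in> arcs H" for e
      using len[OF e(1)[OF that]] e(2)[OF that] by simp
    show "u v = 0 \<or> int (u v) \<le> (\<Sum>v\<in>{a \<in> verts G. \<phi> a = v}. int (w v)) +
        int (card {e \<in> arcs G - ?\<psi> ` arcs H. \<phi> (tail G e) = v}) - int (card {a \<in> verts G. \<phi> a = v}) + 1"
      if v: "v \<in> verts H" for v
    proof -
      obtain a where a: "a \<in> verts G" "\<phi> a = v"
        using v unfolding bij_betw_imp_surj_on[OF \<phi>, symmetric] by auto
      then have "{a \<in> verts G. \<phi> a = v} = {a}" using \<phi> by (auto simp: bij_betw_def inj_on_def)
      moreover have "u v = w a" using iso a by (auto simp: wgraph_iso_def)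
      ultimately show ?thesis by simp
    qed
  qed (use good \<epsilon> im in \<open>auto simp: good_curve_def\<close>)
  show ?thesis by (rule bn_property_limit) (rule P)
qed

text \<open>Ranks are at least -1, so they are determined by the nonnegative thresholds they
  reach.\<close>

lemma bn_rank_iso:
  assumes \<epsilon>: "0 < \<epsilon>" and good: "good_curve \<Gamma>" "good_curve \<Delta>" and iso: "trop_isomorphic \<Gamma> \<Delta>"
  shows "bn_rank \<epsilon> r d \<Gamma> = bn_rank \<epsilon> r d \<Delta>"
proof -
  obtain G w l where \<Gamma>: "\<Gamma> = (G, w, l)" by (cases \<Gamma>)
  obtain H u m where \<Delta>: "\<Delta> = (H, u, m)" by (cases \<Delta>)
  obtain \<phi> \<psi> where iso': "wgraph_iso G w H u \<phi> \<psi>" "\<And>e. e \<in> arcs G \<Longrightarrow> m (\<psi> e) = l e"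
    using iso by (auto simp: \<Gamma> \<Delta>)
  have G: "fin_digraph G" using good(1) by (simp add: \<Gamma> good_curve_def)
  have \<psi>: "bij_betw \<psi> (arcs G) (arcs H)" using iso' by (simp add: wgraph_iso_def)
  have len: "l (inv_into (arcs G) \<psi> e) = m e" if "e \<in> arcs H" for e
    using that iso'(2) bij_betw_inv_into_right[OF \<psi>] bij_betwE[OF bij_betw_inv_into[OF \<psi>]] by metis
  have "bn_property \<epsilon> r d k \<Gamma> = bn_property \<epsilon> r d k \<Delta>" for k
    unfolding \<Gamma> \<Delta>
    using bn_property_iso[OF \<epsilon> good[unfolded \<Gamma> \<Delta>] iso']
      bn_property_iso[OF \<epsilon> good(2)[unfolded \<Delta>] good(1)[unfolded \<Gamma>] wgraph_iso_inverse[OF G iso'(1)] len]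
    by blast
  then have *: "int k \<le> bn_rank \<epsilon> r d \<Gamma> \<longleftrightarrow> int k \<le> bn_rank \<epsilon> r d \<Delta>" for k
    by (simp add: good_curve_bn_rank(2)[OF good(1) \<epsilon>] good_curve_bn_rank(2)[OF good(2) \<epsilon>])
  have ge: "- 1 \<le> bn_rank \<epsilon> r d \<Gamma>" "- 1 \<le> bn_rank \<epsilon> r d \<Delta>"
    using good_curve_bn_rank(1)[OF good(1) \<epsilon>] good_curve_bn_rank(1)[OF good(2) \<epsilon>] by blast+
  show ?thesis
    using *[of "nat (bn_rank \<epsilon> r d \<Gamma>)"] *[of "nat (bn_rank \<epsilon> r d \<Delta>)"] ge by linarith
qed


section \<open>Contracting the edges of length zero\<close>

definition zero_arcs :: "('v, 'e) pre_digraph \<Rightarrow> ('e \<Rightarrow> real) \<Rightarrow> 'e set" where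
  "zero_arcs G s = {e \<in> arcs G. s e = 0}"

text \<open>Library reachability is reflexive at vertices only; starting at a vertex makes it agree
  with the plain reflexive transitive closure used elsewhere.\<close>

lemma mk_symmetric_reachable:
  assumes H: "wf_digraph H" and u: "u \<in> verts H"
  shows "reachable (with_proj (mk_symmetric H)) u v \<longleftrightarrow> (u, v) \<in> (link H (arcs H))\<^sup>*"
proof -
  interpret wf_digraph H by fact
  have link: "parcs (mk_symmetric H) = link H (arcs H)" by (simp add: parcs_mk_symmetric link_def)
  have "(u, v) \<in> rtrancl_on (verts H) (link H (arcs H)) \<longleftrightarrow> (u, v) \<in> (link H (arcs H))\<^sup>*"
  proof
    assume "(u, v) \<in> rtrancl_on (verts H) (link H (arcs H))"
    then show "(u, v) \<in> (link H (arcs H))\<^sup>*"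
      by (induction rule: rtrancl_on_induct) (auto intro: rtrancl_into_rtrancl)
  next
    assume "(u, v) \<in> (link H (arcs H))\<^sup>*"
    then show "(u, v) \<in> rtrancl_on (verts H) (link H (arcs H))"
    proof (induction rule: rtrancl_induct)
      case (step y z)
      then have "z \<in> verts H" by (auto simp: link_def)
      with step show ?case by (auto intro: rtrancl_on_into_rtrancl_on)
    qed (simp add: u)
  qed
  then show ?thesis by (simp add: reachable_def link)
qed

lemma zero_component_eq:
  assumes G: "wf_digraph G" and v: "v \<in> verts G"
  shows "zero_component G s v = {u. (v, u) \<in> (link G (zero_arcs G s))\<^sup>*}"
proof -
  interpret wf_digraph G by fact
  have "wf_digraph (zero_subgraph G s)" by unfold_locales (auto simp: zero_subgraph_def)
  moreover have "link (zero_subgraph G s) (arcs (zero_subgraph G s)) = link G (zero_arcs G s)"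
    by (simp add: link_def zero_subgraph_def zero_arcs_def)
  ultimately show ?thesis
    using mk_symmetric_reachable[of "zero_subgraph G s" v] v
    by (simp add: zero_component_def zero_subgraph_def)
qed

lemma connected_link:
  assumes "wf_digraph G" "Digraph_Component.connected G"
  shows "verts G \<noteq> {}" "u \<in> verts G \<Longrightarrow> v \<in> verts G \<Longrightarrow> (u, v) \<in> (link G (arcs G))\<^sup>*"
  using assms(2) mk_symmetric_reachable[OF assms(1), of u v]
  by (auto simp: Digraph_Component.connected_def strongly_connected_def)

locale graph_family =
  fixes G :: "('v, 'e) pre_digraph" and w :: "'v \<Rightarrow> nat"
  assumes G: "fin_digraph G" and conn: "Digraph_Component.connected G"
begin

sublocale fin_digraph G by (rule G)

abbreviation "zcomp \<equiv> zero_component G"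

lemma comp_eq_iff:
  assumes "u \<in> verts G" "v \<in> verts G"
  shows "zcomp s u = zcomp s v \<longleftrightarrow> (u, v) \<in> (link G (zero_arcs G s))\<^sup>*"
proof -
  have *: "zcomp s u = {x. (u, x) \<in> (link G (zero_arcs G s))\<^sup>*}" "zcomp s v = {x. (v, x) \<in> (link G (zero_arcs G s))\<^sup>*}"
    using assms by (auto simp: zero_component_eq wf_digraph)
  show ?thesis
  proof
    assume "zcomp s u = zcomp s v"
    moreover have "v \<in> zcomp s v" by (simp add: *)
    ultimately have "v \<in> zcomp s u" by simp
    then show "(u, v) \<in> (link G (zero_arcs G s))\<^sup>*" by (simp add: *)
  next
    assume uv: "(u, v) \<in> (link G (zero_arcs G s))\<^sup>*"
    show "zcomp s u = zcomp s v"
      unfolding * using rtrancl_trans[OF uv] rtrancl_trans[OF link_rtrancl_sym[OF uv]] by blast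
  qed
qed

lemma comp_subset: "v \<in> verts G \<Longrightarrow> zcomp s v \<subseteq> verts G"
proof
  fix u assume v: "v \<in> verts G" and "u \<in> zcomp s v"
  then have "(v, u) \<in> (link G (zero_arcs G s))\<^sup>*" by (simp add: zero_component_eq wf_digraph)
  then show "u \<in> verts G"
    by (induction rule: rtrancl_induct) (use v in \<open>auto simp: link_def zero_arcs_def\<close>)
qed

lemma comp_self: "v \<in> verts G \<Longrightarrow> v \<in> zcomp s v"
  by (simp add: zero_component_eq wf_digraph)

lemma mem_comp_iff:
  assumes "v \<in> verts G"
  shows "u \<in> zcomp s v \<longleftrightarrow> u \<in> verts G \<and> zcomp s u = zcomp s v"
proof
  assume u: "u \<in> zcomp s v"
  then have "u \<in> verts G" using comp_subset[OF assms] by auto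
  then show "u \<in> verts G \<and> zcomp s u = zcomp s v"
    using u comp_eq_iff[OF assms, of u s] assms by (auto simp: zero_component_eq wf_digraph)
next
  assume "u \<in> verts G \<and> zcomp s u = zcomp s v"
  then show "u \<in> zcomp s v" using comp_self by blast
qed

lemma zero_arc_comp: "e \<in> zero_arcs G s \<Longrightarrow> zcomp s (tail G e) = zcomp s (head G e)"
  by (subst comp_eq_iff) (auto simp: zero_arcs_def link_def)

lemma contract_simps [simp]:
  "verts (fst (contract G w s)) = zcomp s ` verts G"
  "arcs (fst (contract G w s)) = arcs G - zero_arcs G s"
  "tail (fst (contract G w s)) e = zcomp s (tail G e)"
  "head (fst (contract G w s)) e = zcomp s (head G e)"
  by (auto simp: contract_def zero_arcs_def)

text \<open>Both ends of an edge of length 0 lie in one component, so counting tails counts the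
  edges of the induced subgraph.\<close>

lemma genus_component:
  assumes v: "v \<in> verts G"
  shows "genus (zero_subgraph G s \<restriction> zcomp s v) w =
    int (card {e \<in> zero_arcs G s. tail G e \<in> zcomp s v}) - int (card (zcomp s v)) + 1 + (\<Sum>u\<in>zcomp s v. int (w u))"
proof -
  have "head G e \<in> zcomp s v" if "e \<in> zero_arcs G s" "tail G e \<in> zcomp s v" for e
    using that zero_arc_comp[of e s] by (auto simp: mem_comp_iff[OF v] zero_arcs_def)
  then have "arcs (zero_subgraph G s \<restriction> zcomp s v) = {e \<in> zero_arcs G s. tail G e \<in> zcomp s v}"
    by (auto simp: zero_subgraph_def zero_arcs_def)
  then show ?thesis by (simp add: genus_def)
qed

text \<open>Edges of length 0 become stationary steps and the others survive. A general
  \<open>F\<close> serves both for connectedness and for the fibres of a further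
  contraction.\<close>

lemma contracted_path:
  assumes "(u, v) \<in> (link G F)\<^sup>*" "F \<subseteq> arcs G"
  shows "(zcomp s u, zcomp s v) \<in> (link (fst (contract G w s)) (F - zero_arcs G s))\<^sup>*"
  using assms(1)
proof (induction rule: rtrancl_induct)
  case (step x y)
  then obtain e where e: "e \<in> F" "(x, y) \<in> link G {e}" by (auto simp: link_def)
  show ?case
  proof (cases "e \<in> zero_arcs G s")
    case True
    then have "zcomp s x = zcomp s y" using e zero_arc_comp[OF True] by (auto simp: link_def)
    then show ?thesis using step.IH by simp
  next
    case False
    then have "(zcomp s x, zcomp s y) \<in> link (fst (contract G w s)) (F - zero_arcs G s)"
      using e by (auto simp: link_def)
    with step.IH show ?thesis by (rule rtrancl_into_rtrancl)
  qed
qed simp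

lemma fin_digraph_contract: "fin_digraph (fst (contract G w s))"
  by unfold_locales auto

lemma contract_connected:
  assumes "a \<in> verts (fst (contract G w s))" "b \<in> verts (fst (contract G w s))"
  shows "(a, b) \<in> (link (fst (contract G w s)) (arcs (fst (contract G w s))))\<^sup>*"
proof -
  obtain u v where uv: "a = zcomp s u" "b = zcomp s v" "u \<in> verts G" "v \<in> verts G" using assms by auto
  then show ?thesis
    using contracted_path[OF connected_link(2)[OF wf_digraph conn uv(3,4)] subset_refl, of s] by simp
qed

lemma contract_eq: "contract G w s = (fst (contract G w s), fst (snd (contract G w s)), s)"
  by (simp add: contract_def)

lemma good_contract:
  assumes "\<And>e. e \<in> arcs G \<Longrightarrow> 0 \<le> s e"
  shows "good_curve (contract G w s)"
  unfolding good_curve_def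
  by (subst contract_eq)
    (use fin_digraph_contract contract_connected connected_link(1)[OF wf_digraph conn] assms in
      \<open>auto simp: zero_arcs_def order_less_le\<close>)

lemma contract_weight:
  assumes "v \<in> verts G"
  shows "fst (snd (contract G w s)) (zcomp s v) =
    nat (int (card {e \<in> zero_arcs G s. tail G e \<in> zcomp s v}) - int (card (zcomp s v)) + 1 +
      (\<Sum>u\<in>zcomp s v. int (w u)))"
  by (simp add: contract_def genus_component[OF assms])

end

section \<open>Contraction in stages and under automorphisms\<close>

context graph_family
begin

text \<open>Graph and weights depend on \<open>s\<close> only through the vanishing edges, so all
  curves of a sequence in one stratum share one graph.\<close>

lemma contract_cong:
  assumes "zero_arcs G s = zero_arcs G s'"
  shows "contract G w s = (fst (contract G w s'), fst (snd (contract G w s')), s)"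
proof -
  have "zero_subgraph G s = zero_subgraph G s'"
    using assms by (simp add: zero_subgraph_def zero_arcs_def)
  moreover from this have "zero_component G s = zero_component G s'"
    by (simp add: zero_component_def fun_eq_iff)
  moreover have "{e \<in> arcs G. s e \<noteq> 0} = {e \<in> arcs G. s' e \<noteq> 0}"
    using assms by (auto simp: zero_arcs_def)
  ultimately show ?thesis by (simp add: contract_def)
qed

lemma zcomp_coarser:
  assumes "zero_arcs G s' \<subseteq> zero_arcs G s" "u \<in> verts G" "v \<in> verts G" "zcomp s' u = zcomp s' v"
  shows "zcomp s u = zcomp s v"
  using assms(4) rtrancl_mono[OF link_mono[OF assms(1), of G]] by (auto simp: comp_eq_iff assms(2,3))

text \<open>Genus is additive for contraction in two stages: edges, vertices and weights of the
  parts of \<open>C\<close> add up, and each part becomes a vertex. Truncation to natural numbers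
  can only increase the weights of the parts, hence the direction of the inequality.\<close>

lemma contract_weight_le:
  assumes sub: "zero_arcs G s' \<subseteq> zero_arcs G s" and v: "v \<in> verts G"
  defines "C \<equiv> zcomp s v"
  shows "fst (snd (contract G w s)) C = 0 \<or>
    int (fst (snd (contract G w s)) C) \<le> (\<Sum>B\<in>zcomp s' ` C. int (fst (snd (contract G w s')) B)) +
      int (card {e \<in> zero_arcs G s - zero_arcs G s'. tail G e \<in> C}) - int (card (zcomp s' ` C)) + 1"
proof -
  have CG: "C \<subseteq> verts G" using comp_subset[OF v] by (simp add: C_def)
  have finC: "finite C" using CG by (rule finite_subset) simp
  have mem: "u \<in> C \<longleftrightarrow> u \<in> verts G \<and> zcomp s u = C" for u
    unfolding C_def by (rule mem_comp_iff[OF v])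
  \<comment> \<open>Components for \<open>s\<close> are unions of components for \<open>s'\<close>,
    as more edges vanish.\<close>
  have part: "{x \<in> C. zcomp s' x = B} = B" if B: "B \<in> zcomp s' ` C" for B
  proof -
    obtain u where u: "u \<in> C" "B = zcomp s' u" using B by auto
    then have uG: "u \<in> verts G" using CG by auto
    have "x \<in> C" if "x \<in> B" for x
    proof -
      have x: "x \<in> verts G" "zcomp s' x = zcomp s' u" using that mem_comp_iff[OF uG] u(2) by auto
      then have "zcomp s x = zcomp s u" using zcomp_coarser[OF sub x(1) uG] by simp
      then show "x \<in> C" using x(1) u(1) mem by simp
    qed
    then show ?thesis using mem_comp_iff[OF uG] u(2) CG by auto
  qed
  have grp: "(\<Sum>B\<in>zcomp s' ` C. \<Sum>x\<in>B. h x) = (\<Sum>x\<in>C. h x)" for h :: "'v \<Rightarrow> int"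
  proof -
    have "(\<Sum>B\<in>zcomp s' ` C. \<Sum>x\<in>B. h x) = (\<Sum>B\<in>zcomp s' ` C. \<Sum>x\<in>{x \<in> C. zcomp s' x = B}. h x)"
      using part by (intro sum.cong) auto
    also have "\<dots> = (\<Sum>x\<in>C. h x)" using finC by (intro sum.group) auto
    finally show ?thesis .
  qed
  let ?E = "\<lambda>B. {e \<in> zero_arcs G s'. tail G e \<in> B}"
  have finE: "finite (?E B)" for B by (rule finite_subset[OF _ finite_arcs]) (auto simp: zero_arcs_def)
  have "(\<Sum>B\<in>zcomp s' ` C. card (?E B)) = (\<Sum>B\<in>zcomp s' ` C. \<Sum>e\<in>{e \<in> ?E C. zcomp s' (tail G e) = B}. 1)"
  proof (rule sum.cong)
    fix B assume B: "B \<in> zcomp s' ` C"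
    have "?E B = {e \<in> ?E C. zcomp s' (tail G e) = B}" using part[OF B] by blast
    then show "card (?E B) = (\<Sum>e\<in>{e \<in> ?E C. zcomp s' (tail G e) = B}. 1)" by simp
  qed simp
  also have "\<dots> = (\<Sum>e\<in>?E C. 1)" using finE finC by (intro sum.group) auto
  finally have cardE: "(\<Sum>B\<in>zcomp s' ` C. card (?E B)) = card (?E C)" by simp
  have "(\<Sum>B\<in>zcomp s' ` C. int (card (?E B)) - int (card B) + 1 + (\<Sum>x\<in>B. int (w x))) \<le>
      (\<Sum>B\<in>zcomp s' ` C. int (fst (snd (contract G w s')) B))"
  proof (rule sum_mono)
    fix B assume "B \<in> zcomp s' ` C"
    then obtain u where u: "u \<in> verts G" "B = zcomp s' u" using CG by auto
    show "int (card (?E B)) - int (card B) + 1 + (\<Sum>x\<in>B. int (w x)) \<le> int (fst (snd (contract G w s')) B)"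
      unfolding u(2) contract_weight[OF u(1)] by linarith
  qed
  also have "(\<Sum>B\<in>zcomp s' ` C. int (card (?E B)) - int (card B) + 1 + (\<Sum>x\<in>B. int (w x))) =
      int (card (?E C)) - int (card C) + int (card (zcomp s' ` C)) + (\<Sum>x\<in>C. int (w x))"
    using grp[of "\<lambda>_. 1"] grp[of "\<lambda>x. int (w x)"] cardE
    by (simp add: sum.distrib sum_subtractf of_nat_sum[symmetric] del: of_nat_sum)
  finally have 1: "int (card (?E C)) - int (card C) + int (card (zcomp s' ` C)) + (\<Sum>x\<in>C. int (w x)) \<le>
      (\<Sum>B\<in>zcomp s' ` C. int (fst (snd (contract G w s')) B))" .
  have "{e \<in> zero_arcs G s. tail G e \<in> C} = ?E C \<union> {e \<in> zero_arcs G s - zero_arcs G s'. tail G e \<in> C}"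
    using sub by auto
  moreover have "card (?E C \<union> {e \<in> zero_arcs G s - zero_arcs G s'. tail G e \<in> C}) =
      card (?E C) + card {e \<in> zero_arcs G s - zero_arcs G s'. tail G e \<in> C}"
    by (rule card_Un_disjoint[OF finE]) (auto intro: finite_subset[OF _ finite_arcs] simp: zero_arcs_def)
  ultimately have "card {e \<in> zero_arcs G s. tail G e \<in> C} =
      card (?E C) + card {e \<in> zero_arcs G s - zero_arcs G s'. tail G e \<in> C}" by simp
  with 1 show ?thesis unfolding C_def contract_weight[OF v] by (simp add: nat_eq_iff)
qed

text \<open>All curves of the sequence live on the contraction for \<open>s'\<close>, with positive
  lengths. More edges may vanish in the limit, and the contraction for \<open>s\<close> is then a
  degeneration of that graph.\<close>

lemma bn_property_contract_limit:
  assumes \<epsilon>: "0 < \<epsilon>" and S: "\<And>n e. e \<in> arcs G \<Longrightarrow> 0 \<le> S n e"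
    and lim: "\<And>e. e \<in> arcs G \<Longrightarrow> (\<lambda>n. S n e) \<longlonglongrightarrow> s e"
    and zero: "\<And>n. zero_arcs G (S n) = zero_arcs G (S 0)"
    and P: "\<And>n. bn_property \<epsilon> r d k (contract G w (S n))"
  shows "bn_property \<epsilon> r d k (contract G w s)"
proof -
  define s' where "s' = S 0"
  have zero': "zero_arcs G (S n) = zero_arcs G s'" for n using zero by (simp add: s'_def)
  have s: "0 \<le> s e" if "e \<in> arcs G" for e
    by (rule LIMSEQ_le_const[OF lim[OF that]]) (use S[OF that] in auto)
  have sub: "zero_arcs G s' \<subseteq> zero_arcs G s"
  proof
    fix e assume e: "e \<in> zero_arcs G s'"
    then have "e \<in> zero_arcs G (S n)" for n by (simp add: zero')
    then have "S n e = 0" for n by (simp add: zero_arcs_def)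
    moreover have "e \<in> arcs G" using e by (simp add: zero_arcs_def)
    ultimately show "e \<in> zero_arcs G s"
      using lim[of e] LIMSEQ_unique[of "\<lambda>_. 0 :: real" "s e" 0] by (simp add: zero_arcs_def)
  qed
  let ?A = "fst (contract G w s')" and ?B = "fst (contract G w s)"
  \<comment> \<open>Any member represents the finer component, since equality of components persists
    when more edges vanish.\<close>
  define \<pi> where "\<pi> C = zcomp s (SOME v. v \<in> C)" for C
  have \<pi>: "\<pi> (zcomp s' v) = zcomp s v" if v: "v \<in> verts G" for v
  proof -
    let ?u = "SOME u. u \<in> zcomp s' v"
    have "?u \<in> zcomp s' v" using comp_self[OF v] by (rule someI)
    then have "?u \<in> verts G" "zcomp s' ?u = zcomp s' v" using mem_comp_iff[OF v] by auto
    then show ?thesis unfolding \<pi>_def by (intro zcomp_coarser[OF sub]) (use v in auto)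
  qed
  have collapsed: "arcs ?A - (\<lambda>e. e) ` arcs ?B = zero_arcs G s - zero_arcs G s'"
    using sub by (auto simp: zero_arcs_def)
  interpret degeneration ?A ?B \<pi> "\<lambda>e. e" S s s "fst (snd (contract G w s'))" "fst (snd (contract G w s))" \<epsilon>
  proof (intro degeneration.intro contraction.intro degeneration_axioms.intro)
    show "fin_digraph ?A" "fin_digraph ?B" by (rule fin_digraph_contract)+
    show "\<pi> ` verts ?A = verts ?B" using \<pi> by (auto simp: image_image)
    show "inj_on (\<lambda>e. e) (arcs ?B)" by simp
    show "(\<lambda>e. e) ` arcs ?B \<subseteq> arcs ?A" using sub by auto
    show "{tail ?B e, head ?B e} = {\<pi> (tail ?A e), \<pi> (head ?A e)}" if "e \<in> arcs ?B" for e
      using that by (simp add: \<pi>)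
    show "\<pi> (tail ?A e) = \<pi> (head ?A e)" if "e \<in> arcs ?A - (\<lambda>e. e) ` arcs ?B" for e
      using that zero_arc_comp[of e s] unfolding collapsed by (auto simp: \<pi> zero_arcs_def)
    show "(a, b) \<in> (link ?A (arcs ?A - (\<lambda>e. e) ` arcs ?B))\<^sup>*"
      if ab: "a \<in> verts ?A" "b \<in> verts ?A" "\<pi> a = \<pi> b" for a b
    proof -
      obtain u v where uv: "a = zcomp s' u" "b = zcomp s' v" "u \<in> verts G" "v \<in> verts G" using ab by auto
      then have "(u, v) \<in> (link G (zero_arcs G s))\<^sup>*" using ab(3) \<pi> comp_eq_iff by simp
      from contracted_path[OF this, of s'] show ?thesis
        unfolding collapsed uv by (auto simp: zero_arcs_def)
    qed
    show "(a, b) \<in> (link ?A (arcs ?A))\<^sup>*" if "a \<in> verts ?A" "b \<in> verts ?A" for a b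
      using that by (rule contract_connected)
    show "verts ?A \<noteq> {}" using connected_link(1)[OF wf_digraph conn] by simp
    show "0 < S n e" if "e \<in> arcs ?A" for n e
      using that S[of e n] zero'[of n] by (auto simp: zero_arcs_def order_less_le)
    show "(\<lambda>n. S n e) \<longlonglongrightarrow> s e" if "e \<in> arcs ?A" for e using that lim by simp
    show "0 < s e" if "e \<in> arcs ?B" for e
      using that s[of e] by (auto simp: zero_arcs_def order_less_le)
    show "s e = 0" if "e \<in> arcs ?A - (\<lambda>e. e) ` arcs ?B" for e
      using that unfolding collapsed by (simp add: zero_arcs_def)
    show "fst (snd (contract G w s)) C = 0 \<or> int (fst (snd (contract G w s)) C) \<le>
        (\<Sum>B\<in>{B \<in> verts ?A. \<pi> B = C}. int (fst (snd (contract G w s')) B)) +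
        int (card {e \<in> arcs ?A - (\<lambda>e. e) ` arcs ?B. \<pi> (tail ?A e) = C}) -
        int (card {B \<in> verts ?A. \<pi> B = C}) + 1" if "C \<in> verts ?B" for C
    proof -
      obtain v where v: "v \<in> verts G" "C = zcomp s v" using \<open>C \<in> verts ?B\<close> by auto
      have mem: "u \<in> C \<longleftrightarrow> u \<in> verts G \<and> zcomp s u = C" for u
        unfolding v(2) by (rule mem_comp_iff[OF v(1)])
      have "{B \<in> verts ?A. \<pi> B = C} = zcomp s' ` C" using \<pi> mem by auto
      moreover have "{e \<in> arcs ?A - (\<lambda>e. e) ` arcs ?B. \<pi> (tail ?A e) = C} =
          {e \<in> zero_arcs G s - zero_arcs G s'. tail G e \<in> C}"
        unfolding collapsed using \<pi> mem by (auto simp: zero_arcs_def)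
      ultimately show ?thesis using contract_weight_le[OF sub v(1)] v(2) by simp
    qed
  qed (simp_all add: \<epsilon>)
  have "bn_property \<epsilon> r d k (?B, fst (snd (contract G w s)), s)"
  proof (rule bn_property_limit)
    show "bn_property \<epsilon> r d k (?A, fst (snd (contract G w s')), S n)" for n
      using P[of n] unfolding contract_cong[OF zero'[of n]] .
  qed
  then show ?thesis by (simp only: contract_eq[of s, symmetric])
qed

text \<open>As \<open>s \<circ> \<psi>\<close> vanishes on \<open>e\<close> exactly when
  \<open>s\<close> vanishes on \<open>\<psi> e\<close>, components correspond under
  \<open>\<phi>\<close>; this makes the curves of one orbit isomorphic.\<close>

lemma contract_automorphism:
  assumes iso: "wgraph_iso G w G w \<phi> \<psi>"
  shows "trop_isomorphic (contract G w (restrict (s \<circ> \<psi>) (arcs G))) (contract G w s)"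
proof -
  define t where "t = restrict (s \<circ> \<psi>) (arcs G)"
  have \<phi>: "bij_betw \<phi> (verts G) (verts G)" and \<psi>: "bij_betw \<psi> (arcs G) (arcs G)"
    and ends: "\<And>e. e \<in> arcs G \<Longrightarrow> {tail G (\<psi> e), head G (\<psi> e)} = {\<phi> (tail G e), \<phi> (head G e)}"
    and weight: "\<And>v. v \<in> verts G \<Longrightarrow> w (\<phi> v) = w v"
    using iso by (auto simp: wgraph_iso_def)
  have \<phi>V: "\<phi> v \<in> verts G" if "v \<in> verts G" for v using bij_betwE[OF \<phi>] that by auto
  have \<psi>A: "\<psi> e \<in> arcs G" if "e \<in> arcs G" for e using bij_betwE[OF \<psi>] that by auto
  have inj\<phi>: "\<phi> u = \<phi> v \<longleftrightarrow> u = v" if "u \<in> verts G" "v \<in> verts G" for u v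
    using \<phi> that by (auto simp: bij_betw_def inj_on_eq_iff)
  have Z: "\<psi> e \<in> zero_arcs G s \<longleftrightarrow> e \<in> zero_arcs G t" if "e \<in> arcs G" for e
    using that \<psi>A by (simp add: zero_arcs_def t_def)
  have linkF: "(\<phi> a, \<phi> b) \<in> link G {\<psi> e} \<longleftrightarrow> (a, b) \<in> link G {e}"
    if "e \<in> arcs G" "a \<in> verts G" "b \<in> verts G" for a b e
  proof -
    have "(x, y) \<in> link G {e} \<longleftrightarrow> {x, y} = {tail G e, head G e}" for x y e
      by (auto simp: link_def doubleton_eq_iff)
    then have "(\<phi> a, \<phi> b) \<in> link G {\<psi> e} \<longleftrightarrow> \<phi> ` {a, b} = \<phi> ` {tail G e, head G e}"
      using ends[OF that(1)] by simp
    also have "\<dots> \<longleftrightarrow> {a, b} = {tail G e, head G e}"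
      using that \<phi> by (intro inj_on_image_eq_iff[of \<phi> "verts G"]) (auto simp: bij_betw_def)
    finally show ?thesis by (auto simp: link_def doubleton_eq_iff)
  qed
  have path1: "b \<in> verts G \<and> (\<phi> a, \<phi> b) \<in> (link G (zero_arcs G s))\<^sup>*"
    if "(a, b) \<in> (link G (zero_arcs G t))\<^sup>*" "a \<in> verts G" for a b
    using that(1)
  proof (induction rule: rtrancl_induct)
    case (step b c)
    then obtain e where e: "e \<in> zero_arcs G t" "(b, c) \<in> link G {e}" by (auto simp: link_def)
    then have eG: "e \<in> arcs G" by (simp add: zero_arcs_def)
    then have c: "c \<in> verts G" using e(2) by (auto simp: link_def)
    have "(\<phi> b, \<phi> c) \<in> link G {\<psi> e}" using linkF[OF eG _ c] e(2) step.IH by simp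
    then have "(\<phi> b, \<phi> c) \<in> link G (zero_arcs G s)"
      using link_mono[of "{\<psi> e}" "zero_arcs G s" G] Z[OF eG] e(1) by auto
    then show ?case using step.IH c by (auto intro: rtrancl_into_rtrancl)
  qed (use that in simp)
  have path2: "\<exists>b'\<in>verts G. b = \<phi> b' \<and> (a, b') \<in> (link G (zero_arcs G t))\<^sup>*"
    if "(\<phi> a, b) \<in> (link G (zero_arcs G s))\<^sup>*" "a \<in> verts G" for a b
    using that(1)
  proof (induction rule: rtrancl_induct)
    case (step b c)
    then obtain b' where b': "b' \<in> verts G" "b = \<phi> b'" "(a, b') \<in> (link G (zero_arcs G t))\<^sup>*"
      using step.IH by blast
    obtain e where e: "e \<in> zero_arcs G s" "(b, c) \<in> link G {e}" using step by (auto simp: link_def)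
    then have "e \<in> \<psi> ` arcs G" using bij_betw_imp_surj_on[OF \<psi>] by (simp add: zero_arcs_def)
    then obtain e' where e': "e' \<in> arcs G" "e = \<psi> e'" by auto
    have "c \<in> verts G" using e by (auto simp: link_def zero_arcs_def)
    then have "c \<in> \<phi> ` verts G" using bij_betw_imp_surj_on[OF \<phi>] by simp
    then obtain c' where c': "c' \<in> verts G" "c = \<phi> c'" by auto
    have "(b', c') \<in> link G {e'}" using linkF[OF e'(1) b'(1) c'(1)] e(2) by (simp add: b'(2) c'(2) e'(2))
    then have "(b', c') \<in> link G (zero_arcs G t)"
      using link_mono[of "{e'}" "zero_arcs G t" G] Z[OF e'(1)] e(1) e'(2) by auto
    then show ?case using b'(3) c' by (auto intro: rtrancl_into_rtrancl)
  qed (use that in auto)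
  have comp: "zcomp s (\<phi> v) = \<phi> ` zcomp t v" if v: "v \<in> verts G" for v
    using path1[OF _ v] path2[OF _ v] v \<phi>V by (auto simp: zero_component_eq wf_digraph)
  have sub: "zcomp t v \<subseteq> verts G" if "v \<in> verts G" for v by (rule comp_subset[OF that])
  have "wgraph_iso (fst (contract G w t)) (fst (snd (contract G w t)))
      (fst (contract G w s)) (fst (snd (contract G w s))) (image \<phi>) \<psi>"
    unfolding wgraph_iso_def
  proof (intro conjI ballI)
    have "inj_on (image \<phi>) (zcomp t ` verts G)"
    proof (rule inj_onI)
      fix A B assume "A \<in> zcomp t ` verts G" "B \<in> zcomp t ` verts G" "\<phi> ` A = \<phi> ` B"
      then show "A = B"
        using inj_on_image_eq_iff[of \<phi> "verts G" A B] \<phi> sub by (auto simp: bij_betw_def)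
    qed
    moreover have "image \<phi> ` zcomp t ` verts G = zcomp s ` verts G"
    proof -
      have "image \<phi> ` zcomp t ` verts G = zcomp s ` \<phi> ` verts G" by (auto simp: image_image comp)
      then show ?thesis using bij_betw_imp_surj_on[OF \<phi>] by simp
    qed
    ultimately show "bij_betw (image \<phi>) (verts (fst (contract G w t))) (verts (fst (contract G w s)))"
      by (simp add: bij_betw_def)
    have "\<psi> ` (arcs G - zero_arcs G t) = arcs G - zero_arcs G s"
    proof
      show "\<psi> ` (arcs G - zero_arcs G t) \<subseteq> arcs G - zero_arcs G s" using \<psi>A Z by auto
      show "arcs G - zero_arcs G s \<subseteq> \<psi> ` (arcs G - zero_arcs G t)"
      proof
        fix e assume e: "e \<in> arcs G - zero_arcs G s"
        then have "e \<in> \<psi> ` arcs G" using bij_betw_imp_surj_on[OF \<psi>] by simp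
        then show "e \<in> \<psi> ` (arcs G - zero_arcs G t)" using e Z by auto
      qed
    qed
    then show "bij_betw \<psi> (arcs (fst (contract G w t))) (arcs (fst (contract G w s)))"
      using \<psi> by (auto simp: bij_betw_def inj_on_def)
    fix e assume "e \<in> arcs (fst (contract G w t))"
    then have e: "e \<in> arcs G" by simp
    have "zcomp s ` {tail G (\<psi> e), head G (\<psi> e)} = zcomp s ` {\<phi> (tail G e), \<phi> (head G e)}"
      using ends[OF e] by simp
    then show "{tail (fst (contract G w s)) (\<psi> e), head (fst (contract G w s)) (\<psi> e)} =
        {\<phi> ` tail (fst (contract G w t)) e, \<phi> ` head (fst (contract G w t)) e}"
      using e by (simp add: comp)
  next
    fix C assume "C \<in> verts (fst (contract G w t))"
    then obtain v where v: "v \<in> verts G" "C = zcomp t v" by auto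
    have CG: "C \<subseteq> verts G" using sub v by simp
    have inj: "inj_on \<phi> C" using \<phi> CG by (auto simp: bij_betw_def intro: inj_on_subset)
    have C': "zcomp s (\<phi> v) = \<phi> ` C" using comp v by simp
    have "(\<Sum>u\<in>\<phi> ` C. int (w u)) = (\<Sum>u\<in>C. int (w u))"
      using CG by (simp add: sum.reindex[OF inj] weight subset_iff cong: sum.cong)
    moreover have "card (\<phi> ` C) = card C" using inj by (rule card_image)
    moreover have "card {e \<in> zero_arcs G s. tail G e \<in> \<phi> ` C} = card {e \<in> zero_arcs G t. tail G e \<in> C}"
    proof -
      \<comment> \<open>The automorphism may swap the ends of an edge, so tails need not go to
        tails; for an edge of length 0 it makes no difference which end is tested.\<close>
      have closedC: "tail G e \<in> zcomp s x \<longleftrightarrow> head G e \<in> zcomp s x" if "e \<in> zero_arcs G s" "x \<in> verts G" for e s x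
        using that zero_arc_comp[OF that(1)] mem_comp_iff[OF that(2)] by (auto simp: zero_arcs_def)
      have mem: "\<phi> u \<in> \<phi> ` C \<longleftrightarrow> u \<in> C" if "u \<in> verts G" for u
        using that CG inj\<phi> by auto
      have *: "tail G (\<psi> e) \<in> \<phi> ` C \<longleftrightarrow> tail G e \<in> C" if e: "e \<in> zero_arcs G t" for e
      proof -
        have eG: "e \<in> arcs G" using e by (simp add: zero_arcs_def)
        have "tail G (\<psi> e) = \<phi> (tail G e) \<or> tail G (\<psi> e) = \<phi> (head G e)"
          using ends[OF eG] by (auto simp: doubleton_eq_iff)
        moreover have "tail G e \<in> C \<longleftrightarrow> head G e \<in> C" using closedC[OF e v(1)] v(2) by simp
        ultimately show ?thesis
          using mem[OF tail_in_verts[OF eG]] mem[OF head_in_verts[OF eG]] by metis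
      qed
      have "\<psi> ` {e \<in> zero_arcs G t. tail G e \<in> C} = {e \<in> zero_arcs G s. tail G e \<in> \<phi> ` C}"
      proof
        show "\<psi> ` {e \<in> zero_arcs G t. tail G e \<in> C} \<subseteq> {e \<in> zero_arcs G s. tail G e \<in> \<phi> ` C}"
          using * Z by (auto simp: zero_arcs_def)
        show "{e \<in> zero_arcs G s. tail G e \<in> \<phi> ` C} \<subseteq> \<psi> ` {e \<in> zero_arcs G t. tail G e \<in> C}"
        proof
          fix e assume e: "e \<in> {e \<in> zero_arcs G s. tail G e \<in> \<phi> ` C}"
          then have "e \<in> \<psi> ` arcs G" using bij_betw_imp_surj_on[OF \<psi>] by (simp add: zero_arcs_def)
          then obtain e' where e': "e' \<in> arcs G" "e = \<psi> e'" by auto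
          then have z: "e' \<in> zero_arcs G t" using e Z by blast
          then show "e \<in> \<psi> ` {e \<in> zero_arcs G t. tail G e \<in> C}" using e e' *[OF z] by auto
        qed
      qed
      moreover have "inj_on \<psi> {e \<in> zero_arcs G t. tail G e \<in> C}"
        using \<psi> by (auto simp: bij_betw_def inj_on_def zero_arcs_def)
      ultimately show ?thesis using card_image[of \<psi> "{e \<in> zero_arcs G t. tail G e \<in> C}"] by simp
    qed
    ultimately have "fst (snd (contract G w s)) (zcomp s (\<phi> v)) = fst (snd (contract G w t)) (zcomp t v)"
      unfolding contract_weight[OF v(1)] using contract_weight[of "\<phi> v" s] \<phi>V[OF v(1)]
      unfolding C' v(2)[symmetric] by simp
    then show "fst (snd (contract G w s)) (\<phi> ` C) = fst (snd (contract G w t)) C"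
      unfolding C' v(2)[symmetric] .
  qed
  then have "trop_isomorphic (fst (contract G w t), fst (snd (contract G w t)), t)
      (fst (contract G w s), fst (snd (contract G w s)), s)"
    unfolding trop_isomorphic.simps by (intro exI conjI) (auto simp: t_def)
  then show ?thesis by (simp only: contract_eq[symmetric] t_def[symmetric])
qed

end

section \<open>The moduli space\<close>

lemma topspace_orthant: "topspace (orthant G) = (\<Pi>\<^sub>E e\<in>arcs G. {0..})"
  by (simp add: orthant_def)

section \<open>Openness on a closed cell\<close>

context graph_family
begin

lemma good_contract_orthant: "s \<in> topspace (orthant G) \<Longrightarrow> good_curve (contract G w s)"
  by (rule good_contract) (auto simp: topspace_orthant)

text \<open>Finiteness of the edge set makes the boxes of radius \<open>1 / (n + 1)\<close> around
  \<open>s\<close> open. If each of them met the set where the rank is at least \<rho>, points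
  chosen there would converge to \<open>s\<close>, and the limit theorem would give \<open>s\<close>
  the same bound.\<close>

lemma openin_orthant_bn_rank_less:
  assumes \<epsilon>: "0 < \<epsilon>"
  shows "openin (orthant G) {s \<in> topspace (orthant G). \<not> \<rho> \<le> bn_rank \<epsilon> r d (contract G w s)}"
    (is "openin _ ?U")
proof (subst openin_subopen, intro ballI)
  fix s assume s: "s \<in> ?U"
  define B where "B n = (\<Pi>\<^sub>E e\<in>arcs G. {0..} \<inter> ball (s e) (inverse (real (Suc n))))" for n
  have B_open: "openin (orthant G) (B n)" for n
    unfolding B_def orthant_def by (subst openin_PiE) (auto simp: openin_open)
  have sB: "s \<in> B n" for n
    using s by (auto simp: B_def topspace_orthant PiE_iff)
  have Bsub: "B n \<subseteq> topspace (orthant G)" for n using openin_subset[OF B_open] .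
  have "\<exists>n. B n \<subseteq> ?U"
  proof (rule ccontr)
    assume "\<nexists>n. B n \<subseteq> ?U"
    then have "\<exists>t. t \<in> B n \<and> \<rho> \<le> bn_rank \<epsilon> r d (contract G w t)" for n
      using Bsub[of n] by blast
    then obtain S where S: "\<And>n. S n \<in> B n" "\<And>n. \<rho> \<le> bn_rank \<epsilon> r d (contract G w (S n))" by metis
    have ST: "S n \<in> topspace (orthant G)" for n using S(1) Bsub by blast
    have lim: "(\<lambda>n. S n e) \<longlonglongrightarrow> s e" if "e \<in> arcs G" for e
    proof (rule metric_LIMSEQ_I)
      fix \<delta> :: real assume "0 < \<delta>"
      then obtain N where N: "inverse (real (Suc N)) < \<delta>" using reals_Archimedean by blast
      have "dist (S n e) (s e) < \<delta>" if "N \<le> n" for n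
      proof -
        have "dist (s e) (S n e) < inverse (real (Suc n))"
          using S(1)[of n] \<open>e \<in> arcs G\<close> by (auto simp: B_def PiE_iff)
        also have "\<dots> \<le> inverse (real (Suc N))" using that by (intro le_imp_inverse_le) auto
        finally show ?thesis using N by (simp add: dist_commute)
      qed
      then show "\<exists>N. \<forall>n\<ge>N. dist (S n e) (s e) < \<delta>" by blast
    qed
    \<comment> \<open>There are finitely many strata, so one vanishing set recurs; this puts a
      subsequence on a single graph.\<close>
    have "zero_arcs G (S n) \<in> Pow (arcs G)" for n by (auto simp: zero_arcs_def)
    then obtain \<sigma> :: "nat \<Rightarrow> nat" and Z where \<sigma>: "strict_mono \<sigma>" "\<And>n. zero_arcs G (S (\<sigma> n)) = Z"
      using constant_subseq[of "Pow (arcs G)" "\<lambda>n. zero_arcs G (S n)"] by (metis finite_Pow_iff finite_arcs)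
    have good: "good_curve (contract G w s)" using s good_contract_orthant by simp
    have "\<rho> \<le> bn_rank \<epsilon> r d (contract G w s)"
    \<comment> \<open>For negative \<rho> the bound is automatic, as the rank never drops below
      -1.\<close>
    proof (cases "0 \<le> \<rho>")
      case True
      then obtain k where k: "\<rho> = int k" by (rule nonneg_int_cases)
      have P: "bn_property \<epsilon> r d (int r + int k) (contract G w (S n))" for n
        using S(2)[of n] good_curve_bn_rank(2)[OF good_contract_orthant[OF ST] \<epsilon>] by (simp add: k)
      have "bn_property \<epsilon> r d (int r + int k) (contract G w s)"
      proof (rule bn_property_contract_limit[OF \<epsilon>])
        show "0 \<le> S (\<sigma> n) e" if "e \<in> arcs G" for n e
          using ST[of "\<sigma> n"] that by (auto simp: topspace_orthant)
        show "(\<lambda>n. S (\<sigma> n) e) \<longlonglongrightarrow> s e" if "e \<in> arcs G" for e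
          using LIMSEQ_subseq_LIMSEQ[OF lim[OF that] \<sigma>(1)] by (simp add: o_def)
        show "zero_arcs G (S (\<sigma> n)) = zero_arcs G (S (\<sigma> 0))" for n by (simp add: \<sigma>(2))
        show "bn_property \<epsilon> r d (int r + int k) (contract G w (S (\<sigma> n)))" for n by (rule P)
      qed
      then show ?thesis using good_curve_bn_rank(2)[OF good \<epsilon>] by (simp add: k)
    next
      case False
      then show ?thesis using good_curve_bn_rank(1)[OF good \<epsilon>, of r d] by linarith
    qed
    then show False using s by simp
  qed
  then obtain n where "B n \<subseteq> ?U" ..
  then show "\<exists>T. openin (orthant G) T \<and> s \<in> T \<and> T \<subseteq> ?U" using B_open sB by blast
qed

lemma aut_orbit_self:
  assumes "s \<in> topspace (orthant G)"
  shows "s \<in> aut_orbit G w s"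
proof -
  have "wgraph_iso G w G w (\<lambda>v. v) (\<lambda>e. e)"
    by (simp add: wgraph_iso_def bij_betw_def inj_on_def)
  \<comment> \<open>Members of the orthant are extensional on \<open>arcs G\<close>, so restriction
    returns them unchanged.\<close>
  moreover have "s = restrict (s \<circ> (\<lambda>e. e)) (arcs G)"
    using assms by (auto simp: topspace_orthant PiE_iff extensional_def fun_eq_iff)
  ultimately show ?thesis unfolding aut_orbit_def by blast
qed

lemma orbit_rank:
  assumes \<epsilon>: "0 < \<epsilon>" and s: "s \<in> topspace (orthant G)" and \<Gamma>: "\<Gamma> \<in> contract G w ` aut_orbit G w s"
  shows "good_curve \<Gamma>" "bn_rank \<epsilon> r d \<Gamma> = bn_rank \<epsilon> r d (contract G w s)"
proof -
  obtain \<phi> \<psi> where iso: "wgraph_iso G w G w \<phi> \<psi>" and \<Gamma>: "\<Gamma> = contract G w (restrict (s \<circ> \<psi>) (arcs G))"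
    using \<Gamma> by (auto simp: aut_orbit_def)
  have "\<psi> e \<in> arcs G" if "e \<in> arcs G" for e
    using iso that by (auto simp: wgraph_iso_def dest: bij_betwE)
  then show good: "good_curve \<Gamma>"
    unfolding \<Gamma> using s by (intro good_contract) (auto simp: topspace_orthant)
  show "bn_rank \<epsilon> r d \<Gamma> = bn_rank \<epsilon> r d (contract G w s)"
    using contract_automorphism[OF iso, of s] unfolding \<Gamma>[symmetric]
    by (rule bn_rank_iso[OF \<epsilon> good good_contract_orthant[OF s]])
qed

end

section \<open>Passage to the moduli space\<close>

lemma graph_family_comb_types: "(G, w) \<in> comb_types g \<Longrightarrow> graph_family G"
  by (auto simp: comb_types_def intro: graph_family.intro)

lemma cells_cases:
  assumes "x \<in> topspace (cells g)"
  obtains G w s where "x = ((G, w), aut_orbit G w s)" "(G, w) \<in> comb_types g" "s \<in> topspace (orthant G)"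
  using assms by (auto simp: cells_def closed_cell_def)

lemma curves_at_rank:
  assumes \<epsilon>: "0 < \<epsilon>" and x: "x \<in> topspace (cells g)" and \<Gamma>: "\<Gamma> \<in> curves_at x" and \<Delta>: "\<Delta> \<in> curves_at x"
  shows "good_curve \<Gamma>" "bn_rank \<epsilon> r d \<Gamma> = bn_rank \<epsilon> r d \<Delta>"
proof -
  obtain G w s where *: "x = ((G, w), aut_orbit G w s)" "(G, w) \<in> comb_types g" "s \<in> topspace (orthant G)"
    using x by (rule cells_cases)
  interpret graph_family G w by (rule graph_family_comb_types[OF *(2)])
  show "good_curve \<Gamma>" "bn_rank \<epsilon> r d \<Gamma> = bn_rank \<epsilon> r d \<Delta>"
    using orbit_rank[OF \<epsilon> *(3), of \<Gamma>] orbit_rank[OF \<epsilon> *(3), of \<Delta>] \<Gamma> \<Delta> by (auto simp: *(1))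
qed

text \<open>\<open>cell_equiv\<close> compares only some pair of curves; constancy of the rank on
  each orbit and invariance under that one isomorphism give a single value on the whole
  class.\<close>

lemma bn_rank_M_tr_eq:
  assumes \<epsilon>: "0 < \<epsilon>" and x: "x \<in> topspace (cells g)" and \<Gamma>: "\<Gamma> \<in> curves_at x"
  shows "bn_rank_M_tr \<epsilon> r d (cell_class g x) = bn_rank \<epsilon> r d \<Gamma>"
proof -
  have "bn_rank \<epsilon> r d \<Delta> = bn_rank \<epsilon> r d \<Gamma>" if "y \<in> cell_class g x" "\<Delta> \<in> curves_at y" for y \<Delta>
  proof -
    have y: "y \<in> topspace (cells g)" "cell_equiv x y" using that by (auto simp: cell_class_def)
    then obtain \<Gamma>' \<Delta>' where iso: "\<Gamma>' \<in> curves_at x" "\<Delta>' \<in> curves_at y" "trop_isomorphic \<Gamma>' \<Delta>'"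
      by (auto simp: cell_equiv_def)
    have "bn_rank \<epsilon> r d \<Gamma>' = bn_rank \<epsilon> r d \<Delta>'"
      using bn_rank_iso[OF \<epsilon> curves_at_rank(1)[OF \<epsilon> x iso(1,1)] curves_at_rank(1)[OF \<epsilon> y(1) iso(2,2)] iso(3)] .
    then show ?thesis
      using curves_at_rank(2)[OF \<epsilon> x \<Gamma> iso(1)] curves_at_rank(2)[OF \<epsilon> y(1) that(2) iso(2)] by metis
  qed
  moreover have "x \<in> cell_class g x"
  proof -
    obtain G w l where "\<Gamma> = (G, w, l)" by (cases \<Gamma>)
    then have "trop_isomorphic \<Gamma> \<Gamma>"
      by (auto simp: wgraph_iso_def bij_betw_def inj_on_def intro!: exI[of _ "\<lambda>v. v"])
    then show ?thesis using x \<Gamma> by (auto simp: cell_class_def cell_equiv_def)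
  qed
  ultimately have "bn_rank \<epsilon> r d ` (\<Union>y\<in>cell_class g x. curves_at y) = {bn_rank \<epsilon> r d \<Gamma>}"
    using \<Gamma> by blast
  then show ?thesis by (simp add: bn_rank_M_tr_def)
qed

theorem theorem5p4:
  fixes g r d :: nat and \<epsilon> :: real
  assumes "0 < \<epsilon>"
  shows "upper_semicontinuous_map (M_tr g) (bn_rank_M_tr \<epsilon> r d)"
  unfolding upper_semicontinuous_map_def
proof
  fix \<rho> :: int
  let ?V = "{X \<in> topspace (M_tr g). \<not> \<rho> \<le> bn_rank_M_tr \<epsilon> r d X}"
  let ?W = "{x \<in> topspace (cells g). cell_class g x \<in> ?V}"
  \<comment> \<open>The topology is built from two quotients and a disjoint union, so openness of
    the complement is checked after pulling back to the orthant of each type.\<close>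
  have "openin (closed_cell i) {S. (i, S) \<in> ?W}" if i: "i \<in> comb_types g" for i
  proof -
    obtain G w where Gw: "i = (G, w)" by (cases i)
    interpret graph_family G w using i unfolding Gw by (rule graph_family_comb_types)
    let ?U = "{s \<in> topspace (orthant G). \<not> \<rho> \<le> bn_rank \<epsilon> r d (contract G w s)}"
    have cell: "closed_cell i = quotient_topology (orthant G) (aut_orbit G w)" by (simp add: closed_cell_def Gw)
    have mem: "(i, aut_orbit G w s) \<in> ?W \<longleftrightarrow> \<not> \<rho> \<le> bn_rank \<epsilon> r d (contract G w s)"
      if s: "s \<in> topspace (orthant G)" for s
    proof -
      have x: "(i, aut_orbit G w s) \<in> topspace (cells g)"
        using i s by (auto simp: cells_def cell)
      have "contract G w s \<in> curves_at (i, aut_orbit G w s)"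
        using aut_orbit_self[OF s] by (simp add: Gw)
      from bn_rank_M_tr_eq[OF assms x this] x show ?thesis by (simp add: M_tr_def)
    qed
    have "{S. (i, S) \<in> ?W} \<subseteq> aut_orbit G w ` topspace (orthant G)"
      by (auto simp: cells_def cell)
    moreover have "{s \<in> topspace (orthant G). aut_orbit G w s \<in> {S. (i, S) \<in> ?W}} = ?U"
      using mem by blast
    ultimately show ?thesis
      unfolding cell openin_quotient_topology using openin_orthant_bn_rank_less[OF assms] by simp
  qed
  then have "openin (cells g) ?W"
    unfolding cells_def openin_sum_topology by (auto simp: o_def)
  then have "openin (M_tr g) ?V"
    unfolding M_tr_def openin_quotient_topology by auto
  moreover have "topspace (M_tr g) - {X \<in> topspace (M_tr g). \<rho> \<le> bn_rank_M_tr \<epsilon> r d X} = ?V" by auto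
  ultimately show "closedin (M_tr g) {X \<in> topspace (M_tr g). \<rho> \<le> bn_rank_M_tr \<epsilon> r d X}"
    by (auto simp: closedin_def)
qed

end
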